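(* Let $N$ be a finitely generated residually finite discrete group, let $K$ be a discrete group with property (F), and let $\Gamma=N\rtimes K$ be a semidirect product (with $N$ normal in $\Gamma$ and $K$ acting on $N$ by automorphisms). Then $\Gamma$ has property (F).
   Context: All groups here are ordinary discrete groups. A group is residually finite if every non-trivial element has non-trivial image in some finite quotient. Amenable trace: a tracial state $\tau$ on a unital $C^*$-algebra $A$ is amenable if there is a net of unital completely positive maps $\varphi_k:A\to M_{n_k}(\mathbb{C})$ such that $\mathrm{tr}_{n_k}(\varphi_k(a))\to\tau(a)$ and $\|\varphi_k(a^*b)-\varphi_k(a)^*\varphi_k(b)\|_{2,n_k}\to 0$ for all $a,b\in A$, where $\mathrm{tr}_n$ is the normalized trace on $M_n(\mathbb{C})$ and $\|x\|_{2,n}=\mathrm{tr}_n(x^*x)^{1/2}$. Property (F) (Kirchberg factorization property): a discrete group $\Gamma$ has property (F) if the canonical trace $\tau$ on the full group $C^*$-algebra $C^*(\Gamma)$, $\tau(\gamma)=\delta_{\gamma,e}$, is amenable. Equivalently, the representation of $C^*(\Gamma)\otimes_{\max}C^*(\Gamma)^{op}$ on $\ell^2(\Gamma)$ given by the left and right translation actions factors through $C^*(\Gamma)\otimes_{\min}C^*(\Gamma)^{op}$. *)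

theory Defs
  imports
    "HOL-Algebra.Bij"
    "HOL-Algebra.Generated_Groups"
    "HOL-Algebra.QuotRing"
    "HOL-Analysis.Analysis"
    "Jordan_Normal_Form.Schur_Decomposition"
begin

hide_const (open) Polynomial.smult Multiset.mult

section \<open>Unital \<open>*\<close>-algebras and \<open>C\<^sup>*\<close>-algebras\<close>

record 'a star_alg = "(complex, 'a) module" +
  adj :: "'a \<Rightarrow> 'a"

record 'a normed_star_alg = "'a star_alg" +
  nrm :: "'a \<Rightarrow> real"

locale unital_star_algebra = R: ring A + M: module "class_ring :: complex ring" A
  for A :: "('a, 'm) star_alg_scheme" (structure) +
  assumes smult_mult_left:
      "\<lbrakk>x \<in> carrier A; y \<in> carrier A\<rbrakk> \<Longrightarrow> (c \<odot> x) \<otimes> y = c \<odot> (x \<otimes> y)"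
    and smult_mult_right:
      "\<lbrakk>x \<in> carrier A; y \<in> carrier A\<rbrakk> \<Longrightarrow> x \<otimes> (c \<odot> y) = c \<odot> (x \<otimes> y)"
    and adj_closed: "x \<in> carrier A \<Longrightarrow> adj A x \<in> carrier A"
    and adj_adj: "x \<in> carrier A \<Longrightarrow> adj A (adj A x) = x"
    and adj_add:
      "\<lbrakk>x \<in> carrier A; y \<in> carrier A\<rbrakk> \<Longrightarrow> adj A (x \<oplus> y) = adj A x \<oplus> adj A y"
    and adj_smult: "x \<in> carrier A \<Longrightarrow> adj A (c \<odot> x) = cnj c \<odot> adj A x"
    and adj_mult:
      "\<lbrakk>x \<in> carrier A; y \<in> carrier A\<rbrakk> \<Longrightarrow> adj A (x \<otimes> y) = adj A y \<otimes> adj A x"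

definition cstar_seminorm :: "('a, 'm) star_alg_scheme \<Rightarrow> ('a \<Rightarrow> real) \<Rightarrow> bool" where
  "cstar_seminorm A p \<longleftrightarrow>
     (\<forall>x\<in>carrier A. 0 \<le> p x) \<and>
     (\<forall>c. \<forall>x\<in>carrier A. p (c \<odot>\<^bsub>A\<^esub> x) = cmod c * p x) \<and>
     (\<forall>x\<in>carrier A. \<forall>y\<in>carrier A. p (x \<oplus>\<^bsub>A\<^esub> y) \<le> p x + p y) \<and>
     (\<forall>x\<in>carrier A. \<forall>y\<in>carrier A. p (x \<otimes>\<^bsub>A\<^esub> y) \<le> p x * p y) \<and>
     (\<forall>x\<in>carrier A. p (adj A x \<otimes>\<^bsub>A\<^esub> x) = (p x)\<^sup>2)"

definition cauchy_seqs :: "('a, 'm) normed_star_alg_scheme \<Rightarrow> (nat \<Rightarrow> 'a) set" where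
  "cauchy_seqs A = {X. range X \<subseteq> carrier A \<and>
     (\<forall>e>0. \<exists>N. \<forall>m\<ge>N. \<forall>n\<ge>N. nrm A (X m \<ominus>\<^bsub>A\<^esub> X n) < e)}"

locale unital_cstar_algebra = unital_star_algebra A
  for A :: "('a, 'm) normed_star_alg_scheme" (structure) +
  assumes cstar_seminorm_nrm: "cstar_seminorm A (nrm A)"
    and nrm_definite: "\<lbrakk>x \<in> carrier A; nrm A x = 0\<rbrakk> \<Longrightarrow> x = \<zero>"
    and complete: "X \<in> cauchy_seqs A \<Longrightarrow>
      \<exists>x\<in>carrier A. (\<lambda>n. nrm A (X n \<ominus> x)) \<longlonglongrightarrow> 0"


section \<open>Separation and completion of a seminormed \<open>*\<close>-algebra\<close>

definition cauchy_ring :: "('a, 'm) normed_star_alg_scheme \<Rightarrow> (nat \<Rightarrow> 'a) ring" where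
  "cauchy_ring A =
    \<lparr>carrier = cauchy_seqs A,
     mult = (\<lambda>X Y n. X n \<otimes>\<^bsub>A\<^esub> Y n), one = (\<lambda>n. \<one>\<^bsub>A\<^esub>),
     zero = (\<lambda>n. \<zero>\<^bsub>A\<^esub>), add = (\<lambda>X Y n. X n \<oplus>\<^bsub>A\<^esub> Y n)\<rparr>"

definition null_seqs :: "('a, 'm) normed_star_alg_scheme \<Rightarrow> (nat \<Rightarrow> 'a) set" where
  "null_seqs A = {X \<in> cauchy_seqs A. (\<lambda>n. nrm A (X n)) \<longlonglongrightarrow> 0}"

text \<open>Cauchy sequences modulo null sequences. As in \<^const>\<open>rcoset_mult\<close>, an operation on a coset
  is the union of the (coinciding) cosets obtained from its representatives.\<close>

definition star_completion ::
  "('a, 'm) normed_star_alg_scheme \<Rightarrow> (nat \<Rightarrow> 'a) set normed_star_alg" where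
  "star_completion A = (let Q = cauchy_ring A Quot null_seqs A in
    \<lparr>carrier = carrier Q, mult = mult Q, one = one Q, zero = zero Q, add = add Q,
     smult = (\<lambda>c S. \<Union>X\<in>S. null_seqs A +>\<^bsub>cauchy_ring A\<^esub> (\<lambda>n. c \<odot>\<^bsub>A\<^esub> X n)),
     adj = (\<lambda>S. \<Union>X\<in>S. null_seqs A +>\<^bsub>cauchy_ring A\<^esub> (\<lambda>n. adj A (X n))),
     nrm = (\<lambda>S. THE r. \<forall>X\<in>S. (\<lambda>n. nrm A (X n)) \<longlonglongrightarrow> r)\<rparr>)"


section \<open>The full group \<open>C\<^sup>*\<close>-algebra\<close>

definition group_alg :: "('g, 'b) monoid_scheme \<Rightarrow> ('g \<Rightarrow> complex) star_alg" where
  "group_alg G =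
    \<lparr>carrier = {f. finite {x. f x \<noteq> 0} \<and> {x. f x \<noteq> 0} \<subseteq> carrier G},
     mult = (\<lambda>f h x. \<Sum>(y, z) \<in> {(y, z). f y \<noteq> 0 \<and> h z \<noteq> 0 \<and> y \<otimes>\<^bsub>G\<^esub> z = x}. f y * h z),
     one = (\<lambda>x. if x = \<one>\<^bsub>G\<^esub> then 1 else 0),
     zero = (\<lambda>x. 0),
     add = (\<lambda>f h x. f x + h x),
     smult = (\<lambda>c f x. c * f x),
     adj = (\<lambda>f x. if x \<in> carrier G then cnj (f (inv\<^bsub>G\<^esub> x)) else 0)\<rparr>"

text \<open>The universal norm: the largest \<open>C\<^sup>*\<close>-seminorm on the group algebra. By the
  Gelfand--Naimark theorem every \<open>C\<^sup>*\<close>-seminorm is the norm of some unitary representation on a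
  Hilbert space, so this is the supremum over all unitary representations; the seminorms avoid a
  quantification over the carrier types of Hilbert spaces.\<close>

definition full_norm :: "('g, 'b) monoid_scheme \<Rightarrow> ('g \<Rightarrow> complex) \<Rightarrow> real" where
  "full_norm G f = (SUP p \<in> {p. cstar_seminorm (group_alg G) p}. p f)"

definition normed_group_alg :: "('g, 'b) monoid_scheme \<Rightarrow> ('g \<Rightarrow> complex) normed_star_alg" where
  "normed_group_alg G = star_alg.extend (group_alg G) \<lparr>nrm = full_norm G\<rparr>"

definition group_cstar ::
  "('g, 'b) monoid_scheme \<Rightarrow> (nat \<Rightarrow> 'g \<Rightarrow> complex) set normed_star_alg" where
  "group_cstar G = star_completion (normed_group_alg G)"

text \<open>The continuous extension of \<open>f \<mapsto> f(e)\<close>, i.e. of \<open>\<gamma> \<mapsto> \<delta>\<^bsub>\<gamma>,e\<^esub>\<close>, to the completion.\<close>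

definition canonical_trace ::
  "('g, 'b) monoid_scheme \<Rightarrow> (nat \<Rightarrow> 'g \<Rightarrow> complex) set \<Rightarrow> complex" where
  "canonical_trace G S = (THE z. \<forall>X\<in>S. (\<lambda>n. X n \<one>\<^bsub>G\<^esub>) \<longlonglongrightarrow> z)"


section \<open>Unital completely positive maps\<close>

definition positive_elem :: "('a, 'm) star_alg_scheme \<Rightarrow> 'a \<Rightarrow> bool" where
  "positive_elem A x \<longleftrightarrow> (\<exists>y\<in>carrier A. x = adj A y \<otimes>\<^bsub>A\<^esub> y)"

definition matrix_alg :: "nat \<Rightarrow> ('a, 'm) star_alg_scheme \<Rightarrow> 'a mat star_alg" where
  "matrix_alg m A =
    \<lparr>carrier = {X \<in> carrier_mat m m. elements_mat X \<subseteq> carrier A},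
     mult = (\<lambda>X Y. mat m m (\<lambda>(i, j). \<Oplus>\<^bsub>A\<^esub>k\<in>{..<m}. X $$ (i, k) \<otimes>\<^bsub>A\<^esub> Y $$ (k, j))),
     one = mat m m (\<lambda>(i, j). if i = j then \<one>\<^bsub>A\<^esub> else \<zero>\<^bsub>A\<^esub>),
     zero = mat m m (\<lambda>_. \<zero>\<^bsub>A\<^esub>),
     add = (\<lambda>X Y. mat m m (\<lambda>ij. X $$ ij \<oplus>\<^bsub>A\<^esub> Y $$ ij)),
     smult = (\<lambda>c X. mat m m (\<lambda>ij. c \<odot>\<^bsub>A\<^esub> X $$ ij)),
     adj = (\<lambda>X. mat m m (\<lambda>(i, j). adj A (X $$ (j, i))))\<rparr>"

definition complex_mat_alg :: "nat \<Rightarrow> complex mat star_alg" where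
  "complex_mat_alg n = module.extend (module_mat TYPE(complex) n n) \<lparr>adj = mat_adjoint\<rparr>"

definition completely_positive ::
  "('a, 'm) star_alg_scheme \<Rightarrow> ('b, 'k) star_alg_scheme \<Rightarrow> ('a \<Rightarrow> 'b) \<Rightarrow> bool" where
  "completely_positive A B \<phi> \<longleftrightarrow>
     (\<forall>m X. positive_elem (matrix_alg m A) X \<longrightarrow> positive_elem (matrix_alg m B) (map_mat \<phi> X))"

definition linear_on :: "('a, 'm) star_alg_scheme \<Rightarrow> ('b, 'k) star_alg_scheme \<Rightarrow> ('a \<Rightarrow> 'b) \<Rightarrow> bool" where
  "linear_on A B \<phi> \<longleftrightarrow>
     \<phi> \<in> carrier A \<rightarrow> carrier B \<and>
     (\<forall>x\<in>carrier A. \<forall>y\<in>carrier A. \<phi> (x \<oplus>\<^bsub>A\<^esub> y) = \<phi> x \<oplus>\<^bsub>B\<^esub> \<phi> y) \<and>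
     (\<forall>c. \<forall>x\<in>carrier A. \<phi> (c \<odot>\<^bsub>A\<^esub> x) = c \<odot>\<^bsub>B\<^esub> \<phi> x)"

definition ucp :: "('a, 'm) star_alg_scheme \<Rightarrow> ('b, 'k) star_alg_scheme \<Rightarrow> ('a \<Rightarrow> 'b) \<Rightarrow> bool" where
  "ucp A B \<phi> \<longleftrightarrow> linear_on A B \<phi> \<and> \<phi> \<one>\<^bsub>A\<^esub> = \<one>\<^bsub>B\<^esub> \<and> completely_positive A B \<phi>"


section \<open>Amenable traces and property (F)\<close>

definition tracial_state :: "('a, 'm) star_alg_scheme \<Rightarrow> ('a \<Rightarrow> complex) \<Rightarrow> bool" where
  "tracial_state A \<tau> \<longleftrightarrow>
     (\<forall>x\<in>carrier A. \<forall>y\<in>carrier A. \<tau> (x \<oplus>\<^bsub>A\<^esub> y) = \<tau> x + \<tau> y) \<and>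
     (\<forall>c. \<forall>x\<in>carrier A. \<tau> (c \<odot>\<^bsub>A\<^esub> x) = c * \<tau> x) \<and>
     (\<forall>x\<in>carrier A. \<tau> (adj A x \<otimes>\<^bsub>A\<^esub> x) \<in> \<real> \<and> 0 \<le> Re (\<tau> (adj A x \<otimes>\<^bsub>A\<^esub> x))) \<and>
     \<tau> \<one>\<^bsub>A\<^esub> = 1 \<and>
     (\<forall>x\<in>carrier A. \<forall>y\<in>carrier A. \<tau> (x \<otimes>\<^bsub>A\<^esub> y) = \<tau> (y \<otimes>\<^bsub>A\<^esub> x))"

definition ntr :: "nat \<Rightarrow> complex mat \<Rightarrow> complex" where
  "ntr n x = (\<Sum>i<n. x $$ (i, i)) / of_nat n"

definition norm2 :: "nat \<Rightarrow> complex mat \<Rightarrow> real" where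
  "norm2 n x = sqrt (Re (ntr n (mat_adjoint x * x)))"

text \<open>A net \<open>(n\<^sub>k, \<phi>\<^sub>k)\<close> enters through its eventuality filter on the set of pairs \<open>(n, \<phi>)\<close>:
  convergence along the net is convergence along this filter, and every proper filter arises from
  a net.\<close>

definition amenable_trace ::
  "('a, 'm) normed_star_alg_scheme \<Rightarrow> ('a \<Rightarrow> complex) \<Rightarrow> bool" where
  "amenable_trace A \<tau> \<longleftrightarrow>
     unital_cstar_algebra A \<and> tracial_state A \<tau> \<and>
     (\<exists>\<F> :: (nat \<times> ('a \<Rightarrow> complex mat)) filter.
        \<F> \<noteq> bot \<and>
        (\<forall>\<^sub>F (n, \<phi>) in \<F>. 0 < n \<and> ucp A (complex_mat_alg n) \<phi>) \<and>
        (\<forall>a\<in>carrier A. ((\<lambda>(n, \<phi>). ntr n (\<phi> a)) \<longlongrightarrow> \<tau> a) \<F>) \<and>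
        (\<forall>a\<in>carrier A. \<forall>b\<in>carrier A.
           ((\<lambda>(n, \<phi>). norm2 n (\<phi> (adj A a \<otimes>\<^bsub>A\<^esub> b) - mat_adjoint (\<phi> a) * \<phi> b)) \<longlongrightarrow> 0) \<F>))"

definition property_F :: "('g, 'b) monoid_scheme \<Rightarrow> bool" where
  "property_F G \<longleftrightarrow> amenable_trace (group_cstar G) (canonical_trace G)"


section \<open>Groups\<close>

definition finitely_generated :: "('g, 'b) monoid_scheme \<Rightarrow> bool" where
  "finitely_generated G \<longleftrightarrow> (\<exists>S. finite S \<and> S \<subseteq> carrier G \<and> generate G S = carrier G)"

definition residually_finite :: "('g, 'b) monoid_scheme \<Rightarrow> bool" where
  "residually_finite G \<longleftrightarrow>
     (\<forall>x\<in>carrier G. x \<noteq> \<one>\<^bsub>G\<^esub> \<longrightarrow>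
        (\<exists>H. H \<lhd> G \<and> finite (carrier (G Mod H)) \<and> H #>\<^bsub>G\<^esub> x \<noteq> \<one>\<^bsub>G Mod H\<^esub>))"

definition semidirect_product ::
  "('a, 'm) monoid_scheme \<Rightarrow> ('b, 'k) monoid_scheme \<Rightarrow> ('b \<Rightarrow> 'a \<Rightarrow> 'a) \<Rightarrow> ('a \<times> 'b) monoid" where
  "semidirect_product N K \<theta> =
    \<lparr>carrier = carrier N \<times> carrier K,
     mult = (\<lambda>(n, k) (n', k'). (n \<otimes>\<^bsub>N\<^esub> \<theta> k n', k \<otimes>\<^bsub>K\<^esub> k')),
     one = (\<one>\<^bsub>N\<^esub>, \<one>\<^bsub>K\<^esub>)\<rparr>"


section \<open>The full group \<open>C\<^sup>*\<close>-algebra is a \<open>C\<^sup>*\<close>-algebra\<close>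

locale seminormed_star_algebra = unital_star_algebra A for A :: "('a, 'm) normed_star_alg_scheme" (structure) +
  assumes csn: "cstar_seminorm A (nrm A)"
begin

abbreviation "CR \<equiv> cauchy_ring A"
abbreviation "NS \<equiv> null_seqs A"

lemma nn: "x \<in> carrier A \<Longrightarrow> 0 \<le> nrm A x"
  and nsm: "x \<in> carrier A \<Longrightarrow> nrm A (c \<odot> x) = cmod c * nrm A x"
  and ntri: "\<lbrakk>x \<in> carrier A; y \<in> carrier A\<rbrakk> \<Longrightarrow> nrm A (x \<oplus> y) \<le> nrm A x + nrm A y"
  and nmul: "\<lbrakk>x \<in> carrier A; y \<in> carrier A\<rbrakk> \<Longrightarrow> nrm A (x \<otimes> y) \<le> nrm A x * nrm A y"
  and ncs: "x \<in> carrier A \<Longrightarrow> nrm A (adj A x \<otimes> x) = (nrm A x)\<^sup>2"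
  using csn unfolding cstar_seminorm_def by auto

lemma sm_closed[simp,intro]: "x \<in> carrier A \<Longrightarrow> c \<odot> x \<in> carrier A"
  using M.smult_closed by simp
lemma sm_one[simp]: "x \<in> carrier A \<Longrightarrow> 1 \<odot> x = x"
  using M.smult_one by simp
lemma sm_l: "x \<in> carrier A \<Longrightarrow> (a + b) \<odot> x = a \<odot> x \<oplus> b \<odot> x"
  using M.smult_l_distr[of a b x] by simp
lemma sm_r: "\<lbrakk>x \<in> carrier A; y \<in> carrier A\<rbrakk> \<Longrightarrow> a \<odot> (x \<oplus> y) = a \<odot> x \<oplus> a \<odot> y"
  using M.smult_r_distr[of a x y] by simp
lemma sm_assoc: "x \<in> carrier A \<Longrightarrow> (a * b) \<odot> x = a \<odot> (b \<odot> x)"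
  using M.smult_assoc1[of a b x] by simp
lemma sm_zero[simp]: "x \<in> carrier A \<Longrightarrow> 0 \<odot> x = \<zero>"
proof -
  assume x: "x \<in> carrier A"
  have "0 \<odot> x \<oplus> 0 \<odot> x = 0 \<odot> x" using sm_l[OF x, of 0 0] by simp
  thus ?thesis using x by (metis R.add.l_cancel_one' R.add.m_closed sm_closed)
qed
lemma sm_m1: "x \<in> carrier A \<Longrightarrow> (-1) \<odot> x = \<ominus> x"
proof -
  assume x: "x \<in> carrier A"
  have "(-1) \<odot> x \<oplus> x = \<zero>" using sm_l[OF x, of "-1" 1] x by simp
  thus ?thesis using x by (simp add: R.minus_equality)
qed
lemma sm_neg: "x \<in> carrier A \<Longrightarrow> c \<odot> (\<ominus> x) = \<ominus> (c \<odot> x)"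
  using sm_m1[of x] sm_m1[of "c \<odot> x"] sm_assoc[of x c "-1"] sm_assoc[of x "-1" c] by simp
lemma adj_zero: "adj A \<zero> = \<zero>"
  using adj_smult[of \<zero> 0] adj_closed[of \<zero>] by simp
lemma adj_neg: "x \<in> carrier A \<Longrightarrow> adj A (\<ominus> x) = \<ominus> adj A x"
  using adj_smult[of x "-1"] adj_closed[of x] by (simp add: sm_m1)

lemma n0[simp]: "nrm A \<zero> = 0" using nsm[of \<zero> 0] by simp
lemma nneg[simp]: "x \<in> carrier A \<Longrightarrow> nrm A (\<ominus> x) = nrm A x"
  using nsm[of x "-1"] by (simp add: sm_m1)
lemma nadj: assumes x: "x \<in> carrier A" shows "nrm A (adj A x) = nrm A x"
proof -
  have *: "nrm A y \<le> nrm A (adj A y)" if y: "y \<in> carrier A" for y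
  proof -
    have "(nrm A y)\<^sup>2 \<le> nrm A (adj A y) * nrm A y"
      using ncs[OF y] nmul[of "adj A y" y] y adj_closed by simp
    thus ?thesis using nn[OF y] nn[OF adj_closed[OF y]]
      by (cases "nrm A y = 0") (auto simp: power2_eq_square)
  qed
  show ?thesis using *[OF x] *[OF adj_closed[OF x]] adj_adj[OF x] by simp
qed
lemma ntri_minus: "\<lbrakk>x \<in> carrier A; y \<in> carrier A; z \<in> carrier A\<rbrakk>
   \<Longrightarrow> nrm A (x \<ominus> z) \<le> nrm A (x \<ominus> y) + nrm A (y \<ominus> z)"
proof -
  assume a: "x \<in> carrier A" "y \<in> carrier A" "z \<in> carrier A"
  have "x \<ominus> z = (x \<ominus> y) \<oplus> (y \<ominus> z)" using a by algebra
  thus ?thesis using ntri[of "x \<ominus> y" "y \<ominus> z"] a by simp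
qed
lemma nsym: "\<lbrakk>x \<in> carrier A; y \<in> carrier A\<rbrakk> \<Longrightarrow> nrm A (x \<ominus> y) = nrm A (y \<ominus> x)"
proof -
  assume a: "x \<in> carrier A" "y \<in> carrier A"
  have "x \<ominus> y = \<ominus> (y \<ominus> x)" using a by algebra
  thus ?thesis using a by simp
qed
lemma nrev: "\<lbrakk>x \<in> carrier A; y \<in> carrier A\<rbrakk> \<Longrightarrow> \<bar>nrm A x - nrm A y\<bar> \<le> nrm A (x \<ominus> y)"
proof -
  assume a: "x \<in> carrier A" "y \<in> carrier A"
  have "x = (x \<ominus> y) \<oplus> y" "y = (y \<ominus> x) \<oplus> x" using a by algebra+
  thus ?thesis using ntri[of "x \<ominus> y" y] ntri[of "y \<ominus> x" x] nsym[OF a] a by (smt (verit) R.minus_closed)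
qed

lemma csD: "X \<in> cauchy_seqs A \<Longrightarrow> X n \<in> carrier A"
  unfolding cauchy_seqs_def by blast
lemma csE: "X \<in> cauchy_seqs A \<Longrightarrow> e > 0 \<Longrightarrow> \<exists>N. \<forall>m\<ge>N. \<forall>n\<ge>N. nrm A (X m \<ominus> X n) < e"
  unfolding cauchy_seqs_def by blast
lemma csI: "(\<And>n. X n \<in> carrier A) \<Longrightarrow> (\<And>e. e > 0 \<Longrightarrow> \<exists>N. \<forall>m\<ge>N. \<forall>n\<ge>N. nrm A (X m \<ominus> X n) < e)
  \<Longrightarrow> X \<in> cauchy_seqs A"
  unfolding cauchy_seqs_def by blast

lemma cs_conv: assumes X: "X \<in> cauchy_seqs A" shows "convergent (\<lambda>n. nrm A (X n))"
proof -
  have "Cauchy (\<lambda>n. nrm A (X n))"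
  proof (rule metric_CauchyI)
    fix e :: real assume "e > 0"
    then obtain N where N: "\<forall>m\<ge>N. \<forall>n\<ge>N. nrm A (X m \<ominus> X n) < e" using csE[OF X] by blast
    show "\<exists>M. \<forall>m\<ge>M. \<forall>n\<ge>M. dist (nrm A (X m)) (nrm A (X n)) < e"
      using N le_less_trans[OF nrev[OF csD[OF X] csD[OF X]]] unfolding dist_real_def by blast
  qed
  thus ?thesis by (simp add: Cauchy_convergent)
qed

lemma cs_bdd: assumes X: "X \<in> cauchy_seqs A" obtains B where "B > 0" "\<And>n. nrm A (X n) \<le> B"
proof -
  from cs_conv[OF X] have "Bseq (\<lambda>n. nrm A (X n))" by (rule convergent_imp_Bseq)
  then obtain K where K: "K > 0" "\<And>n. norm (nrm A (X n)) \<le> K" by (auto elim: BseqE)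
  have "nrm A (X n) \<le> K" for n using K(2)[of n] by simp
  with K(1) show ?thesis using that by blast
qed

lemma cs_const: "x \<in> carrier A \<Longrightarrow> (\<lambda>n. x) \<in> cauchy_seqs A"
  by (rule csI) (auto simp: R.minus_eq R.r_neg)

lemma add_diff: "\<lbrakk>x \<in> carrier A; y \<in> carrier A; z \<in> carrier A; w \<in> carrier A\<rbrakk> \<Longrightarrow>
   (x \<oplus> y) \<ominus> (z \<oplus> w) = (x \<ominus> z) \<oplus> (y \<ominus> w)"
  by algebra

lemma cs_add: assumes X: "X \<in> cauchy_seqs A" and Y: "Y \<in> cauchy_seqs A"
  shows "(\<lambda>n. X n \<oplus> Y n) \<in> cauchy_seqs A"
proof (rule csI)
  fix e :: real assume "e > 0"
  hence e2: "e/2 > 0" by simp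
  obtain N where N: "\<forall>m\<ge>N. \<forall>n\<ge>N. nrm A (X m \<ominus> X n) < e/2" using csE[OF X e2] by blast
  obtain M where M: "\<forall>m\<ge>M. \<forall>n\<ge>M. nrm A (Y m \<ominus> Y n) < e/2" using csE[OF Y e2] by blast
  have "nrm A ((X m \<oplus> Y m) \<ominus> (X n \<oplus> Y n)) < e" if "m \<ge> max N M" "n \<ge> max N M" for m n
  proof -
    have "(X m \<oplus> Y m) \<ominus> (X n \<oplus> Y n) = (X m \<ominus> X n) \<oplus> (Y m \<ominus> Y n)"
      using csD[OF X] csD[OF Y] by (intro add_diff) auto
    moreover have "nrm A ((X m \<ominus> X n) \<oplus> (Y m \<ominus> Y n)) \<le> nrm A (X m \<ominus> X n) + nrm A (Y m \<ominus> Y n)"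
      using ntri csD[OF X] csD[OF Y] by simp
    ultimately show ?thesis using N M that by (smt (verit) field_sum_of_halves max.bounded_iff)
  qed
  thus "\<exists>N. \<forall>m\<ge>N. \<forall>n\<ge>N. nrm A ((X m \<oplus> Y m) \<ominus> (X n \<oplus> Y n)) < e" by blast
qed (use csD X Y in auto)

lemma cs_sm: assumes X: "X \<in> cauchy_seqs A" shows "(\<lambda>n. c \<odot> X n) \<in> cauchy_seqs A"
proof (rule csI)
  fix e :: real assume e: "e > 0"
  hence "e / (cmod c + 1) > 0" by (simp add: add_nonneg_pos)
  then obtain N where N: "\<forall>m\<ge>N. \<forall>n\<ge>N. nrm A (X m \<ominus> X n) < e / (cmod c + 1)" using csE[OF X] by blast
  have "nrm A (c \<odot> X m \<ominus> c \<odot> X n) < e" if "m \<ge> N" "n \<ge> N" for m n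
  proof -
    have eq: "c \<odot> X m \<ominus> c \<odot> X n = c \<odot> (X m \<ominus> X n)"
      using csD[OF X] by (simp add: R.minus_eq sm_r sm_neg)
    have "nrm A (X m \<ominus> X n) < e / (cmod c + 1)" using N that by blast
    hence "(cmod c + 1) * nrm A (X m \<ominus> X n) < e"
      using pos_less_divide_eq[of "cmod c + 1" "nrm A (X m \<ominus> X n)" e]
      by (simp add: add_nonneg_pos mult.commute)
    moreover have "0 \<le> nrm A (X m \<ominus> X n)" using nn csD[OF X] by simp
    ultimately show ?thesis using csD[OF X] by (simp add: eq nsm distrib_right)
  qed
  thus "\<exists>N. \<forall>m\<ge>N. \<forall>n\<ge>N. nrm A (c \<odot> X m \<ominus> c \<odot> X n) < e" by blast
qed (use csD X in auto)

lemma cs_adj: assumes X: "X \<in> cauchy_seqs A" shows "(\<lambda>n. adj A (X n)) \<in> cauchy_seqs A"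
proof (rule csI)
  fix e :: real assume e: "e > 0"
  have eq: "adj A (X m) \<ominus> adj A (X n) = adj A (X m \<ominus> X n)" for m n
    using csD[OF X] by (simp add: R.minus_eq adj_add adj_neg)
  show "\<exists>N. \<forall>m\<ge>N. \<forall>n\<ge>N. nrm A (adj A (X m) \<ominus> adj A (X n)) < e"
    unfolding eq using csE[OF X e] csD[OF X] by (simp add: nadj)
qed (use csD X adj_closed in auto)

lemma mul_diff: "\<lbrakk>x \<in> carrier A; y \<in> carrier A; z \<in> carrier A; w \<in> carrier A\<rbrakk> \<Longrightarrow>
   nrm A (x \<otimes> y \<ominus> z \<otimes> w) \<le> nrm A x * nrm A (y \<ominus> w) + nrm A (x \<ominus> z) * nrm A w"
proof -
  assume a: "x \<in> carrier A" "y \<in> carrier A" "z \<in> carrier A" "w \<in> carrier A"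
  have "x \<otimes> y \<ominus> z \<otimes> w = x \<otimes> (y \<ominus> w) \<oplus> (x \<ominus> z) \<otimes> w" using a by algebra
  also have "nrm A \<dots> \<le> nrm A (x \<otimes> (y \<ominus> w)) + nrm A ((x \<ominus> z) \<otimes> w)" using a by (intro ntri) auto
  also have "\<dots> \<le> nrm A x * nrm A (y \<ominus> w) + nrm A (x \<ominus> z) * nrm A w"
    using a by (intro add_mono nmul) auto
  finally show ?thesis .
qed

lemma cs_mult: assumes X: "X \<in> cauchy_seqs A" and Y: "Y \<in> cauchy_seqs A"
  shows "(\<lambda>n. X n \<otimes> Y n) \<in> cauchy_seqs A"
proof (rule csI)
  fix e :: real assume e: "e > 0"
  obtain B where B: "B > 0" "\<And>n. nrm A (X n) \<le> B" using cs_bdd[OF X] by blast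
  obtain C where C: "C > 0" "\<And>n. nrm A (Y n) \<le> C" using cs_bdd[OF Y] by blast
  obtain N where N: "\<forall>m\<ge>N. \<forall>n\<ge>N. nrm A (X m \<ominus> X n) < e/(2*C)" using csE[OF X, of "e/(2*C)"] e C by auto
  obtain M where M: "\<forall>m\<ge>M. \<forall>n\<ge>M. nrm A (Y m \<ominus> Y n) < e/(2*B)" using csE[OF Y, of "e/(2*B)"] e B by auto
  have "nrm A ((X m \<otimes> Y m) \<ominus> (X n \<otimes> Y n)) < e" if mn: "m \<ge> max N M" "n \<ge> max N M" for m n
  proof -
    have 1: "nrm A (X m) * nrm A (Y m \<ominus> Y n) \<le> B * nrm A (Y m \<ominus> Y n)"
      using B nn csD[OF Y] by (intro mult_right_mono) auto
    have "nrm A (Y m \<ominus> Y n) < e/(2*B)" using M mn by auto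
    hence 2: "B * nrm A (Y m \<ominus> Y n) < e/2" using B by (simp add: field_simps)
    have 3: "nrm A (X m \<ominus> X n) * nrm A (Y n) \<le> nrm A (X m \<ominus> X n) * C"
      using C nn csD[OF X] by (intro mult_left_mono) auto
    have "nrm A (X m \<ominus> X n) < e/(2*C)" using N mn by auto
    hence 4: "nrm A (X m \<ominus> X n) * C < e/2" using C by (simp add: field_simps)
    show ?thesis using mul_diff[of "X m" "Y m" "X n" "Y n"] 1 2 3 4 csD[OF X] csD[OF Y]
      by (smt (verit) field_sum_of_halves)
  qed
  thus "\<exists>N. \<forall>m\<ge>N. \<forall>n\<ge>N. nrm A ((X m \<otimes> Y m) \<ominus> (X n \<otimes> Y n)) < e" by blast
qed (use csD X Y in auto)

lemma CR_simps[simp]: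
  "carrier CR = cauchy_seqs A" "mult CR = (\<lambda>X Y n. X n \<otimes> Y n)" "one CR = (\<lambda>n. \<one>)"
  "zero CR = (\<lambda>n. \<zero>)" "add CR = (\<lambda>X Y n. X n \<oplus> Y n)"
  by (simp_all add: cauchy_ring_def)

lemma CR_ring: "ring CR"
proof (rule ringI)
  show "abelian_group CR"
  proof (rule abelian_groupI)
    fix X assume "X \<in> carrier CR"
    hence X: "X \<in> cauchy_seqs A" by simp
    show "\<exists>Y\<in>carrier CR. Y \<oplus>\<^bsub>CR\<^esub> X = \<zero>\<^bsub>CR\<^esub>"
      using cs_sm[OF X, of "-1"] csD[OF X]
      by (intro bexI[of _ "\<lambda>n. (-1) \<odot> X n"]) (auto simp: sm_m1 R.l_neg)
  qed (auto simp: csD cs_add cs_const R.add.m_ac)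
  show "monoid CR"
    by (rule monoidI) (auto simp: csD cs_mult cs_const R.m_assoc)
qed (auto simp: csD R.l_distr R.r_distr)

lemma NS_sub: "NS \<subseteq> cauchy_seqs A" unfolding null_seqs_def by auto
lemma NS_iff: "X \<in> NS \<longleftrightarrow> X \<in> cauchy_seqs A \<and> (\<lambda>n. nrm A (X n)) \<longlonglongrightarrow> 0" unfolding null_seqs_def by auto

lemma NSI: assumes X: "X \<in> cauchy_seqs A" and le: "\<And>n. nrm A (X n) \<le> f n" and f: "f \<longlonglongrightarrow> 0"
  shows "X \<in> NS"
  unfolding NS_iff using X le f nn csD[OF X]
  by (auto intro: tendsto_sandwich[of "\<lambda>_. 0" _ _ f])

interpretation CR: ring CR by (rule CR_ring)

lemma CR_neg: "X \<in> cauchy_seqs A \<Longrightarrow> \<ominus>\<^bsub>CR\<^esub> X = (\<lambda>n. \<ominus> X n)"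
proof -
  assume X: "X \<in> cauchy_seqs A"
  have "(\<lambda>n. (-1) \<odot> X n) = (\<lambda>n. \<ominus> X n)" using csD[OF X] by (simp add: sm_m1)
  hence "(\<lambda>n. \<ominus> X n) \<in> cauchy_seqs A" using cs_sm[OF X, of "-1"] by simp
  thus ?thesis using X csD[OF X] by (intro CR.minus_equality) (auto simp: R.l_neg)
qed

lemma NS_ideal: "ideal NS CR"
proof (rule idealI)
  show "ring CR" by (rule CR_ring)
  show "subgroup NS (add_monoid CR)"
  proof (rule CR.add.subgroupI)
    show "NS \<noteq> {}" using cs_const[of \<zero>] NS_iff[of "\<lambda>n. \<zero>"] by auto
    show "\<ominus>\<^bsub>CR\<^esub> X \<in> NS" if "X \<in> NS" for X
    proof -
      have X: "X \<in> cauchy_seqs A" using that by (simp add: NS_iff)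
      have "\<ominus>\<^bsub>CR\<^esub> X \<in> cauchy_seqs A" using CR.a_inv_closed X by simp
      thus ?thesis using that X csD[OF X] by (simp add: CR_neg NS_iff)
    qed
    fix X Y assume XY: "X \<in> NS" "Y \<in> NS"
    have "(\<lambda>n. nrm A (X n) + nrm A (Y n)) \<longlonglongrightarrow> 0 + 0" using XY by (intro tendsto_add) (auto simp: NS_iff)
    thus "X \<oplus>\<^bsub>CR\<^esub> Y \<in> NS" using XY ntri csD
      by (auto simp: NS_iff[of X] NS_iff[of Y] intro!: NSI[where f = "\<lambda>n. nrm A (X n) + nrm A (Y n)"] cs_add)
  qed (use NS_sub in auto)
  fix X Y assume X: "X \<in> NS" and "Y \<in> carrier CR"
  hence Y: "Y \<in> cauchy_seqs A" and X': "X \<in> cauchy_seqs A" using NS_sub by auto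
  obtain B where B: "\<And>n. nrm A (Y n) \<le> B" using cs_bdd[OF Y] by blast
  have t: "(\<lambda>n. B * nrm A (X n)) \<longlonglongrightarrow> 0" using X tendsto_mult[OF tendsto_const[of B]] by (fastforce simp: NS_iff)
  have 1: "nrm A (Y n \<otimes> X n) \<le> B * nrm A (X n)" for n
    using nmul[OF csD[OF Y] csD[OF X'], of n n] mult_right_mono[OF B[of n] nn[OF csD[OF X', of n]]] by linarith
  have 2: "nrm A (X n \<otimes> Y n) \<le> B * nrm A (X n)" for n
    using nmul[OF csD[OF X'] csD[OF Y], of n n] mult_left_mono[OF B[of n] nn[OF csD[OF X', of n]]]
    by (simp add: mult.commute)
  show "Y \<otimes>\<^bsub>CR\<^esub> X \<in> NS" using NSI[OF cs_mult[OF Y X'] 1 t] by simp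
  show "X \<otimes>\<^bsub>CR\<^esub> Y \<in> NS" using NSI[OF cs_mult[OF X' Y] 2 t] by simp
qed

interpretation NS: ideal NS CR by (rule NS_ideal)

abbreviation "cl X \<equiv> NS +>\<^bsub>CR\<^esub> X"

lemma cl_mem: assumes X: "X \<in> cauchy_seqs A"
  shows "Y \<in> cl X \<longleftrightarrow> Y \<in> cauchy_seqs A \<and> (\<lambda>n. Y n \<ominus> X n) \<in> NS"
proof -
  have sub: "cl X \<subseteq> cauchy_seqs A" 
    using CR.a_r_coset_subset_G[OF NS.a_subset, of X] X by simp
  show ?thesis
  proof (cases "Y \<in> cauchy_seqs A")
    case True
    have "Y \<in> cl X \<longleftrightarrow> Y \<ominus>\<^bsub>CR\<^esub> X \<in> NS"
      using NS.a_rcos_module_minus[OF CR_ring, of X Y] X True by simp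
    also have "Y \<ominus>\<^bsub>CR\<^esub> X = (\<lambda>n. Y n \<ominus> X n)"
      using X by (simp add: CR.minus_eq CR_neg R.minus_eq)
    finally show ?thesis using True by simp
  qed (use sub in auto)
qed

lemma cl_self: "X \<in> cauchy_seqs A \<Longrightarrow> X \<in> cl X"
  using NS.a_rcos_self by simp

lemma cl_eqI: "X \<in> cauchy_seqs A \<Longrightarrow> Y \<in> cl X \<Longrightarrow> cl Y = cl X"
  using NS.a_repr_independence'[of Y X] by simp

lemma cl_lim: assumes X: "X \<in> cauchy_seqs A" and Y: "Y \<in> cl X" and r: "(\<lambda>n. nrm A (X n)) \<longlonglongrightarrow> r"
  shows "(\<lambda>n. nrm A (Y n)) \<longlonglongrightarrow> r"
proof -
  have Yc: "Y \<in> cauchy_seqs A" and d: "(\<lambda>n. nrm A (Y n \<ominus> X n)) \<longlonglongrightarrow> 0"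
    using Y unfolding cl_mem[OF X] NS_iff by blast+
  have "(\<lambda>n. nrm A (Y n) - nrm A (X n)) \<longlonglongrightarrow> 0"
    by (rule Lim_null_comparison[OF _ d]) (use nrev csD[OF X] csD[OF Yc] in auto)
  from tendsto_add[OF this r] show ?thesis by simp
qed

lemma comp_carrier: "carrier (star_completion A) = {cl X |X. X \<in> cauchy_seqs A}"
  by (auto simp: star_completion_def Let_def FactRing_def A_RCOSETS_def')

lemma comp_one: "one (star_completion A) = cl (\<lambda>n. \<one>)"
  by (simp add: star_completion_def Let_def FactRing_def)
lemma comp_zero: "zero (star_completion A) = cl (\<lambda>n. \<zero>)"
proof -
  have "cl \<zero>\<^bsub>CR\<^esub> = NS" using CR.a_coset_add_zero[of NS] NS_sub by simp
  thus ?thesis by (simp add: star_completion_def Let_def FactRing_def)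
qed
lemma comp_add: "X \<in> cauchy_seqs A \<Longrightarrow> Y \<in> cauchy_seqs A \<Longrightarrow>
   add (star_completion A) (cl X) (cl Y) = cl (\<lambda>n. X n \<oplus> Y n)"
  using NS.a_rcos_sum[of X Y] by (simp add: star_completion_def Let_def FactRing_def)
lemma comp_mult: "X \<in> cauchy_seqs A \<Longrightarrow> Y \<in> cauchy_seqs A \<Longrightarrow>
   mult (star_completion A) (cl X) (cl Y) = cl (\<lambda>n. X n \<otimes> Y n)"
  using NS.rcoset_mult_add[of X Y] by (simp add: star_completion_def Let_def FactRing_def)

lemma comp_smult: assumes X: "X \<in> cauchy_seqs A"
  shows "smult (star_completion A) c (cl X) = cl (\<lambda>n. c \<odot> X n)"
proof -
  have "cl (\<lambda>n. c \<odot> Y n) = cl (\<lambda>n. c \<odot> X n)" if Y: "Y \<in> cl X" for Y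
  proof -
    have Yc: "Y \<in> cauchy_seqs A" and d: "(\<lambda>n. nrm A (Y n \<ominus> X n)) \<longlonglongrightarrow> 0"
      and dc: "(\<lambda>n. Y n \<ominus> X n) \<in> cauchy_seqs A"
      using Y unfolding cl_mem[OF X] NS_iff by blast+
    have eq: "(c \<odot> Y n \<ominus> c \<odot> X n) = c \<odot> (Y n \<ominus> X n)" for n
      using csD[OF X] csD[OF Yc] by (simp add: R.minus_eq sm_r sm_neg)
    have "(\<lambda>n. c \<odot> Y n \<ominus> c \<odot> X n) \<in> NS" unfolding eq
      using cs_sm[OF dc] tendsto_mult[OF tendsto_const[of "cmod c"] d] csD[OF X] csD[OF Yc]
      by (simp add: NS_iff nsm)
    thus ?thesis by (intro cl_eqI cs_sm[OF X]) (simp add: cl_mem[OF cs_sm[OF X]] cs_sm[OF Yc])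
  qed
  hence "(\<Union>Y\<in>cl X. cl (\<lambda>n. c \<odot> Y n)) = (\<Union>Y\<in>cl X. cl (\<lambda>n. c \<odot> X n))"
    by (intro SUP_cong refl)
  also have "\<dots> = cl (\<lambda>n. c \<odot> X n)" using cl_self[OF X] by blast
  finally show ?thesis by (simp only: star_completion_def Let_def star_alg.simps normed_star_alg.simps module.simps)
qed

lemma comp_adj: assumes X: "X \<in> cauchy_seqs A"
  shows "adj (star_completion A) (cl X) = cl (\<lambda>n. adj A (X n))"
proof -
  have "cl (\<lambda>n. adj A (Y n)) = cl (\<lambda>n. adj A (X n))" if Y: "Y \<in> cl X" for Y
  proof -
    have Yc: "Y \<in> cauchy_seqs A" and d: "(\<lambda>n. nrm A (Y n \<ominus> X n)) \<longlonglongrightarrow> 0"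
      and dc: "(\<lambda>n. Y n \<ominus> X n) \<in> cauchy_seqs A"
      using Y unfolding cl_mem[OF X] NS_iff by blast+
    have eq: "adj A (Y n) \<ominus> adj A (X n) = adj A (Y n \<ominus> X n)" for n
      using csD[OF X] csD[OF Yc] by (simp add: R.minus_eq adj_add adj_neg)
    have "(\<lambda>n. adj A (Y n) \<ominus> adj A (X n)) \<in> NS" unfolding eq
      using cs_adj[OF dc] d csD[OF X] csD[OF Yc] by (simp add: NS_iff nadj)
    thus ?thesis by (intro cl_eqI cs_adj[OF X]) (simp add: cl_mem[OF cs_adj[OF X]] cs_adj[OF Yc])
  qed
  hence "(\<Union>Y\<in>cl X. cl (\<lambda>n. adj A (Y n))) = (\<Union>Y\<in>cl X. cl (\<lambda>n. adj A (X n)))"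
    by (intro SUP_cong refl)
  also have "\<dots> = cl (\<lambda>n. adj A (X n))" using cl_self[OF X] by blast
  finally show ?thesis by (simp only: star_completion_def Let_def star_alg.simps normed_star_alg.simps module.simps)
qed

lemma comp_nrm: assumes X: "X \<in> cauchy_seqs A"
  shows "(\<lambda>n. nrm A (X n)) \<longlonglongrightarrow> nrm (star_completion A) (cl X)"
proof -
  obtain r where r: "(\<lambda>n. nrm A (X n)) \<longlonglongrightarrow> r" using cs_conv[OF X] by (auto simp: convergent_def)
  have "(THE r. \<forall>X\<in>cl X. (\<lambda>n. nrm A (X n)) \<longlonglongrightarrow> r) = r"
    using cl_lim[OF X _ r] cl_self[OF X] by (intro the_equality) (auto intro: LIMSEQ_unique[OF _ r])
  thus ?thesis using r by (simp add: star_completion_def Let_def)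
qed
lemma comp_nrm_eq: assumes X: "X \<in> cauchy_seqs A" and "(\<lambda>n. nrm A (X n)) \<longlonglongrightarrow> r"
  shows "nrm (star_completion A) (cl X) = r"
  using LIMSEQ_unique[OF comp_nrm[OF X]] assms by blast

lemma comp_cases: "S \<in> carrier (star_completion A) \<Longrightarrow> (\<And>X. X \<in> cauchy_seqs A \<Longrightarrow> S = cl X \<Longrightarrow> P) \<Longrightarrow> P"
  unfolding comp_carrier by auto
lemma comp_mem: "X \<in> cauchy_seqs A \<Longrightarrow> cl X \<in> carrier (star_completion A)"
  unfolding comp_carrier by auto

lemma comp_ring: "ring (star_completion A)"
proof (rule ringI)
  note simps = comp_add comp_mult comp_smult comp_zero comp_one cs_add cs_mult cs_sm cs_const comp_mem
  show "abelian_group (star_completion A)"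
  proof (rule abelian_groupI)
    fix S assume "S \<in> carrier (star_completion A)"
    then obtain X where X: "X \<in> cauchy_seqs A" and S: "S = cl X" using comp_cases by metis
    have "cl (\<lambda>n. (-1) \<odot> X n) \<oplus>\<^bsub>star_completion A\<^esub> S = cl (\<lambda>n. (-1) \<odot> X n \<oplus> X n)"
      unfolding S by (rule comp_add[OF cs_sm[OF X] X])
    also have "(\<lambda>n. (-1) \<odot> X n \<oplus> X n) = (\<lambda>n. \<zero>)"
      using csD[OF X] by (simp add: sm_m1 R.l_neg)
    finally show "\<exists>Y\<in>carrier (star_completion A). Y \<oplus>\<^bsub>star_completion A\<^esub> S = \<zero>\<^bsub>star_completion A\<^esub>"
      using comp_mem[OF cs_sm[OF X, of "-1"]] unfolding comp_zero by blast
  qed (auto elim!: comp_cases simp: simps csD R.add.m_ac)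
  show "monoid (star_completion A)"
    by (rule monoidI) (auto elim!: comp_cases simp: simps csD R.m_assoc)
qed (auto elim!: comp_cases simp: comp_add comp_mult cs_add cs_mult csD R.l_distr R.r_distr)

lemma comp_star: "unital_star_algebra (star_completion A)"
proof -
  interpret C: ring "star_completion A" by (rule comp_ring)
  note simps = comp_add comp_mult comp_smult comp_adj cs_add cs_mult cs_sm cs_adj comp_mem
  have "module (class_ring :: complex ring) (star_completion A)"
    by (rule moduleI)
       (auto elim!: comp_cases simp: simps csD sm_l sm_r sm_assoc C.abelian_group_axioms M.R.cring_axioms)
  thus ?thesis
    by (intro unital_star_algebra.intro unital_star_algebra_axioms.intro comp_ring)
       (auto elim!: comp_cases simp: simps csD smult_mult_left smult_mult_right adj_closed adj_adj
         adj_add adj_smult adj_mult)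
qed

lemma comp_csn: "cstar_seminorm (star_completion A) (nrm (star_completion A))"
  unfolding cstar_seminorm_def
proof (intro conjI ballI allI; elim comp_cases; hypsubst)
  fix X assume X: "X \<in> cauchy_seqs A"
  note lX = comp_nrm[OF X]
  show "0 \<le> nrm (star_completion A) (cl X)"
    by (rule LIMSEQ_le_const[OF lX]) (use nn csD[OF X] in auto)
  show "nrm (star_completion A) (c \<odot>\<^bsub>star_completion A\<^esub> cl X) = cmod c * nrm (star_completion A) (cl X)" for c
    using tendsto_mult[OF tendsto_const[of "cmod c"] lX] csD[OF X]
    by (simp add: comp_smult X) (intro comp_nrm_eq cs_sm X, simp add: nsm)
  show "nrm (star_completion A) (adj (star_completion A) (cl X) \<otimes>\<^bsub>star_completion A\<^esub> cl X) = (nrm (star_completion A) (cl X))\<^sup>2"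
    using tendsto_power[OF lX, of 2] csD[OF X]
    by (simp add: comp_adj comp_mult cs_adj X) (intro comp_nrm_eq cs_mult cs_adj X, simp add: ncs)
  fix Y assume Y: "Y \<in> cauchy_seqs A"
  note lY = comp_nrm[OF Y]
  show "nrm (star_completion A) (cl X \<oplus>\<^bsub>star_completion A\<^esub> cl Y) \<le> nrm (star_completion A) (cl X) + nrm (star_completion A) (cl Y)"
    using LIMSEQ_le[OF comp_nrm[OF cs_add[OF X Y]] tendsto_add[OF lX lY]] ntri csD[OF X] csD[OF Y]
    by (simp add: comp_add X Y)
  show "nrm (star_completion A) (cl X \<otimes>\<^bsub>star_completion A\<^esub> cl Y) \<le> nrm (star_completion A) (cl X) * nrm (star_completion A) (cl Y)"
    using LIMSEQ_le[OF comp_nrm[OF cs_mult[OF X Y]] tendsto_mult[OF lX lY]] nmul csD[OF X] csD[OF Y]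
    by (simp add: comp_mult X Y)
qed

lemma comp_minus: assumes "X \<in> cauchy_seqs A" "Y \<in> cauchy_seqs A"
  shows "cl X \<ominus>\<^bsub>star_completion A\<^esub> cl Y = cl (\<lambda>n. X n \<ominus> Y n)"
proof -
  interpret C: seminormed_star_algebra "star_completion A" 
    by (intro seminormed_star_algebra.intro comp_star seminormed_star_algebra_axioms.intro comp_csn)
  have "cl X \<ominus>\<^bsub>star_completion A\<^esub> cl Y = cl X \<oplus>\<^bsub>star_completion A\<^esub> ((-1) \<odot>\<^bsub>star_completion A\<^esub> cl Y)"
    using assms by (simp add: C.R.minus_eq C.sm_m1 comp_mem)
  also have "\<dots> = cl (\<lambda>n. X n \<oplus> (-1) \<odot> Y n)"
    using assms by (simp add: comp_smult comp_add cs_sm)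
  also have "\<dots> = cl (\<lambda>n. X n \<ominus> Y n)"
    using csD[OF assms(2)] by (simp add: sm_m1 R.minus_eq)
  finally show ?thesis .
qed

lemma cs_minus: assumes "X \<in> cauchy_seqs A" "Y \<in> cauchy_seqs A" shows "(\<lambda>n. X n \<ominus> Y n) \<in> cauchy_seqs A"
proof -
  have "(\<lambda>n. X n \<oplus> (-1) \<odot> Y n) \<in> cauchy_seqs A" using assms cs_sm cs_add by auto
  thus ?thesis using csD[OF assms(2)] by (simp add: sm_m1 R.minus_eq)
qed

lemma dense: assumes S: "S \<in> carrier (star_completion A)" and e: "e > 0"
  shows "\<exists>x\<in>carrier A. nrm (star_completion A) (S \<ominus>\<^bsub>star_completion A\<^esub> cl (\<lambda>n. x)) < e"
proof -
  obtain X where X: "X \<in> cauchy_seqs A" and SX: "S = cl X" using comp_cases[OF S] by blast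
  have e2: "e/2 > 0" using e by simp
  obtain N where N: "\<forall>m\<ge>N. \<forall>n\<ge>N. nrm A (X m \<ominus> X n) < e/2" using csE[OF X e2] by blast
  have c: "(\<lambda>n. X N) \<in> cauchy_seqs A" using cs_const csD[OF X] by blast
  have "nrm (star_completion A) (cl (\<lambda>n. X n \<ominus> X N)) \<le> e/2"
    by (rule LIMSEQ_le_const2[OF comp_nrm[OF cs_minus[OF X c]]]) (use N in \<open>auto intro!: exI[of _ N] less_imp_le\<close>)
  thus ?thesis using comp_minus[OF X c] SX e csD[OF X] by (intro bexI[of _ "X N"]) auto
qed

theorem comp_cstar: "unital_cstar_algebra (star_completion A)"
proof -
  let ?C = "star_completion A"
  interpret C: seminormed_star_algebra "star_completion A"
    by (intro seminormed_star_algebra.intro comp_star seminormed_star_algebra_axioms.intro comp_csn)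
  show ?thesis
  proof (intro unital_cstar_algebra.intro comp_star unital_cstar_algebra_axioms.intro comp_csn)
    fix S assume S: "S \<in> carrier ?C" "nrm ?C S = 0"
    then obtain X where X: "X \<in> cauchy_seqs A" and SX: "S = cl X" using comp_cases by metis
    have X0: "(\<lambda>n. nrm A (X n)) \<longlonglongrightarrow> 0" using comp_nrm[OF X] S SX by simp
    have z: "(\<lambda>n. \<zero>) \<in> cauchy_seqs A" by (simp add: cs_const)
    have "X \<in> cl (\<lambda>n. \<zero>)" using X X0 csD[OF X] by (simp add: cl_mem z NS_iff R.minus_eq)
    thus "S = \<zero>\<^bsub>?C\<^esub>" using cl_eqI[OF z] SX comp_zero by simp
  next
    fix S assume S: "S \<in> cauchy_seqs ?C"
    have "\<forall>n. \<exists>x\<in>carrier A. nrm ?C (S n \<ominus>\<^bsub>?C\<^esub> cl (\<lambda>i. x)) < 1 / real (Suc n)"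
      using dense[OF C.csD[OF S]] by simp
    then obtain x where x: "\<And>n. x n \<in> carrier A"
      and xS: "\<And>n. nrm ?C (S n \<ominus>\<^bsub>?C\<^esub> cl (\<lambda>i. x n)) < 1 / real (Suc n)" by metis
    have k: "(\<lambda>i. x n) \<in> cauchy_seqs A" for n using cs_const x by blast
    have kc: "cl (\<lambda>i. x n) \<in> carrier ?C" for n using k comp_mem by blast
    have iso: "nrm ?C (cl (\<lambda>i. x m) \<ominus>\<^bsub>?C\<^esub> cl (\<lambda>i. x n)) = nrm A (x m \<ominus> x n)" for m n
      by (simp add: comp_minus k) (intro comp_nrm_eq cs_minus k tendsto_const)
    have lim1: "(\<lambda>n. 1 / real (Suc n)) \<longlonglongrightarrow> 0" by (rule LIMSEQ_inverse_real_of_nat[unfolded inverse_eq_divide])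
    have X: "x \<in> cauchy_seqs A"
    proof (rule csI[OF x])
      fix e :: real assume e: "e > 0"
      hence e3: "e/3 > 0" by simp
      obtain N where N: "\<forall>m\<ge>N. \<forall>n\<ge>N. nrm ?C (S m \<ominus>\<^bsub>?C\<^esub> S n) < e/3" using C.csE[OF S e3] by blast
      obtain M where M: "\<forall>n\<ge>M. 1 / real (Suc n) < e/3"
        using order_tendstoD(2)[OF lim1 e3] by (auto simp: eventually_sequentially)
      have "nrm A (x m \<ominus> x n) < e" if mn: "m \<ge> max N M" "n \<ge> max N M" for m n
      proof -
        have 1: "nrm ?C (cl (\<lambda>i. x m) \<ominus>\<^bsub>?C\<^esub> cl (\<lambda>i. x n)) \<le>
          nrm ?C (cl (\<lambda>i. x m) \<ominus>\<^bsub>?C\<^esub> S m) + nrm ?C (S m \<ominus>\<^bsub>?C\<^esub> cl (\<lambda>i. x n))"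
          using C.ntri_minus kc C.csD[OF S] by blast
        have 2: "nrm ?C (S m \<ominus>\<^bsub>?C\<^esub> cl (\<lambda>i. x n)) \<le>
          nrm ?C (S m \<ominus>\<^bsub>?C\<^esub> S n) + nrm ?C (S n \<ominus>\<^bsub>?C\<^esub> cl (\<lambda>i. x n))"
          using C.ntri_minus kc C.csD[OF S] by blast
        have 3: "nrm ?C (cl (\<lambda>i. x m) \<ominus>\<^bsub>?C\<^esub> S m) < e/3"
          using C.nsym[OF kc C.csD[OF S], of m m] xS[of m] M mn by force
        have 4: "nrm ?C (S n \<ominus>\<^bsub>?C\<^esub> cl (\<lambda>i. x n)) < e/3" using xS[of n] M mn by force
        have 5: "nrm ?C (S m \<ominus>\<^bsub>?C\<^esub> S n) < e/3" using N mn by auto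
        show ?thesis using 1 2 3 4 5 iso[of m n] by linarith
      qed
      thus "\<exists>N. \<forall>m\<ge>N. \<forall>n\<ge>N. nrm A (x m \<ominus> x n) < e" by blast
    qed
    have "(\<lambda>n. nrm ?C (S n \<ominus>\<^bsub>?C\<^esub> cl x)) \<longlonglongrightarrow> 0"
    proof (rule LIMSEQ_I)
      fix e :: real assume e: "e > 0"
      hence e3: "e/3 > 0" by simp
      obtain N where N: "\<forall>m\<ge>N. \<forall>n\<ge>N. nrm A (x m \<ominus> x n) < e/3" using csE[OF X e3] by blast
      obtain M where M: "\<forall>n\<ge>M. 1 / real (Suc n) < e/3"
        using order_tendstoD(2)[OF lim1 e3] by (auto simp: eventually_sequentially)
      have "norm (nrm ?C (S n \<ominus>\<^bsub>?C\<^esub> cl x) - 0) < e" if n: "n \<ge> max N M" for n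
      proof -
        have 1: "nrm ?C (S n \<ominus>\<^bsub>?C\<^esub> cl x) \<le>
          nrm ?C (S n \<ominus>\<^bsub>?C\<^esub> cl (\<lambda>i. x n)) + nrm ?C (cl (\<lambda>i. x n) \<ominus>\<^bsub>?C\<^esub> cl x)"
          using C.ntri_minus kc C.csD[OF S] comp_mem[OF X] by blast
        have 2: "nrm ?C (cl (\<lambda>i. x n) \<ominus>\<^bsub>?C\<^esub> cl x) \<le> e/3"
          unfolding comp_minus[OF k X]
          by (rule LIMSEQ_le_const2[OF comp_nrm[OF cs_minus[OF k X]]]) 
             (use N n in \<open>auto intro!: exI[of _ N] less_imp_le\<close>)
        have 3: "nrm ?C (S n \<ominus>\<^bsub>?C\<^esub> cl (\<lambda>i. x n)) < e/3" using xS[of n] M n by force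
        have "0 \<le> nrm ?C (S n \<ominus>\<^bsub>?C\<^esub> cl x)" using C.nn C.csD[OF S] comp_mem[OF X] by simp
        thus ?thesis using 1 2 3 e by simp
      qed
      thus "\<exists>no. \<forall>n\<ge>no. norm (nrm ?C (S n \<ominus>\<^bsub>?C\<^esub> cl x) - 0) < e" by blast
    qed
    thus "\<exists>x\<in>carrier ?C. (\<lambda>n. nrm ?C (S n \<ominus>\<^bsub>?C\<^esub> x)) \<longlonglongrightarrow> 0" using comp_mem[OF X] by blast
  qed
qed

end

lemma star_cong:
  fixes A :: "('a, 'm) star_alg_scheme" and B :: "('a, 'n) star_alg_scheme"
  assumes "unital_star_algebra A" and e[simp]: "carrier B = carrier A" "mult B = mult A" "one B = one A"
    "zero B = zero A" "add B = add A" "smult B = smult A" "adj B = adj A"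
  shows "unital_star_algebra B"
proof -
  interpret A: unital_star_algebra A by fact
  have r: "ring B"
  proof (rule ringI)
    show "abelian_group B"
      by (rule abelian_groupI) (auto simp: A.R.add.m_ac intro: A.R.add.l_inv_ex)
    show "Group.monoid B" by (rule monoidI) (auto simp: A.R.m_assoc)
  qed (auto simp: A.R.l_distr A.R.r_distr)
  interpret B: ring B by (rule r)
  have "module (class_ring :: complex ring) B"
    by (rule moduleI[OF module.axioms(1)[OF unital_star_algebra.axioms(2)[OF assms(1)]] B.abelian_group_axioms])
       (simp_all only: e A.M.smult_closed A.M.smult_l_distr A.M.smult_r_distr A.M.smult_assoc1 A.M.smult_one)
  thus ?thesis
    by (intro unital_star_algebra.intro r unital_star_algebra_axioms.intro)
       (simp_all only: e A.smult_mult_left A.smult_mult_right A.adj_closed A.adj_adj A.adj_add A.adj_smult A.adj_mult)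
qed

locale group_algebra = Group.group G for G (structure)
begin

abbreviation "CG \<equiv> group_alg G"
abbreviation supp :: "('a \<Rightarrow> complex) \<Rightarrow> 'a set" where "supp f \<equiv> {x. f x \<noteq> 0}"
abbreviation mu :: "('a \<Rightarrow> complex) \<Rightarrow> ('a \<Rightarrow> complex) \<Rightarrow> 'a \<Rightarrow> complex" where "mu \<equiv> mult CG"

lemma CG_simps: "carrier CG = {f. finite (supp f) \<and> supp f \<subseteq> carrier G}"
  "one CG = (\<lambda>x. if x = \<one> then 1 else 0)" "zero CG = (\<lambda>x. 0)" "add CG = (\<lambda>f h x. f x + h x)"
  "smult CG = (\<lambda>c f x. c * f x)" "adj CG = (\<lambda>f x. if x \<in> carrier G then cnj (f (inv x)) else 0)"
  by (simp_all add: group_alg_def)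

lemma mu_eq: assumes "finite S" "finite T" "supp f \<subseteq> S" "supp h \<subseteq> T"
  shows "mu f h x = (\<Sum>y\<in>S. \<Sum>z\<in>T. if y \<otimes> z = x then f y * h z else 0)"
proof -
  have "mu f h x = (\<Sum>(y, z) \<in> {(y, z). f y \<noteq> 0 \<and> h z \<noteq> 0 \<and> y \<otimes> z = x}. f y * h z)"
    by (simp add: group_alg_def)
  also have "\<dots> = (\<Sum>(y, z) \<in> S \<times> T. if y \<otimes> z = x then f y * h z else 0)"
    by (rule sum.mono_neutral_cong_left) (use assms in \<open>auto split: if_splits\<close>)
  finally show ?thesis by (simp add: sum.cartesian_product)
qed

lemma mu_supp: assumes "f \<in> carrier CG" "h \<in> carrier CG"
  shows "supp (mu f h) \<subseteq> (\<lambda>(y,z). y \<otimes> z) ` (supp f \<times> supp h)"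
proof
  fix x assume "x \<in> supp (mu f h)"
  hence "mu f h x \<noteq> 0" by simp
  moreover have "mu f h x = (\<Sum>(y, z) \<in> {(y, z). f y \<noteq> 0 \<and> h z \<noteq> 0 \<and> y \<otimes> z = x}. f y * h z)"
    by (simp add: group_alg_def)
  ultimately have "{(y, z). f y \<noteq> 0 \<and> h z \<noteq> 0 \<and> y \<otimes> z = x} \<noteq> {}"
    by fastforce
  thus "x \<in> (\<lambda>(y,z). y \<otimes> z) ` (supp f \<times> supp h)" by auto
qed

lemma mu_closed: assumes "f \<in> carrier CG" "h \<in> carrier CG" shows "mu f h \<in> carrier CG"
proof -
  have "finite ((\<lambda>(y,z). y \<otimes> z) ` (supp f \<times> supp h))" 
    "(\<lambda>(y,z). y \<otimes> z) ` (supp f \<times> supp h) \<subseteq> carrier G"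
    using assms unfolding CG_simps by (simp, auto)
  hence "finite (supp (mu f h))" "supp (mu f h) \<subseteq> carrier G"
    using finite_subset[OF mu_supp[OF assms]] order_trans[OF mu_supp[OF assms]] by simp_all
  thus ?thesis by (simp add: CG_simps(1))
qed

lemma mu_assoc: assumes "f \<in> carrier CG" "h \<in> carrier CG" "k \<in> carrier CG"
  shows "mu (mu f h) k = mu f (mu h k)"
proof
  fix x
  note c = assms[unfolded CG_simps, simplified]
  let ?F = "supp f" let ?H = "supp h" let ?K = "supp k"
  let ?FH = "(\<lambda>(y,z). y \<otimes> z) ` (?F \<times> ?H)" let ?HK = "(\<lambda>(y,z). y \<otimes> z) ` (?H \<times> ?K)"
  have "mu (mu f h) k x = (\<Sum>w\<in>?FH. \<Sum>v\<in>?K. if w \<otimes> v = x then mu f h w * k v else 0)"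
    by (rule mu_eq) (use c mu_supp[OF assms(1,2)] in auto)
  also have "\<dots> = (\<Sum>w\<in>?FH. \<Sum>v\<in>?K. \<Sum>y\<in>?F. \<Sum>z\<in>?H. if w = y \<otimes> z then (if w \<otimes> v = x then f y * h z * k v else 0) else 0)"
  proof (intro sum.cong refl)
    fix w v
    have m: "mu f h w = (\<Sum>y\<in>?F. \<Sum>z\<in>?H. if y \<otimes> z = w then f y * h z else 0)"
      by (rule mu_eq) (use c in auto)
    show "(if w \<otimes> v = x then mu f h w * k v else 0) =
      (\<Sum>y\<in>?F. \<Sum>z\<in>?H. if w = y \<otimes> z then (if w \<otimes> v = x then f y * h z * k v else 0) else 0)"
    proof (cases "w \<otimes> v = x")
      case True
      thus ?thesis unfolding m by (auto simp: sum_distrib_right intro!: sum.cong)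
    next
      case False
      thus ?thesis by (simp only: if_False if_cancel sum.neutral_const)
    qed
  qed
  also have "\<dots> = (\<Sum>v\<in>?K. \<Sum>y\<in>?F. \<Sum>z\<in>?H. \<Sum>w\<in>?FH. if w = y \<otimes> z then (if w \<otimes> v = x then f y * h z * k v else 0) else 0)"
    by (rule trans[OF sum.swap], rule sum.cong[OF refl], rule trans[OF sum.swap], rule sum.cong[OF refl], rule sum.swap)
  also have "\<dots> = (\<Sum>v\<in>?K. \<Sum>y\<in>?F. \<Sum>z\<in>?H. if (y \<otimes> z) \<otimes> v = x then f y * h z * k v else 0)"
    by (intro sum.cong refl, subst sum.delta) (use c in auto)
  also have "\<dots> = (\<Sum>y\<in>?F. \<Sum>z\<in>?H. \<Sum>v\<in>?K. if (y \<otimes> z) \<otimes> v = x then f y * h z * k v else 0)"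
    by (rule trans[OF sum.swap], rule sum.cong[OF refl], rule sum.swap)
  also have "\<dots> = (\<Sum>y\<in>?F. \<Sum>z\<in>?H. \<Sum>v\<in>?K. if y \<otimes> (z \<otimes> v) = x then f y * (h z * k v) else 0)"
    by (intro sum.cong refl) (use c in \<open>auto simp: m_assoc subset_iff\<close>)
  also have "\<dots> = (\<Sum>y\<in>?F. \<Sum>z\<in>?H. \<Sum>v\<in>?K. \<Sum>w\<in>?HK. if w = z \<otimes> v then (if y \<otimes> w = x then f y * (h z * k v) else 0) else 0)"
    by (intro sum.cong refl, subst sum.delta) (use c in auto)
  also have "\<dots> = (\<Sum>y\<in>?F. \<Sum>w\<in>?HK. \<Sum>z\<in>?H. \<Sum>v\<in>?K. if w = z \<otimes> v then (if y \<otimes> w = x then f y * (h z * k v) else 0) else 0)"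
    by (rule sum.cong[OF refl], rule trans[OF sum.cong[OF refl sum.swap]], rule sum.swap)
  also have "\<dots> = (\<Sum>y\<in>?F. \<Sum>w\<in>?HK. if y \<otimes> w = x then f y * mu h k w else 0)"
  proof (intro sum.cong refl)
    fix y w
    have m: "mu h k w = (\<Sum>z\<in>?H. \<Sum>v\<in>?K. if z \<otimes> v = w then h z * k v else 0)"
      by (rule mu_eq) (use c in auto)
    show "(\<Sum>z\<in>?H. \<Sum>v\<in>?K. if w = z \<otimes> v then (if y \<otimes> w = x then f y * (h z * k v) else 0) else 0)
      = (if y \<otimes> w = x then f y * mu h k w else 0)"
    proof (cases "y \<otimes> w = x")
      case True
      thus ?thesis unfolding m by (auto simp: sum_distrib_left intro!: sum.cong)
    next
      case False
      thus ?thesis by (simp only: if_False if_cancel sum.neutral_const)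
    qed
  qed
  also have "\<dots> = mu f (mu h k) x"
    by (rule mu_eq[symmetric]) (use c mu_supp[OF assms(2,3)] in auto)
  finally show "mu (mu f h) k x = mu f (mu h k) x" .
qed

lemma mu_add_left: assumes "f \<in> carrier CG" "g \<in> carrier CG" "h \<in> carrier CG"
  shows "mu (\<lambda>x. f x + g x) h = (\<lambda>x. mu f h x + mu g h x)"
proof
  fix x note c = assms[unfolded CG_simps, simplified]
  let ?S = "supp f \<union> supp g"
  have S: "finite ?S" "finite (supp h)" using c by auto
  show "mu (\<lambda>x. f x + g x) h x = mu f h x + mu g h x"
  proof -
    have 1: "mu (\<lambda>x. f x + g x) h x = (\<Sum>y\<in>?S. \<Sum>z\<in>supp h. if y \<otimes> z = x then (f y + g y) * h z else 0)"
      and 2: "mu f h x = (\<Sum>y\<in>?S. \<Sum>z\<in>supp h. if y \<otimes> z = x then f y * h z else 0)"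
      and 3: "mu g h x = (\<Sum>y\<in>?S. \<Sum>z\<in>supp h. if y \<otimes> z = x then g y * h z else 0)"
      by (rule mu_eq[OF S]; auto)+
    show ?thesis unfolding 1 2 3 sum.distrib[symmetric]
      by (intro sum.cong refl) (simp add: distrib_right)
  qed
qed

lemma mu_add_right: assumes "f \<in> carrier CG" "g \<in> carrier CG" "h \<in> carrier CG"
  shows "mu h (\<lambda>x. f x + g x) = (\<lambda>x. mu h f x + mu h g x)"
proof
  fix x note c = assms[unfolded CG_simps, simplified]
  let ?S = "supp f \<union> supp g"
  have S: "finite (supp h)" "finite ?S" using c by auto
  show "mu h (\<lambda>x. f x + g x) x = mu h f x + mu h g x"
  proof -
    have 1: "mu h (\<lambda>x. f x + g x) x = (\<Sum>y\<in>supp h. \<Sum>z\<in>?S. if y \<otimes> z = x then h y * (f z + g z) else 0)"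
      and 2: "mu h f x = (\<Sum>y\<in>supp h. \<Sum>z\<in>?S. if y \<otimes> z = x then h y * f z else 0)"
      and 3: "mu h g x = (\<Sum>y\<in>supp h. \<Sum>z\<in>?S. if y \<otimes> z = x then h y * g z else 0)"
      by (rule mu_eq[OF S]; auto)+
    show ?thesis unfolding 1 2 3 sum.distrib[symmetric]
      by (intro sum.cong refl) (simp add: distrib_left)
  qed
qed

lemma mu_smult: assumes "f \<in> carrier CG" "h \<in> carrier CG"
  shows "mu (\<lambda>x. c * f x) h = (\<lambda>x. c * mu f h x)" "mu f (\<lambda>x. c * h x) = (\<lambda>x. c * mu f h x)"
proof -
  note a = assms[unfolded CG_simps, simplified]
  have S: "finite (supp f)" "finite (supp h)" using a by auto
  have e: "mu f h x = (\<Sum>y\<in>supp f. \<Sum>z\<in>supp h. if y \<otimes> z = x then f y * h z else 0)" for x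
    by (rule mu_eq[OF S]) auto
  show "mu (\<lambda>x. c * f x) h = (\<lambda>x. c * mu f h x)" unfolding e
    by (rule ext, subst mu_eq[OF S]) (auto intro!: sum.cong simp: sum_distrib_left)
  show "mu f (\<lambda>x. c * h x) = (\<lambda>x. c * mu f h x)" unfolding e
    by (rule ext, subst mu_eq[OF S]) (auto intro!: sum.cong simp: sum_distrib_left)
qed

definition dl :: "'a \<Rightarrow> 'a \<Rightarrow> complex" where "dl g = (\<lambda>x. if x = g then 1 else 0)"

lemma dl_supp: "supp (dl g) = {g}" by (auto simp: dl_def)
lemma dl_closed: "g \<in> carrier G \<Longrightarrow> dl g \<in> carrier CG" by (simp add: CG_simps(1) dl_supp)
lemma one_dl: "one CG = dl \<one>" by (simp add: CG_simps dl_def)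

lemma mu_dl_left: assumes g: "g \<in> carrier G" and f: "f \<in> carrier CG" and x: "x \<in> carrier G"
  shows "mu (dl g) f x = f (inv g \<otimes> x)"
proof -
  note a = f[unfolded CG_simps, simplified]
  have "mu (dl g) f x = (\<Sum>z\<in>supp f. if g \<otimes> z = x then f z else 0)"
    by (subst mu_eq[of "{g}" "supp f"]) (use a in \<open>auto simp: dl_supp dl_def intro!: sum.cong\<close>)
  also have "\<dots> = (\<Sum>z\<in>supp f. if z = inv g \<otimes> x then f z else 0)"
    using a g x by (intro sum.cong refl) (auto simp: inv_solve_left subset_iff)
  also have "\<dots> = f (inv g \<otimes> x)" using a by (auto simp: sum.delta)
  finally show ?thesis .
qed

lemma mu_out: assumes "f \<in> carrier CG" "h \<in> carrier CG" "x \<notin> carrier G" shows "mu f h x = 0"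
  using mu_closed[OF assms(1,2)] assms(3) by (auto simp: CG_simps)

lemma mu_one: assumes f: "f \<in> carrier CG" shows "mu (one CG) f = f" "mu f (one CG) = f"
proof -
  have out: "f x = 0" if "x \<notin> carrier G" for x using f that by (auto simp: CG_simps)
  show "mu (one CG) f = f"
  proof
    fix x show "mu (one CG) f x = f x"
      using mu_dl_left[OF one_closed f, of x] mu_out[OF dl_closed[OF one_closed] f, of x] out[of x]
      by (cases "x \<in> carrier G") (auto simp: one_dl)
  qed
  note a = f[unfolded CG_simps, simplified]
  show "mu f (one CG) = f"
  proof
    fix x
    have "mu f (one CG) x = (\<Sum>z\<in>supp f. if z \<otimes> \<one> = x then f z else 0)"
      unfolding one_dl by (subst mu_eq[of "supp f" "{\<one>}"]) (use a in \<open>auto simp: dl_supp dl_def intro!: sum.cong\<close>)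
    also have "\<dots> = (\<Sum>z\<in>supp f. if z = x then f z else 0)"
      using a by (intro sum.cong refl) (auto simp: subset_iff)
    also have "\<dots> = f x" using a by (auto simp: sum.delta)
    finally show "mu f (one CG) x = f x" .
  qed
qed

lemma adj_supp: "f \<in> carrier CG \<Longrightarrow> supp (adj CG f) = m_inv G ` supp f"
  by (force simp: CG_simps image_iff subset_iff)

lemma adj_closed: "f \<in> carrier CG \<Longrightarrow> adj CG f \<in> carrier CG"
  by (frule adj_supp) (auto simp: CG_simps subset_iff)

lemma adj_mu: assumes "f \<in> carrier CG" "h \<in> carrier CG"
  shows "adj CG (mu f h) = mu (adj CG h) (adj CG f)"
proof
  fix x
  note a = assms[unfolded CG_simps, simplified]
  have inj: "inj_on (m_inv G) (supp k)" if "k \<in> carrier CG" for k :: "'a \<Rightarrow> complex"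
    using that inj_on_subset[OF inv_inj] by (auto simp: CG_simps)
  show "adj CG (mu f h) x = mu (adj CG h) (adj CG f) x"
  proof (cases "x \<in> carrier G")
    case x: True
    have "mu (adj CG h) (adj CG f) x = (\<Sum>z\<in>m_inv G ` supp h. \<Sum>y\<in>m_inv G ` supp f.
       if z \<otimes> y = x then adj CG h z * adj CG f y else 0)"
      by (rule mu_eq) (use a in \<open>auto simp: adj_supp[OF assms(1)] adj_supp[OF assms(2)]\<close>)
    also have "\<dots> = (\<Sum>z\<in>supp h. \<Sum>y\<in>supp f.
       if inv z \<otimes> inv y = x then adj CG h (inv z) * adj CG f (inv y) else 0)"
      by (simp add: sum.reindex inj assms)
    also have "\<dots> = (\<Sum>z\<in>supp h. \<Sum>y\<in>supp f. if y \<otimes> z = inv x then cnj (f y * h z) else 0)"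
    proof (intro sum.cong refl)
      fix z y assume "z \<in> supp h" "y \<in> supp f"
      hence c: "z \<in> carrier G" "y \<in> carrier G" using a by auto
      have "inv z \<otimes> inv y = x \<longleftrightarrow> y \<otimes> z = inv x"
        using c x inv_mult_group[of y z] by (metis inv_inv m_closed)
      thus "(if inv z \<otimes> inv y = x then adj CG h (inv z) * adj CG f (inv y) else 0)
        = (if y \<otimes> z = inv x then cnj (f y * h z) else 0)" using c by (simp add: CG_simps)
    qed
    also have "\<dots> = cnj (mu f h (inv x))"
      by (subst mu_eq[of "supp f" "supp h" f h], use a in simp_all, subst sum.swap)
         (auto intro!: sum.cong)
    finally show ?thesis using x by (simp add: CG_simps)
  next
    case False
    have "mu (adj CG h) (adj CG f) x = 0" using mu_out adj_closed assms False by blast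
    thus ?thesis using False by (simp add: CG_simps)
  qed
qed

lemma supp_add: "supp (\<lambda>x. f x + h x) \<subseteq> supp f \<union> supp h" for f h :: "'a \<Rightarrow> complex" by auto
lemma CG_add: "\<lbrakk>f \<in> carrier CG; h \<in> carrier CG\<rbrakk> \<Longrightarrow> (\<lambda>x. f x + h x) \<in> carrier CG"
  unfolding CG_simps using supp_add[of f h] finite_subset by blast
lemma CG_sm: "f \<in> carrier CG \<Longrightarrow> (\<lambda>x. c * f x) \<in> carrier CG"
  unfolding CG_simps by (auto elim: rev_finite_subset)

lemma CG0: "(\<lambda>x. 0) \<in> carrier CG" by (simp add: CG_simps(1))

lemma CG_ring: "ring CG"
proof (rule ringI)
  show "abelian_group CG"
  proof (rule abelian_groupI)
    fix f assume "f \<in> carrier CG"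
    thus "\<exists>h\<in>carrier CG. h \<oplus>\<^bsub>CG\<^esub> f = \<zero>\<^bsub>CG\<^esub>"
      by (intro bexI[of _ "\<lambda>x. (-1) * f x"] CG_sm) (simp add: CG_simps)
  qed (auto simp: CG_add CG0 CG_simps(2-))
  show "monoid CG"
    by (rule monoidI) (simp_all only: mu_closed mu_assoc mu_one dl_closed[OF one_closed, folded one_dl])
next
  fix f g h assume "f \<in> carrier CG" "g \<in> carrier CG" "h \<in> carrier CG"
  thus "(f \<oplus>\<^bsub>CG\<^esub> g) \<otimes>\<^bsub>CG\<^esub> h = f \<otimes>\<^bsub>CG\<^esub> h \<oplus>\<^bsub>CG\<^esub> g \<otimes>\<^bsub>CG\<^esub> h"
    "h \<otimes>\<^bsub>CG\<^esub> (f \<oplus>\<^bsub>CG\<^esub> g) = h \<otimes>\<^bsub>CG\<^esub> f \<oplus>\<^bsub>CG\<^esub> h \<otimes>\<^bsub>CG\<^esub> g"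
    by (simp_all only: CG_simps(4) mu_add_left mu_add_right)
qed

lemma CG_star: "unital_star_algebra CG"
proof -
  interpret C: ring CG by (rule CG_ring)
  have "module (class_ring :: complex ring) CG"
    by (rule moduleI)
       (auto simp: CG_sm C.abelian_group_axioms domain.axioms(1)[OF field.axioms(1)[OF class_field]] CG_simps(2-) algebra_simps)
  thus ?thesis
  proof (intro unital_star_algebra.intro unital_star_algebra_axioms.intro CG_ring)
    fix f assume f: "f \<in> carrier CG"
    show "adj CG f \<in> carrier CG" using adj_closed f .
    show "adj CG (adj CG f) = f" using f by (auto simp: CG_simps intro!: ext)
    fix c show "adj CG (c \<odot>\<^bsub>CG\<^esub> f) = cnj c \<odot>\<^bsub>CG\<^esub> adj CG f" by (auto simp: CG_simps)
    fix h assume h: "h \<in> carrier CG"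
    show "(c \<odot>\<^bsub>CG\<^esub> f) \<otimes>\<^bsub>CG\<^esub> h = c \<odot>\<^bsub>CG\<^esub> (f \<otimes>\<^bsub>CG\<^esub> h)"
      "f \<otimes>\<^bsub>CG\<^esub> (c \<odot>\<^bsub>CG\<^esub> h) = c \<odot>\<^bsub>CG\<^esub> (f \<otimes>\<^bsub>CG\<^esub> h)"
      using f h by (simp_all only: CG_simps(5) mu_smult)
    show "adj CG (f \<oplus>\<^bsub>CG\<^esub> h) = adj CG f \<oplus>\<^bsub>CG\<^esub> adj CG h" by (auto simp: CG_simps)
    show "adj CG (f \<otimes>\<^bsub>CG\<^esub> h) = adj CG h \<otimes>\<^bsub>CG\<^esub> adj CG f" by (rule adj_mu[OF f h])
  qed
qed

abbreviation "P \<equiv> {p. cstar_seminorm CG p}"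

lemma dl_norm: assumes p: "p \<in> P" and g: "g \<in> carrier G" shows "p (dl g) \<le> 1"
proof -
  have cs: "p (mu (adj CG f) f) = (p f)\<^sup>2" "0 \<le> p f" if "f \<in> carrier CG" for f
    using p that by (auto simp: cstar_seminorm_def)
  have a: "adj CG (dl g) = dl (inv g)"
    using g by (auto simp: CG_simps dl_def fun_eq_iff) 
  have m: "mu (dl (inv g)) (dl g) = dl \<one>"
    using mu_eq[of "{inv g}" "{g}" "dl (inv g)" "dl g"] g by (auto simp: dl_supp dl_def fun_eq_iff)
  have a1: "mu (adj CG (dl \<one>)) (dl \<one>) = dl \<one>"
  proof -
    have "adj CG (dl \<one>) = dl \<one>" by (auto simp: CG_simps dl_def fun_eq_iff inv_equality)
    thus ?thesis using mu_one(1)[OF dl_closed[OF one_closed]] by (simp add: one_dl)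
  qed
  have "(p (dl \<one>))\<^sup>2 = p (dl \<one>)" using cs(1)[OF dl_closed[OF one_closed]] a1 by simp
  hence "p (dl \<one>) \<le> 1" by (auto simp: power2_eq_square)
  moreover have "(p (dl g))\<^sup>2 = p (dl \<one>)" using cs(1)[OF dl_closed[OF g]] a m by simp
  ultimately show ?thesis using power2_le_imp_le[of "p (dl g)" 1] by simp
qed

lemma p_bound: assumes p: "p \<in> P" and f: "f \<in> carrier CG" shows "p f \<le> (\<Sum>x\<in>supp f. cmod (f x))"
proof -
  have *: "p (\<lambda>x. if x \<in> S then f x else 0) \<le> (\<Sum>x\<in>S. cmod (f x))" if S: "finite S" "S \<subseteq> carrier G" for S
    using S
  proof (induction S)
    case empty
    have "p (0 \<odot>\<^bsub>CG\<^esub> one CG) = cmod 0 * p (one CG)" 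
      using p dl_closed[OF one_closed] unfolding cstar_seminorm_def one_dl by blast
    thus ?case by (simp add: CG_simps)
  next
    case (insert g S)
    let ?fS = "\<lambda>x. if x \<in> S then f x else 0"
    have e: "(\<lambda>x. if x \<in> insert g S then f x else 0) = (f g \<odot>\<^bsub>CG\<^esub> dl g) \<oplus>\<^bsub>CG\<^esub> ?fS"
      using insert by (auto simp: CG_simps dl_def)
    have c: "?fS \<in> carrier CG" "dl g \<in> carrier CG" "f g \<odot>\<^bsub>CG\<^esub> dl g \<in> carrier CG"
      using insert CG_sm[OF dl_closed[of g]] dl_closed by (auto simp: CG_simps)
    have "p (\<lambda>x. if x \<in> insert g S then f x else 0) \<le> p (f g \<odot>\<^bsub>CG\<^esub> dl g) + p ?fS"
      unfolding e using p c by (auto simp: cstar_seminorm_def)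
    also have "p (f g \<odot>\<^bsub>CG\<^esub> dl g) = cmod (f g) * p (dl g)" using p c by (auto simp: cstar_seminorm_def)
    also have "\<dots> \<le> cmod (f g)" using dl_norm[OF p, of g] insert by (simp add: mult_left_le)
    finally show ?case using insert by simp
  qed
  have "(\<lambda>x. if x \<in> supp f then f x else 0) = f" by auto
  thus ?thesis using *[of "supp f"] f by (simp add: CG_simps)
qed

lemma P_ne: "P \<noteq> {}"
  by (auto simp: cstar_seminorm_def intro!: exI[of _ "\<lambda>_. 0"])

lemma P_bdd: "f \<in> carrier CG \<Longrightarrow> bdd_above ((\<lambda>p. p f) ` P)"
  using p_bound by (auto simp: bdd_above_def)

lemma le_full: "p \<in> P \<Longrightarrow> f \<in> carrier CG \<Longrightarrow> p f \<le> full_norm G f"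
  unfolding full_norm_def by (rule cSUP_upper) (auto intro: P_bdd[simplified])

lemma full_le: "(\<And>p. p \<in> P \<Longrightarrow> p f \<le> b) \<Longrightarrow> full_norm G f \<le> b"
  unfolding full_norm_def by (rule cSUP_least[OF P_ne])

lemma full_nn: "f \<in> carrier CG \<Longrightarrow> 0 \<le> full_norm G f"
  using le_full[of "\<lambda>_. 0" f] by (simp add: cstar_seminorm_def)

lemma full_csn: "cstar_seminorm CG (full_norm G)"
proof -
  interpret C: unital_star_algebra CG by (rule CG_star)
  have sm: "c \<odot>\<^bsub>CG\<^esub> f \<in> carrier CG" if "f \<in> carrier CG" for c f using CG_sm[OF that] by (simp add: CG_simps(5))
  have Pd: "0 \<le> p f" "p (c \<odot>\<^bsub>CG\<^esub> f) = cmod c * p f"  "p (adj CG f \<otimes>\<^bsub>CG\<^esub> f) = (p f)\<^sup>2"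
    if "p \<in> P" "f \<in> carrier CG" for p f c using that by (auto simp: cstar_seminorm_def)
  have Pd2: "p (f \<oplus>\<^bsub>CG\<^esub> h) \<le> p f + p h" "p (f \<otimes>\<^bsub>CG\<^esub> h) \<le> p f * p h"
    if "p \<in> P" "f \<in> carrier CG" "h \<in> carrier CG" for p f h using that by (auto simp: cstar_seminorm_def)
  have sle: "full_norm G (c \<odot>\<^bsub>CG\<^esub> f) \<le> cmod c * full_norm G f" if f: "f \<in> carrier CG" for c f
    by (rule full_le) (simp only: Pd(2)[OF _ f] mult_left_mono[OF le_full[OF _ f]] norm_ge_zero)
  show ?thesis unfolding cstar_seminorm_def
  proof (intro conjI ballI allI)
    fix f assume f: "f \<in> carrier CG"
    show "0 \<le> full_norm G f" using full_nn f .
    show "full_norm G (c \<odot>\<^bsub>CG\<^esub> f) = cmod c * full_norm G f" for c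
    proof (cases "c = 0")
      case True
      thus ?thesis using sle[OF f, of 0] full_nn[OF sm[OF f, of 0]] by simp
    next
      case False
      have "(1/c) \<odot>\<^bsub>CG\<^esub> (c \<odot>\<^bsub>CG\<^esub> f) = f" using False by (simp add: CG_simps)
      hence "full_norm G f \<le> cmod (1/c) * full_norm G (c \<odot>\<^bsub>CG\<^esub> f)"
        using sle[OF sm[OF f, of c], of "1/c"] by simp
      hence "cmod c * full_norm G f \<le> full_norm G (c \<odot>\<^bsub>CG\<^esub> f)" using False
        by (simp add: norm_divide field_simps)
      thus ?thesis using sle[OF f, of c] by simp
    qed
    have af: "adj CG f \<otimes>\<^bsub>CG\<^esub> f \<in> carrier CG" using f by (simp add: C.adj_closed)
    show "full_norm G (adj CG f \<otimes>\<^bsub>CG\<^esub> f) = (full_norm G f)\<^sup>2"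
    proof (rule antisym)
      show "full_norm G (adj CG f \<otimes>\<^bsub>CG\<^esub> f) \<le> (full_norm G f)\<^sup>2"
        by (rule full_le) (simp only: Pd(3)[OF _ f] power_mono[OF le_full[OF _ f] Pd(1)[OF _ f]])
      have "full_norm G f \<le> sqrt (full_norm G (adj CG f \<otimes>\<^bsub>CG\<^esub> f))"
        by (rule full_le, rule real_le_rsqrt) (metis Pd(3)[OF _ f] le_full[OF _ af])
      hence "(full_norm G f)\<^sup>2 \<le> (sqrt (full_norm G (adj CG f \<otimes>\<^bsub>CG\<^esub> f)))\<^sup>2"
        using full_nn[OF f] by (rule power_mono)
      thus "(full_norm G f)\<^sup>2 \<le> full_norm G (adj CG f \<otimes>\<^bsub>CG\<^esub> f)" using full_nn[OF af] by simp
    qed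
    fix h assume h: "h \<in> carrier CG"
    show "full_norm G (f \<oplus>\<^bsub>CG\<^esub> h) \<le> full_norm G f + full_norm G h"
      by (rule full_le) (meson Pd2(1) f h le_full add_mono order_trans)
    show "full_norm G (f \<otimes>\<^bsub>CG\<^esub> h) \<le> full_norm G f * full_norm G h"
      by (rule full_le) (meson Pd2(2) Pd(1) f h le_full mult_mono full_nn order_trans)
  qed
qed

theorem group_cstar_is_cstar: "unital_cstar_algebra (group_cstar G)"
proof -
  have "unital_star_algebra (normed_group_alg G)"
    by (rule star_cong[OF CG_star]) (simp_all add: normed_group_alg_def star_alg.defs)
  moreover have "cstar_seminorm (normed_group_alg G) (nrm (normed_group_alg G))"
    using full_csn by (simp add: normed_group_alg_def cstar_seminorm_def star_alg.defs)
  ultimately have "seminormed_star_algebra (normed_group_alg G)" by (intro seminormed_star_algebra.intro seminormed_star_algebra_axioms.intro)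
  thus ?thesis unfolding group_cstar_def by (rule seminormed_star_algebra.comp_cstar)
qed

end

theorem unital_cstar_algebra_group_cstar:
  "Group.group G \<Longrightarrow> unital_cstar_algebra (group_cstar G)"
  by (intro group_algebra.group_cstar_is_cstar group_algebra.intro)

end

theory Submission
  imports Defs
begin

text \<open>Unital completely positive maps \<open>C\<^sup>*(G) \<rightarrow> M\<^sub>n\<close> correspond to \<open>M\<^sub>n\<close>-valued positive definite
  functions \<open>\<phi>\<close> on \<open>G\<close> with \<open>\<phi>(1) = 1\<close>, so property (F) says that on every finite subset of \<open>G\<close> some
  such \<open>\<phi>\<close> has normalized trace close to \<open>\<delta>\<^sub>e\<close> and is almost multiplicative in the normalized
  Hilbert--Schmidt norm. Let \<open>S\<close> be a finite subset of \<open>N \<rtimes> K\<close>. As \<open>N\<close> is finitely generated and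
  residually finite, it has a finite quotient \<open>N/H\<close> with \<open>H\<close> characteristic in which the nontrivial
  \<open>N\<close>-components of elements of \<open>S\<close> survive. The group \<open>N \<rtimes> K\<close> acts on \<open>N/H\<close> by permutations, and
  the tensor product of the permutation matrices with an approximating \<open>\<phi>\<close> for \<open>K\<close>, pulled back to
  \<open>N \<rtimes> K\<close>, is the required function: an element of \<open>S \<inter> N\<close> other than \<open>1\<close> has no fixed point,
  and outside \<open>N\<close> the trace is already small because of \<open>\<phi>\<close>.\<close>

section \<open>Positive semidefinite kernels\<close>

text \<open>The full algebra is a completion in the largest C*-seminorm, so a positive definite
  function extends to it only once it is bounded by that norm. The bound comes from the GNS seminorm
  of a positive functional, which is one of the seminorms in the supremum; no Hilbert space is
  formed. Positive elements are defined as products adj Y times Y, so complete positivity asks for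
  an actual factor Y, which Cholesky elimination supplies. Positivity is phrased through scalar
  kernels on pairs (group element, matrix index), so that a tensor product with permutation matrices
  amounts to pulling a kernel back and deleting blocks.

  On the group side, a finite quotient of N chosen for S need not be respected by K. The subgroup H
  is therefore the intersection of the kernels of all homomorphisms from N into finitely many finite
  groups; finite generation leaves only finitely many of these, so H has finite index. Permutation
  matrices multiply exactly, so the tensor product has the same normalized defect as \<phi>, and its
  normalized trace is that of \<phi> times the proportion of fixed points.\<close>

definition psd :: "'p set \<Rightarrow> ('p \<Rightarrow> 'p \<Rightarrow> complex) \<Rightarrow> bool" where
  "psd S K \<longleftrightarrow> (\<forall>x. (\<Sum>p\<in>S. \<Sum>q\<in>S. cnj (x p) * K p q * x q) \<in> \<real>\<^sub>\<ge>\<^sub>0)"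

lemma psdD: "psd S K \<Longrightarrow> (\<Sum>p\<in>S. \<Sum>q\<in>S. cnj (x p) * K p q * x q) \<in> \<real>\<^sub>\<ge>\<^sub>0"
  unfolding psd_def by blast

lemma psdI: "(\<And>x. (\<Sum>p\<in>S. \<Sum>q\<in>S. cnj (x p) * K p q * x q) \<in> \<real>\<^sub>\<ge>\<^sub>0) \<Longrightarrow> psd S K"
  unfolding psd_def by blast

lemma psd_cong:
  assumes "\<And>p q. p \<in> S \<Longrightarrow> q \<in> S \<Longrightarrow> K p q = L p q"
  shows "psd S K \<longleftrightarrow> psd S L"
  unfolding psd_def using assms by (simp cong: sum.cong)

lemma sum_nonneg_Reals: "(\<And>p. p \<in> S \<Longrightarrow> f p \<in> \<real>\<^sub>\<ge>\<^sub>0) \<Longrightarrow> sum f S \<in> (\<real>\<^sub>\<ge>\<^sub>0 :: complex set)"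
  by (simp add: complex_nonneg_Reals_iff sum_nonneg)

lemma norm_sq_nonneg_Reals: "cnj z * z \<in> \<real>\<^sub>\<ge>\<^sub>0" "z * cnj z \<in> \<real>\<^sub>\<ge>\<^sub>0"
  by (simp_all add: complex_nonneg_Reals_iff)

lemma psd_subset:
  assumes "finite S" "T \<subseteq> S" "psd S K"
  shows "psd T K"
proof (rule psdI)
  fix x :: "'a \<Rightarrow> complex"
  let ?y = "\<lambda>p. if p \<in> T then x p else 0"
  have "(\<Sum>p\<in>S. \<Sum>q\<in>S. cnj (?y p) * K p q * ?y q) = (\<Sum>p\<in>T. \<Sum>q\<in>S. cnj (?y p) * K p q * ?y q)"
    using assms by (intro sum.mono_neutral_right) auto
  also have "\<dots> = (\<Sum>p\<in>T. \<Sum>q\<in>T. cnj (x p) * K p q * x q)"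
    using assms by (intro sum.cong[OF refl] sum.mono_neutral_cong_right) auto
  finally show "(\<Sum>p\<in>T. \<Sum>q\<in>T. cnj (x p) * K p q * x q) \<in> \<real>\<^sub>\<ge>\<^sub>0"
    using psdD[OF assms(3), of ?y] by simp
qed

text \<open>The form of the pulled-back kernel at \<open>x\<close> is the form of \<open>K\<close>
  at the push-forward of \<open>x\<close>, which sums \<open>x\<close> over the fibres of
  \<open>f\<close>. Large fibres do occur: many elements of a semidirect product have the same image
  in the quotient.\<close>

lemma psd_comp:
  assumes S: "finite S" and K: "psd (f ` S) K"
  shows "psd S (\<lambda>p q. K (f p) (f q))"
proof (rule psdI)
  fix x :: "'a \<Rightarrow> complex"
  let ?y = "\<lambda>r. \<Sum>p\<in>{p \<in> S. f p = r}. x p"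
  have 1: "(\<Sum>q\<in>S. k (f q) * x q) = (\<Sum>s\<in>f ` S. k s * ?y s)" for k
    by (subst sum.image_gen[OF S, of _ f]) (auto simp: sum_distrib_left intro!: sum.cong)
  have 2: "(\<Sum>q\<in>S. cnj (x q) * k (f q)) = (\<Sum>s\<in>f ` S. cnj (?y s) * k s)" for k
    by (subst sum.image_gen[OF S, of _ f]) (auto simp: sum_distrib_right intro!: sum.cong)
  have "(\<Sum>p\<in>S. \<Sum>q\<in>S. cnj (x p) * K (f p) (f q) * x q)
      = (\<Sum>p\<in>S. cnj (x p) * (\<Sum>q\<in>S. K (f p) (f q) * x q))"
    by (simp add: sum_distrib_left mult.assoc)
  also have "\<dots> = (\<Sum>r\<in>f ` S. cnj (?y r) * (\<Sum>s\<in>f ` S. K r s * ?y s))"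
    unfolding 1 by (rule 2)
  also have "\<dots> = (\<Sum>r\<in>f ` S. \<Sum>s\<in>f ` S. cnj (?y r) * K r s * ?y s)"
    by (simp only: sum_distrib_left mult.assoc)
  finally show "(\<Sum>p\<in>S. \<Sum>q\<in>S. cnj (x p) * K (f p) (f q) * x q) \<in> \<real>\<^sub>\<ge>\<^sub>0"
    using psdD[OF K, of ?y] by simp
qed

text \<open>Deleting the entries between different fibres of \<open>e\<close> leaves a block
  diagonal kernel whose blocks are restrictions of \<open>K\<close>. Permutation matrices enter
  through this lemma, with \<open>e\<close> sending (g, C, a) to the translate of C by g.\<close>

lemma psd_block:
  assumes S: "finite S" and K: "psd S K"
  shows "psd S (\<lambda>p q. if e p = e q then K p q else 0)"
proof (rule psdI)
  fix x :: "'a \<Rightarrow> complex"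
  have "(\<Sum>p\<in>S. \<Sum>q\<in>S. cnj (x p) * (if e p = e q then K p q else 0) * x q)
      = (\<Sum>E\<in>e ` S. \<Sum>p\<in>{p \<in> S. e p = E}. \<Sum>q\<in>S. cnj (x p) * (if e p = e q then K p q else 0) * x q)"
    by (rule sum.image_gen[OF S])
  also have "\<dots> = (\<Sum>E\<in>e ` S. \<Sum>p\<in>{p \<in> S. e p = E}. \<Sum>q\<in>{p \<in> S. e p = E}. cnj (x p) * K p q * x q)"
    using S by (intro sum.cong[OF refl] sum.mono_neutral_cong_right) auto
  also have "\<dots> \<in> \<real>\<^sub>\<ge>\<^sub>0"
    by (intro sum_nonneg_Reals psdD psd_subset[OF S _ K]) auto
  finally show "(\<Sum>p\<in>S. \<Sum>q\<in>S. cnj (x p) * (if e p = e q then K p q else 0) * x q) \<in> \<real>\<^sub>\<ge>\<^sub>0" .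
qed

lemma psd_diag:
  assumes "finite S" "psd S K" "p \<in> S"
  shows "K p p \<in> \<real>\<^sub>\<ge>\<^sub>0"
proof -
  have "psd {p} K" using assms psd_subset[of S "{p}"] by simp
  from psdD[OF this, of "\<lambda>_. 1"] show ?thesis by simp
qed

lemma psd_pair:
  assumes "finite S" "psd S K" "p \<in> S" "q \<in> S" "p \<noteq> q"
  shows "cnj a * K p p * a + cnj a * K p q * b + cnj b * K q p * a + cnj b * K q q * b \<in> \<real>\<^sub>\<ge>\<^sub>0"
proof -
  have "psd {p, q} K" using assms psd_subset[of S "{p, q}"] by simp
  from psdD[OF this, of "\<lambda>r. if r = p then a else b"] show ?thesis using assms(5) by (simp add: add_ac)
qed

text \<open>Polarization. Membership in the nonnegative reals includes being real, so the vectors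
  (1, 1) and (1, \<i>) force the imaginary parts of \<open>K p q\<close> and \<open>K q p\<close> to
  cancel and their real parts to agree.\<close>

lemma psd_hermitian:
  assumes "finite S" "psd S K" "p \<in> S" "q \<in> S"
  shows "K q p = cnj (K p q)"
proof (cases "p = q")
  case True
  thus ?thesis using psd_diag[OF assms(1,2,3)] by (simp add: complex_nonneg_Reals_iff complex_eq_iff)
next
  case False
  have "K p p \<in> \<real>\<^sub>\<ge>\<^sub>0" "K q q \<in> \<real>\<^sub>\<ge>\<^sub>0" using psd_diag[OF assms(1,2)] assms(3,4) by auto
  moreover have "K p p + K p q + K q p + K q q \<in> \<real>\<^sub>\<ge>\<^sub>0"
    using psd_pair[OF assms False, of 1 1] by simp
  moreover have "K p p + K p q * \<i> - \<i> * K q p + K q q \<in> \<real>\<^sub>\<ge>\<^sub>0"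
  proof -
    have "cnj 1 * K p p * 1 + cnj 1 * K p q * \<i> + cnj \<i> * K q p * 1 + cnj \<i> * K q q * \<i>
      = K p p + K p q * \<i> - \<i> * K q p + K q q" by (simp add: mult.commute)
    thus ?thesis using psd_pair[OF assms False, of 1 \<i>] by simp
  qed
  ultimately have "Im (K p p) = 0" "Im (K q q) = 0" "Im (K p p + K p q + K q p + K q q) = 0"
    "Im (K p p + K p q * \<i> - \<i> * K q p + K q q) = 0" unfolding complex_nonneg_Reals_iff by blast+
  thus ?thesis by (simp add: complex_eq_iff)
qed

text \<open>With a vanishing diagonal entry the form at the vector with entries \<open>s\<close> at
  \<open>p\<close> and 1 at \<open>q\<close> is real-affine in \<open>s\<close>, hence unbounded
  below unless \<open>K p q = 0\<close>.\<close>

lemma psd_diag_0: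
  assumes "finite S" "psd S K" "p \<in> S" "q \<in> S" "K p p = 0"
  shows "K p q = 0"
proof (cases "p = q")
  case False
  have h: "K q p = cnj (K p q)" using psd_hermitian[OF assms(1-4)] .
  have kq: "0 \<le> Re (K q q)" using psd_diag[OF assms(1,2,4)] by (simp add: complex_nonneg_Reals_iff)
  show ?thesis
  proof (rule ccontr)
    assume n: "K p q \<noteq> 0"
    \<comment> \<open>With this factor the form takes the value - Re (K q q) - 2, which is
      negative.\<close>
    define c where "c = - (Re (K q q) + 1) / (cmod (K p q))\<^sup>2"
    have c: "c * (cmod (K p q))\<^sup>2 = - (Re (K q q) + 1)" using n by (simp add: c_def)
    let ?s = "of_real c * K p q"
    have "cnj ?s * K p q + K q p * ?s + K q q \<in> \<real>\<^sub>\<ge>\<^sub>0"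
      using psd_pair[OF assms(1-4) False, of ?s 1] assms(5) by simp
    hence "0 \<le> Re (cnj ?s * K p q + K q p * ?s + K q q)"
      by (simp only: complex_nonneg_Reals_iff)
    also have "\<dots> = Re (K q q) + 2 * (c * (cmod (K p q))\<^sup>2)"
      by (simp add: h cmod_power2) (simp add: power2_eq_square algebra_simps)
    finally show False using c kq by linarith
  qed
qed (use assms in simp)

lemma psd_gram:
  assumes "\<And>p q. p \<in> S \<Longrightarrow> q \<in> S \<Longrightarrow> K p q = (\<Sum>r\<in>R. cnj (Z r p) * Z r q)"
  shows "psd S K"
proof (rule psdI)
  fix x :: "'a \<Rightarrow> complex"
  have "(\<Sum>p\<in>S. \<Sum>q\<in>S. cnj (x p) * K p q * x q)
      = (\<Sum>p\<in>S. \<Sum>q\<in>S. \<Sum>r\<in>R. cnj (Z r p * x p) * (Z r q * x q))"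
    using assms by (simp add: sum_distrib_left sum_distrib_right mult_ac cong: sum.cong)
  also have "\<dots> = (\<Sum>r\<in>R. \<Sum>p\<in>S. \<Sum>q\<in>S. cnj (Z r p * x p) * (Z r q * x q))"
    by (rule trans[OF sum.cong[OF refl sum.swap] sum.swap])
  also have "\<dots> = (\<Sum>r\<in>R. cnj (\<Sum>p\<in>S. Z r p * x p) * (\<Sum>q\<in>S. Z r q * x q))"
    by (simp only: cnj_sum sum_product)
  also have "\<dots> \<in> \<real>\<^sub>\<ge>\<^sub>0" by (intro sum_nonneg_Reals norm_sq_nonneg_Reals)
  finally show "(\<Sum>p\<in>S. \<Sum>q\<in>S. cnj (x p) * K p q * x q) \<in> \<real>\<^sub>\<ge>\<^sub>0" .
qed

lemma psd_tendsto:
  assumes S: "finite S" and K: "\<And>n. psd S (K n)"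
    and lim: "\<And>p q. p \<in> S \<Longrightarrow> q \<in> S \<Longrightarrow> (\<lambda>n. K n p q) \<longlonglongrightarrow> L p q"
  shows "psd S L"
proof (rule psdI)
  fix x :: "'a \<Rightarrow> complex"
  have "(\<lambda>n. \<Sum>p\<in>S. \<Sum>q\<in>S. cnj (x p) * K n p q * x q) \<longlonglongrightarrow> (\<Sum>p\<in>S. \<Sum>q\<in>S. cnj (x p) * L p q * x q)"
    by (intro tendsto_intros lim)
  thus "(\<Sum>p\<in>S. \<Sum>q\<in>S. cnj (x p) * L p q * x q) \<in> \<real>\<^sub>\<ge>\<^sub>0"
    by (rule closed_sequentially[OF closed_nonneg_Reals_complex, rotated]) (rule psdD[OF K])
qed

text \<open>Cholesky elimination of one index at a time.\<close>

lemma psd_imp_gram: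
  assumes "finite S" "psd S K"
  shows "\<exists>Z. \<forall>p\<in>S. \<forall>q\<in>S. K p q = (\<Sum>r\<in>S. cnj (Z r p) * Z r q)"
  using assms
proof (induction S arbitrary: K)
  case (insert p S)
  let ?T = "insert p S"
  have T: "finite ?T" using insert by simp
  define d where "d = K p p"
  have d: "d \<in> \<real>\<^sub>\<ge>\<^sub>0" unfolding d_def by (rule psd_diag[OF T insert.prems]) simp
  have h: "K q s = cnj (K s q)" if "q \<in> ?T" "s \<in> ?T" for q s
    using psd_hermitian[OF T insert.prems that(2,1)] .
  have h0: "K p s = 0" if "d = 0" "s \<in> ?T" for s
    by (rule psd_diag_0[OF T insert.prems]) (use that d_def in auto)
  have h1: "K s p = 0" if "d = 0" "s \<in> ?T" for s
    using h0[OF that] h[OF that(2), of p] by simp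
  \<comment> \<open>The Schur complement of the pivot \<open>d\<close>. For \<open>d = 0\<close> the
    quotient is 0 by convention and \<open>L\<close> is \<open>K\<close>; this remains correct
    because row and column \<open>p\<close> of \<open>K\<close> then vanish.\<close>
  define L where "L q s = K q s - K q p * K p s / d" for q s
  have "psd S L"
  proof (cases "d = 0")
    case True
    have "psd S K" by (rule psd_subset[OF T _ insert.prems]) blast
    moreover have "L = K" by (simp add: L_def True fun_eq_iff)
    ultimately show ?thesis by simp
  next
    case False
    show ?thesis
    proof (rule psdI)
      fix x :: "'a \<Rightarrow> complex"
      define u where "u = (\<Sum>s\<in>S. K p s * x s)"
      have "cnj (x q) * K q p = cnj (K p q * x q)" if "q \<in> S" for q
        using h[of q p] that by simp
      hence u': "(\<Sum>q\<in>S. cnj (x q) * K q p) = cnj u"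
        unfolding u_def cnj_sum by (intro sum.cong refl)
      \<comment> \<open>The entry - u / d at \<open>p\<close> completes the square: it minimizes the
        form of \<open>K\<close> in that coordinate, and the minimum is the form of \<open>L\<close>
        at \<open>x\<close>.\<close>
      define y where "y q = (if q = p then - u / d else x q)" for q
      have cd: "cnj d = d" using d by (simp add: complex_nonneg_Reals_iff complex_eq_iff)
      have yS: "y q = x q" if "q \<in> S" for q using insert.hyps that by (auto simp: y_def)
      have "(\<Sum>q\<in>?T. \<Sum>s\<in>?T. cnj (y q) * K q s * y s) =
        cnj (y p) * d * y p + cnj (y p) * (\<Sum>s\<in>S. K p s * x s) + (\<Sum>q\<in>S. cnj (x q) * K q p) * y p
         + (\<Sum>q\<in>S. \<Sum>s\<in>S. cnj (x q) * K q s * x s)"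
        using insert.hyps by (simp add: d_def yS sum.distrib sum_distrib_left sum_distrib_right mult.assoc cong: sum.cong)
      also have "\<dots> = (\<Sum>q\<in>S. \<Sum>s\<in>S. cnj (x q) * K q s * x s) - cnj u * u / d"
        unfolding u_def[symmetric] u' using False by (simp add: y_def cd field_simps)
      also have "cnj u * u / d = (\<Sum>q\<in>S. \<Sum>s\<in>S. cnj (x q) * (K q p * K p s / d) * x s)"
        unfolding u'[symmetric] unfolding u_def sum_product sum_divide_distrib by (simp add: mult_ac)
      also have "(\<Sum>q\<in>S. \<Sum>s\<in>S. cnj (x q) * K q s * x s) - \<dots> = (\<Sum>q\<in>S. \<Sum>s\<in>S. cnj (x q) * L q s * x s)"
        by (simp add: L_def sum_subtractf[symmetric] algebra_simps)
      finally show "(\<Sum>q\<in>S. \<Sum>s\<in>S. cnj (x q) * L q s * x s) \<in> \<real>\<^sub>\<ge>\<^sub>0"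
        using psdD[OF insert.prems, of y] by simp
    qed
  qed
  then obtain Z where Z: "\<And>q s. q \<in> S \<Longrightarrow> s \<in> S \<Longrightarrow> L q s = (\<Sum>r\<in>S. cnj (Z r q) * Z r s)"
    using insert.IH by blast
  define w :: complex where "w = of_real (sqrt (Re d))"
  have ww: "w * w = d" "cnj w = w"
    using d by (auto simp: w_def complex_nonneg_Reals_iff complex_eq_iff)
  \<comment> \<open>Row \<open>p\<close> of the factor reproduces the term removed from
    \<open>K\<close> in \<open>L\<close>; the remaining rows are those of \<open>L\<close>, padded
    by a zero in column \<open>p\<close>. For \<open>d = 0\<close> also \<open>w = 0\<close>, and
    row \<open>p\<close> is zero.\<close>
  define Y where "Y r q = (if r = p then K p q / w else if q = p then 0 else Z r q)" for r q
  have L0: "L q s = 0" if "q = p \<or> s = p" "q \<in> ?T" "s \<in> ?T" for q s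
  proof (cases "d = 0")
    case True
    have "K q p * K p s = 0" "K q s = 0" using that(1) h0[OF True] h1[OF True] that(2,3) by fastforce+
    thus ?thesis by (simp add: L_def)
  next
    case False
    from that(1) show ?thesis
      by (elim disjE; hypsubst) (use False in \<open>simp_all add: L_def d_def\<close>)
  qed
  have "K q s = (\<Sum>r\<in>?T. cnj (Y r q) * Y r s)" if qs: "q \<in> ?T" "s \<in> ?T" for q s
  proof -
    have "(\<Sum>r\<in>?T. cnj (Y r q) * Y r s) = cnj (K p q / w) * (K p s / w) + (\<Sum>r\<in>S. cnj (Y r q) * Y r s)"
      using insert.hyps by (simp add: Y_def)
    also have "cnj (K p q / w) * (K p s / w) = K q p * K p s / d"
      by (subst h[of q p]) (use qs ww in simp_all)
    also have "(\<Sum>r\<in>S. cnj (Y r q) * Y r s) = L q s"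
    proof (cases "q = p \<or> s = p")
      case True
      thus ?thesis using L0[OF True qs] insert.hyps by (auto simp: Y_def intro!: sum.neutral)
    next
      case False
      have "(\<Sum>r\<in>S. cnj (Y r q) * Y r s) = (\<Sum>r\<in>S. cnj (Z r q) * Z r s)"
        using False insert.hyps by (intro sum.cong) (auto simp: Y_def)
      thus ?thesis using False Z[of q s] qs by auto
    qed
    finally show ?thesis by (simp add: L_def)
  qed
  thus ?case by blast
qed simp

text \<open>The block matrix with blocks \<phi>(inv g h), flattened to a scalar kernel on pairs. The
  index set is arbitrary, so that a tensor product may be indexed by a product set.\<close>

definition pd :: "('g, 'm) monoid_scheme \<Rightarrow> 'i set \<Rightarrow> ('g \<Rightarrow> 'i \<Rightarrow> 'i \<Rightarrow> complex) \<Rightarrow> bool" where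
  "pd G I \<phi> \<longleftrightarrow> (\<forall>F. finite F \<and> F \<subseteq> carrier G \<longrightarrow>
     psd (F \<times> I) (\<lambda>(g, a) (h, b). \<phi> (inv\<^bsub>G\<^esub> g \<otimes>\<^bsub>G\<^esub> h) a b))"

text \<open>The new kernel is the congruence of \<open>K\<close> by the matrix \<open>M\<close>: its
  form at \<open>x\<close> is the form of \<open>K\<close> at \<open>M x\<close>.\<close>

lemma psd_congruence:
  assumes K: "psd P K"
  shows "psd Q (\<lambda>q q'. \<Sum>p\<in>P. \<Sum>p'\<in>P. cnj (M p q) * K p p' * M p' q')"
proof (rule psdI)
  fix x :: "'b \<Rightarrow> complex"
  have "(\<Sum>q\<in>Q. \<Sum>q'\<in>Q. cnj (x q) * (\<Sum>p\<in>P. \<Sum>p'\<in>P. cnj (M p q) * K p p' * M p' q') * x q')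
     = (\<Sum>q\<in>Q. \<Sum>q'\<in>Q. \<Sum>p\<in>P. \<Sum>p'\<in>P. cnj (M p q * x q) * K p p' * (M p' q' * x q'))"
    by (simp add: sum_distrib_left sum_distrib_right mult_ac)
  also have "\<dots> = (\<Sum>q\<in>Q. \<Sum>p\<in>P. \<Sum>q'\<in>Q. \<Sum>p'\<in>P. cnj (M p q * x q) * K p p' * (M p' q' * x q'))"
    by (intro sum.cong[OF refl] sum.swap)
  also have "\<dots> = (\<Sum>p\<in>P. \<Sum>q\<in>Q. \<Sum>q'\<in>Q. \<Sum>p'\<in>P. cnj (M p q * x q) * K p p' * (M p' q' * x q'))"
    by (rule sum.swap)
  also have "\<dots> = (\<Sum>p\<in>P. \<Sum>q\<in>Q. \<Sum>p'\<in>P. \<Sum>q'\<in>Q. cnj (M p q * x q) * K p p' * (M p' q' * x q'))"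
    by (intro sum.cong[OF refl] sum.swap)
  also have "\<dots> = (\<Sum>p\<in>P. \<Sum>p'\<in>P. \<Sum>q\<in>Q. \<Sum>q'\<in>Q. cnj (M p q * x q) * K p p' * (M p' q' * x q'))"
    by (intro sum.cong[OF refl] sum.swap)
  also have "\<dots> = (\<Sum>p\<in>P. \<Sum>p'\<in>P. cnj (\<Sum>q\<in>Q. M p q * x q) * K p p' * (\<Sum>q'\<in>Q. M p' q' * x q'))"
    by (simp only: cnj_sum sum_distrib_left sum_distrib_right) (intro sum.cong[OF refl] sum.swap)
  finally show "(\<Sum>q\<in>Q. \<Sum>q'\<in>Q. cnj (x q) * (\<Sum>p\<in>P. \<Sum>p'\<in>P. cnj (M p q) * K p p' * M p' q') * x q') \<in> \<real>\<^sub>\<ge>\<^sub>0"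
    by (simp only: psdD[OF K])
qed

text \<open>Writing \<open>K\<close> as a Gram kernel turns the claim into the Cauchy-Schwarz
  inequality for two columns of \<open>Z\<close>.\<close>

lemma psd_cauchy_schwarz:
  assumes S: "finite S" "psd S K" "p \<in> S" "q \<in> S"
  shows "(cmod (K p q))\<^sup>2 \<le> Re (K p p) * Re (K q q)"
proof -
  obtain Z where Z: "\<And>p q. p \<in> S \<Longrightarrow> q \<in> S \<Longrightarrow> K p q = (\<Sum>r\<in>S. cnj (Z r p) * Z r q)"
    using psd_imp_gram[OF S(1,2)] by metis
  have d: "Re (K p p) = (L2_set (\<lambda>r. cmod (Z r p)) S)\<^sup>2" if "p \<in> S" for p
    using Z[OF that that] by (simp add: L2_set_def sum_nonneg cmod_power2) (simp add: power2_eq_square)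
  have "cmod (K p q) \<le> (\<Sum>r\<in>S. cmod (Z r p) * cmod (Z r q))"
    unfolding Z[OF S(3,4)] by (rule order_trans[OF norm_sum]) (simp add: norm_mult)
  also have "\<dots> \<le> L2_set (\<lambda>r. cmod (Z r p)) S * L2_set (\<lambda>r. cmod (Z r q)) S"
    using L2_set_mult_ineq[of "\<lambda>r. cmod (Z r p)" "\<lambda>r. cmod (Z r q)" S] by simp
  finally have "(cmod (K p q))\<^sup>2 \<le> (L2_set (\<lambda>r. cmod (Z r p)) S * L2_set (\<lambda>r. cmod (Z r q)) S)\<^sup>2"
    by (rule power_mono) simp
  thus ?thesis using d S(3,4) by (simp add: power_mult_distrib)
qed

section \<open>Positive functionals and the universal norm\<close>

context unital_star_algebra
begin

lemma scale_closed [simp, intro]: "x \<in> carrier A \<Longrightarrow> c \<odot> x \<in> carrier A"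
  using M.smult_closed by simp

lemma scale_one: "x \<in> carrier A \<Longrightarrow> 1 \<odot> x = x"
  using M.smult_one by simp

lemma scale_scale: "x \<in> carrier A \<Longrightarrow> a \<odot> (b \<odot> x) = (a * b) \<odot> x"
  using M.smult_assoc1[of a b x] by simp

lemma adj_one: "adj A \<one> = \<one>"
  using adj_mult[of "adj A \<one>" \<one>] adj_adj adj_closed by simp

end

locale positive_functional = unital_star_algebra A for A :: "('a, 'm) star_alg_scheme" (structure) +
  fixes \<omega> :: "'a \<Rightarrow> complex"
  assumes func_add: "\<lbrakk>x \<in> carrier A; y \<in> carrier A\<rbrakk> \<Longrightarrow> \<omega> (x \<oplus> y) = \<omega> x + \<omega> y"
    and func_scale: "x \<in> carrier A \<Longrightarrow> \<omega> (c \<odot> x) = c * \<omega> x"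
    and func_pos: "x \<in> carrier A \<Longrightarrow> \<omega> (adj A x \<otimes> x) \<in> \<real>\<^sub>\<ge>\<^sub>0"
begin

definition form :: "'a \<Rightarrow> 'a \<Rightarrow> complex" where "form x y = \<omega> (adj A x \<otimes> y)"

definition seminorm :: "'a \<Rightarrow> real" where "seminorm x = sqrt (Re (form x x))"

lemma form_add_right: "\<lbrakk>x \<in> carrier A; y \<in> carrier A; z \<in> carrier A\<rbrakk> \<Longrightarrow> form x (y \<oplus> z) = form x y + form x z"
  by (simp add: form_def adj_closed R.r_distr func_add)

lemma form_add_left: "\<lbrakk>x \<in> carrier A; y \<in> carrier A; z \<in> carrier A\<rbrakk> \<Longrightarrow> form (x \<oplus> y) z = form x z + form y z"
  by (simp add: form_def adj_closed adj_add R.l_distr func_add)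

lemma form_scale_right: "\<lbrakk>x \<in> carrier A; y \<in> carrier A\<rbrakk> \<Longrightarrow> form x (c \<odot> y) = c * form x y"
  by (simp add: form_def adj_closed smult_mult_right func_scale)

lemma form_scale_left: "\<lbrakk>x \<in> carrier A; y \<in> carrier A\<rbrakk> \<Longrightarrow> form (c \<odot> x) y = cnj c * form x y"
  by (simp add: form_def adj_closed adj_smult smult_mult_left func_scale)

lemma form_mult_right: "\<lbrakk>x \<in> carrier A; y \<in> carrier A; z \<in> carrier A\<rbrakk> \<Longrightarrow> form x (y \<otimes> z) = form (adj A y \<otimes> x) z"
  by (simp add: form_def adj_closed adj_mult adj_adj R.m_assoc)

lemma form_pos: "x \<in> carrier A \<Longrightarrow> form x x \<in> \<real>\<^sub>\<ge>\<^sub>0"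
  by (simp add: form_def func_pos)

lemma seminorm_nonneg: "x \<in> carrier A \<Longrightarrow> 0 \<le> seminorm x"
  using form_pos by (simp add: seminorm_def complex_nonneg_Reals_iff)

lemma seminorm_sq: "x \<in> carrier A \<Longrightarrow> (seminorm x)\<^sup>2 = Re (form x x)"
  using form_pos by (simp add: seminorm_def complex_nonneg_Reals_iff)

text \<open>The Gram matrix of \<open>x\<close> and \<open>y\<close>, indexed by the Booleans, is
  positive semidefinite, because its quadratic form is \<open>form\<close> on a linear combination
  of \<open>x\<close> and \<open>y\<close>.\<close>

lemma form_cauchy_schwarz:
  assumes x: "x \<in> carrier A" and y: "y \<in> carrier A"
  shows "cmod (form x y) \<le> seminorm x * seminorm y"
proof -
  let ?f = "\<lambda>b. if b then x else y"
  have "psd UNIV (\<lambda>b c. form (?f b) (?f c))"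
  proof (rule psdI)
    fix z :: "bool \<Rightarrow> complex"
    have "(\<Sum>p\<in>UNIV. \<Sum>q\<in>UNIV. cnj (z p) * form (?f p) (?f q) * z q)
       = form (z True \<odot> x \<oplus> z False \<odot> y) (z True \<odot> x \<oplus> z False \<odot> y)"
      using x y by (simp add: UNIV_bool form_add_left form_add_right form_scale_left form_scale_right
          algebra_simps)
    also have "\<dots> \<in> \<real>\<^sub>\<ge>\<^sub>0" using x y by (intro form_pos) simp
    finally show "(\<Sum>p\<in>UNIV. \<Sum>q\<in>UNIV. cnj (z p) * form (?f p) (?f q) * z q) \<in> \<real>\<^sub>\<ge>\<^sub>0" .
  qed
  from psd_cauchy_schwarz[OF _ this, of True False]
  have "(cmod (form x y))\<^sup>2 \<le> (seminorm x * seminorm y)\<^sup>2"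
    using x y by (simp add: power_mult_distrib seminorm_sq)
  thus ?thesis by (rule power2_le_imp_le) (use x y in \<open>simp add: seminorm_nonneg\<close>)
qed

lemma seminorm_add:
  assumes x: "x \<in> carrier A" and y: "y \<in> carrier A"
  shows "seminorm (x \<oplus> y) \<le> seminorm x + seminorm y"
proof (rule power2_le_imp_le)
  have "Re (form x y) \<le> seminorm x * seminorm y" "Re (form y x) \<le> seminorm x * seminorm y"
    using form_cauchy_schwarz[OF x y] form_cauchy_schwarz[OF y x]
      complex_Re_le_cmod[of "form x y"] complex_Re_le_cmod[of "form y x"] by (simp_all add: mult.commute)
  thus "(seminorm (x \<oplus> y))\<^sup>2 \<le> (seminorm x + seminorm y)\<^sup>2"
    using x y by (simp add: seminorm_sq form_add_left form_add_right power2_sum)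
qed (use assms seminorm_nonneg in simp)

lemma seminorm_scale:
  assumes "x \<in> carrier A"
  shows "seminorm (c \<odot> x) = cmod c * seminorm x"
proof (rule power2_eq_imp_eq)
  have "form (c \<odot> x) (c \<odot> x) = of_real ((cmod c)\<^sup>2) * form x x"
    using assms complex_norm_square[of c]
    by (simp add: form_scale_left form_scale_right mult_ac)
  hence "Re (form (c \<odot> x) (c \<odot> x)) = (cmod c)\<^sup>2 * Re (form x x)"
    by (simp only: Re_complex_of_real complex.sel times_complex.sel Im_complex_of_real mult_zero_left diff_zero)
  thus "(seminorm (c \<odot> x))\<^sup>2 = (cmod c * seminorm x)\<^sup>2"
    using assms by (simp add: seminorm_sq power_mult_distrib)
qed (use assms seminorm_nonneg in auto)

text \<open>The Gelfand--Naimark--Segal construction, recorded only through the operator norm of left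
  multiplication on the pre-Hilbert space \<open>(A, form)\<close>.\<close>

theorem bounded_positive_functional:
  assumes bounded: "\<And>x. x \<in> carrier A \<Longrightarrow> \<exists>C\<ge>0. \<forall>h\<in>carrier A. seminorm (x \<otimes> h) \<le> C * seminorm h"
  obtains p where "cstar_seminorm A p" "\<And>x. x \<in> carrier A \<Longrightarrow> cmod (\<omega> x) \<le> Re (\<omega> \<one>) * p x"
proof -
  define B where "B x = {C. 0 \<le> C \<and> (\<forall>h\<in>carrier A. seminorm (x \<otimes> h) \<le> C * seminorm h)}" for x
  define p where "p x = Inf (B x)" for x
  have ne: "B x \<noteq> {}" if "x \<in> carrier A" for x using bounded[OF that] by (auto simp: B_def)
  have bb: "bdd_below (B x)" for x by (auto simp: B_def bdd_below_def)
  have p_le: "p x \<le> C" if "0 \<le> C" "\<And>h. h \<in> carrier A \<Longrightarrow> seminorm (x \<otimes> h) \<le> C * seminorm h" for x C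
    unfolding p_def by (rule cInf_lower[OF _ bb]) (use that in \<open>simp add: B_def\<close>)
  have p0: "0 \<le> p x" if "x \<in> carrier A" for x
    unfolding p_def by (rule cInf_greatest[OF ne[OF that]]) (simp add: B_def)
  \<comment> \<open>The infimum is itself an admissible constant. Since the form may be degenerate,
    vectors of seminorm 0 need their own argument: any admissible constant shows that left
    multiplication maps them to vectors of seminorm 0.\<close>
  have le_p: "seminorm (x \<otimes> h) \<le> p x * seminorm h" if x: "x \<in> carrier A" and h: "h \<in> carrier A" for x h
  proof (cases "seminorm h = 0")
    case True
    obtain C where "C \<in> B x" using ne[OF x] by blast
    hence "seminorm (x \<otimes> h) \<le> C * seminorm h" using h by (simp add: B_def)
    thus ?thesis by (simp add: True)
  next
    case False
    hence pos: "seminorm h > 0" using seminorm_nonneg[OF h] by simp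
    have "seminorm (x \<otimes> h) / seminorm h \<le> p x"
      unfolding p_def by (rule cInf_greatest[OF ne[OF x]]) (use pos h in \<open>simp add: B_def divide_le_eq\<close>)
    thus ?thesis using pos by (simp add: divide_le_eq)
  qed
  \<comment> \<open>The half of the C*-identity that depends on the form: the squared length of
    \<open>x h\<close> is the form of \<open>h\<close> against (adj x) x h, which Cauchy-Schwarz
    bounds. The other half will follow from submultiplicativity once \<open>adj\<close> is known to
    be isometric.\<close>
  have sq: "p x \<le> sqrt (p (adj A x \<otimes> x))" if x: "x \<in> carrier A" for x
  proof (rule p_le)
    let ?y = "adj A x \<otimes> x"
    have y: "?y \<in> carrier A" using x adj_closed by simp
    show "0 \<le> sqrt (p ?y)" using p0[OF y] by simp
    fix h assume h: "h \<in> carrier A"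
    have "(seminorm (x \<otimes> h))\<^sup>2 = Re (form h (?y \<otimes> h))"
      using x h adj_closed by (simp add: seminorm_sq form_mult_right adj_mult adj_adj R.m_assoc)
    also have "\<dots> \<le> seminorm h * seminorm (?y \<otimes> h)"
      using form_cauchy_schwarz[of h "?y \<otimes> h"] h y complex_Re_le_cmod[of "form h (?y \<otimes> h)"] by simp
    also have "\<dots> \<le> seminorm h * (p ?y * seminorm h)"
      using le_p[OF y h] seminorm_nonneg[OF h] by (rule mult_left_mono)
    also have "\<dots> = (sqrt (p ?y) * seminorm h)\<^sup>2"
      using p0[OF y] by (simp add: power_mult_distrib) (simp add: power2_eq_square)
    finally show "seminorm (x \<otimes> h) \<le> sqrt (p ?y) * seminorm h"
      by (rule power2_le_imp_le) (use p0[OF y] seminorm_nonneg[OF h] in simp)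
  qed
  have mult: "p (x \<otimes> y) \<le> p x * p y" if x: "x \<in> carrier A" and y: "y \<in> carrier A" for x y
  proof (rule p_le)
    fix h assume h: "h \<in> carrier A"
    have "seminorm (x \<otimes> y \<otimes> h) \<le> p x * seminorm (y \<otimes> h)" using le_p x y h by (simp add: R.m_assoc)
    also have "\<dots> \<le> p x * (p y * seminorm h)" using le_p[OF y h] p0[OF x] by (rule mult_left_mono)
    finally show "seminorm (x \<otimes> y \<otimes> h) \<le> p x * p y * seminorm h" by simp
  qed (use p0 x y in simp)
  have sq': "(p x)\<^sup>2 \<le> p (adj A x \<otimes> x)" if x: "x \<in> carrier A" for x
    using sq[OF x] p0[OF x] p0[of "adj A x \<otimes> x"] x adj_closed
    by (metis R.m_closed power_mono real_sqrt_pow2)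
  \<comment> \<open>The square of \<open>p x\<close> is at most \<open>p (adj A x)\<close> times
    \<open>p x\<close>, and one factor is cancelled; applied to \<open>x\<close> and to its adjoint
    this makes \<open>adj\<close> isometric.\<close>
  have adj_le: "p x \<le> p (adj A x)" if x: "x \<in> carrier A" for x
  proof (cases "p x = 0")
    case False
    hence pos: "0 < p x" using p0[OF x] by simp
    have "p x * p x \<le> p (adj A x) * p x"
      using order_trans[OF sq'[OF x] mult[OF adj_closed[OF x] x]] unfolding power2_eq_square .
    thus ?thesis using pos by (rule mult_right_le_imp_le)
  next
    case True
    thus ?thesis using p0[OF adj_closed[OF x]] by simp
  qed
  have scale_le: "p (c \<odot> x) \<le> cmod c * p x" if x: "x \<in> carrier A" for c x
    by (rule p_le) (use x p0 le_p in \<open>auto simp: smult_mult_left seminorm_scale mult.assoc intro!: mult_left_mono\<close>)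
  have "cstar_seminorm A p"
    unfolding cstar_seminorm_def
  proof (intro conjI ballI allI)
    fix x assume x: "x \<in> carrier A"
    show "0 \<le> p x" by (rule p0[OF x])
    show "p (c \<odot> x) = cmod c * p x" for c
    proof (cases "c = 0")
      case True
      thus ?thesis using scale_le[OF x, of 0] p0[of "0 \<odot> x"] x by simp
    next
      case False
      have "p x = p ((1 / c) \<odot> (c \<odot> x))" using x False by (simp add: scale_scale scale_one)
      also have "\<dots> \<le> cmod (1 / c) * p (c \<odot> x)" using x by (intro scale_le) simp
      finally have "cmod c * p x \<le> p (c \<odot> x)" using False by (simp add: norm_divide field_simps)
      thus ?thesis using scale_le[OF x, of c] by simp
    qed
    show "p (adj A x \<otimes> x) = (p x)\<^sup>2"
    proof (rule antisym)
      have "p (adj A x) = p x" using adj_le[OF x] adj_le[OF adj_closed[OF x]] adj_adj[OF x] by simp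
      thus "p (adj A x \<otimes> x) \<le> (p x)\<^sup>2"
        using mult[OF adj_closed[OF x] x] by (simp add: power2_eq_square)
    qed (rule sq'[OF x])
    fix y assume y: "y \<in> carrier A"
    show "p (x \<otimes> y) \<le> p x * p y" by (rule mult[OF x y])
    show "p (x \<oplus> y) \<le> p x + p y"
    proof (rule p_le)
      fix h assume h: "h \<in> carrier A"
      have "seminorm ((x \<oplus> y) \<otimes> h) \<le> seminorm (x \<otimes> h) + seminorm (y \<otimes> h)"
        using x y h by (simp add: R.l_distr seminorm_add)
      also have "\<dots> \<le> p x * seminorm h + p y * seminorm h" using x y h by (intro add_mono le_p)
      finally show "seminorm ((x \<oplus> y) \<otimes> h) \<le> (p x + p y) * seminorm h" by (simp add: distrib_right)
    qed (use p0 x y in simp)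
  qed
  \<comment> \<open>The functional is the vector functional of the unit,
    \<open>\<omega> x = form \<one> x\<close>, and the squared length of the unit is
    \<open>\<omega> \<one>\<close>.\<close>
  moreover have "cmod (\<omega> x) \<le> Re (\<omega> \<one>) * p x" if x: "x \<in> carrier A" for x
  proof -
    have "cmod (\<omega> x) = cmod (form \<one> x)" using x by (simp add: form_def adj_one)
    also have "\<dots> \<le> seminorm \<one> * seminorm x" using x by (intro form_cauchy_schwarz) simp_all
    also have "\<dots> \<le> seminorm \<one> * (p x * seminorm \<one>)"
      using le_p[OF x R.one_closed] x by (intro mult_left_mono) (simp_all add: seminorm_nonneg)
    also have "\<dots> = (seminorm \<one>)\<^sup>2 * p x" by (simp add: power2_eq_square)
    also have "(seminorm \<one>)\<^sup>2 = Re (\<omega> \<one>)" by (simp add: seminorm_sq form_def adj_one)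
    finally show ?thesis .
  qed
  ultimately show thesis by (rule that)
qed

end

section \<open>Linear extension from the group to the group algebra\<close>

context group_algebra
begin

definition lin_ext :: "('a \<Rightarrow> complex) \<Rightarrow> ('a \<Rightarrow> complex) \<Rightarrow> complex" where
  "lin_ext \<psi> f = (\<Sum>x\<in>supp f. f x * \<psi> x)"

lemma lin_ext_eq:
  assumes "finite W" "supp f \<subseteq> W"
  shows "lin_ext \<psi> f = (\<Sum>x\<in>W. f x * \<psi> x)"
  unfolding lin_ext_def using assms by (intro sum.mono_neutral_left) auto

lemma lin_ext_add:
  assumes "f \<in> carrier CG" "h \<in> carrier CG"
  shows "lin_ext \<psi> (f \<oplus>\<^bsub>CG\<^esub> h) = lin_ext \<psi> f + lin_ext \<psi> h"
proof -
  have W: "finite (supp f \<union> supp h)" using assms by (simp add: CG_simps(1))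
  have "lin_ext \<psi> (f \<oplus>\<^bsub>CG\<^esub> h) = (\<Sum>x\<in>supp f \<union> supp h. (f x + h x) * \<psi> x)"
    unfolding CG_simps(4) by (intro lin_ext_eq[OF W] supp_add)
  also have "\<dots> = lin_ext \<psi> f + lin_ext \<psi> h"
    using lin_ext_eq[OF W, of f] lin_ext_eq[OF W, of h] by (simp add: distrib_right sum.distrib)
  finally show ?thesis .
qed

lemma lin_ext_scale:
  assumes "f \<in> carrier CG"
  shows "lin_ext \<psi> (c \<odot>\<^bsub>CG\<^esub> f) = c * lin_ext \<psi> f"
proof -
  have "lin_ext \<psi> (c \<odot>\<^bsub>CG\<^esub> f) = (\<Sum>x\<in>supp f. c * f x * \<psi> x)"
    unfolding CG_simps(5) using assms by (intro lin_ext_eq) (auto simp: CG_simps(1))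
  thus ?thesis by (simp add: lin_ext_def sum_distrib_left mult.assoc)
qed

lemma lin_ext_dl: "lin_ext \<psi> (dl g) = \<psi> g"
  unfolding lin_ext_def dl_supp by (simp add: dl_def)

lemma lin_ext_mult:
  assumes "f \<in> carrier CG" "h \<in> carrier CG"
  shows "lin_ext \<psi> (mu f h) = (\<Sum>y\<in>supp f. \<Sum>z\<in>supp h. f y * h z * \<psi> (y \<otimes> z))"
proof -
  define W where "W = (\<lambda>(y, z). y \<otimes> z) ` (supp f \<times> supp h)"
  have fin: "finite (supp f)" "finite (supp h)" using assms by (simp_all add: CG_simps(1))
  have W: "finite W" using fin by (simp add: W_def)
  have "lin_ext \<psi> (mu f h) = (\<Sum>x\<in>W. mu f h x * \<psi> x)"
    using mu_supp[OF assms] by (intro lin_ext_eq W) (simp add: W_def)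
  also have "\<dots> = (\<Sum>x\<in>W. \<Sum>y\<in>supp f. \<Sum>z\<in>supp h. if y \<otimes> z = x then f y * h z * \<psi> x else 0)"
    by (subst mu_eq[OF fin order_refl order_refl])
       (auto simp: sum_distrib_right intro!: sum.cong)
  also have "\<dots> = (\<Sum>y\<in>supp f. \<Sum>x\<in>W. \<Sum>z\<in>supp h. if y \<otimes> z = x then f y * h z * \<psi> x else 0)"
    by (rule sum.swap)
  also have "\<dots> = (\<Sum>y\<in>supp f. \<Sum>z\<in>supp h. \<Sum>x\<in>W. if y \<otimes> z = x then f y * h z * \<psi> x else 0)"
    by (intro sum.cong[OF refl] sum.swap)
  also have "\<dots> = (\<Sum>y\<in>supp f. \<Sum>z\<in>supp h. f y * h z * \<psi> (y \<otimes> z))"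
    by (intro sum.cong[OF refl], subst sum.delta'[OF W]) (auto simp: W_def)
  finally show ?thesis .
qed

lemma lin_ext_adj_mult:
  assumes f: "f \<in> carrier CG" and h: "h \<in> carrier CG"
    and F: "finite F" "supp f \<subseteq> F" "supp h \<subseteq> F"
  shows "lin_ext \<psi> (mu (adj CG f) h) = (\<Sum>y\<in>F. \<Sum>z\<in>F. cnj (f y) * h z * \<psi> (inv y \<otimes> z))"
proof -
  have c: "supp f \<subseteq> carrier G" using f by (simp add: CG_simps(1))
  have inj: "inj_on (m_inv G) (supp f)" using inj_on_subset[OF inv_inj c] .
  have "lin_ext \<psi> (mu (adj CG f) h)
      = (\<Sum>y\<in>m_inv G ` supp f. \<Sum>z\<in>supp h. adj CG f y * h z * \<psi> (y \<otimes> z))"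
    unfolding lin_ext_mult[OF adj_closed[OF f] h] adj_supp[OF f] by (rule refl)
  also have "\<dots> = (\<Sum>y\<in>supp f. \<Sum>z\<in>supp h. cnj (f y) * h z * \<psi> (inv y \<otimes> z))"
    unfolding sum.reindex[OF inj] o_def using c by (intro sum.cong refl) (auto simp: CG_simps(6))
  also have "\<dots> = (\<Sum>y\<in>supp f. \<Sum>z\<in>F. cnj (f y) * h z * \<psi> (inv y \<otimes> z))"
    using F by (intro sum.cong[OF refl] sum.mono_neutral_left) auto
  also have "\<dots> = (\<Sum>y\<in>F. \<Sum>z\<in>F. cnj (f y) * h z * \<psi> (inv y \<otimes> z))"
    using F by (intro sum.mono_neutral_left) auto
  finally show ?thesis .
qed

text \<open>Expanding every \<open>h j\<close> over the common finite support \<open>F\<close>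
  exhibits the kernel as a congruence of the kernel of \<phi> on F \<times> I, by the coefficient
  matrix of the family \<open>h\<close> tensored with the identity on \<open>I\<close>.\<close>

lemma psd_lin_ext:
  fixes I :: "'i set"
  assumes pd: "pd G I \<phi>" and I: "finite I" and J: "finite J"
    and h: "\<And>j. j \<in> J \<Longrightarrow> h j \<in> carrier CG"
  shows "psd (J \<times> I) (\<lambda>(j, a) (k, b). lin_ext (\<lambda>g. \<phi> g a b) (mu (adj CG (h j)) (h k)))"
proof -
  define F where "F = (\<Union>j\<in>J. supp (h j))"
  have F: "finite F" "F \<subseteq> carrier G" using h J by (auto simp: F_def CG_simps(1))
  define K where "K = (\<lambda>(g, a) (h, b). \<phi> (inv g \<otimes> h) a b)"
  define M where "M = (\<lambda>(g, a :: 'i) (j, b). if a = b then h j g else 0)"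
  define L where "L = (\<lambda>(j, a) (k, b). lin_ext (\<lambda>g. \<phi> g a b) (mu (adj CG (h j)) (h k)))"
  have "psd (F \<times> I) K" using pd F unfolding pd_def K_def by blast
  hence *: "psd (J \<times> I) (\<lambda>q q'. \<Sum>p\<in>F \<times> I. \<Sum>p'\<in>F \<times> I. cnj (M p q) * K p p' * M p' q')"
    by (rule psd_congruence)
  have "(\<Sum>p\<in>F \<times> I. \<Sum>p'\<in>F \<times> I. cnj (M p q) * K p p' * M p' q') = L q q'"
    if qq: "q \<in> J \<times> I" "q' \<in> J \<times> I" for q q'
  proof -
    obtain j a k b where q: "q = (j, a)" "q' = (k, b)" and jk: "j \<in> J" "k \<in> J" and ab: "a \<in> I" "b \<in> I"
      using qq by auto
    have "lin_ext (\<lambda>g. \<phi> g a b) (mu (adj CG (h j)) (h k))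
       = (\<Sum>y\<in>F. \<Sum>z\<in>F. cnj (h j y) * h k z * \<phi> (inv y \<otimes> z) a b)"
      using jk h by (intro lin_ext_adj_mult F) (auto simp: F_def)
    also have "\<dots> = (\<Sum>y\<in>F. \<Sum>c\<in>I. \<Sum>z\<in>F. \<Sum>d\<in>I.
        cnj (if c = a then h j y else 0) * \<phi> (inv y \<otimes> z) c d * (if d = b then h k z else 0))"
    proof (intro sum.cong refl)
      fix y
      have "(\<Sum>c\<in>I. \<Sum>z\<in>F. \<Sum>d\<in>I.
          cnj (if c = a then h j y else 0) * \<phi> (inv y \<otimes> z) c d * (if d = b then h k z else 0))
        = (\<Sum>c\<in>I. if c = a then (\<Sum>z\<in>F. cnj (h j y) * \<phi> (inv y \<otimes> z) a b * h k z) else 0)"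
      proof (intro sum.cong refl)
        fix c
        show "(\<Sum>z\<in>F. \<Sum>d\<in>I.
            cnj (if c = a then h j y else 0) * \<phi> (inv y \<otimes> z) c d * (if d = b then h k z else 0))
          = (if c = a then (\<Sum>z\<in>F. cnj (h j y) * \<phi> (inv y \<otimes> z) a b * h k z) else 0)"
          using ab I by (cases "c = a") (simp_all add: if_distrib[of "\<lambda>x. _ * x"] cong: if_cong)
      qed
      thus "(\<Sum>z\<in>F. cnj (h j y) * h k z * \<phi> (inv y \<otimes> z) a b) = (\<Sum>c\<in>I. \<Sum>z\<in>F. \<Sum>d\<in>I.
          cnj (if c = a then h j y else 0) * \<phi> (inv y \<otimes> z) c d * (if d = b then h k z else 0))"
        using ab I by (simp add: mult_ac)
    qed
    finally show ?thesis by (simp add: q K_def M_def L_def sum.cartesian_product')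
  qed
  from psd_cong[THEN iffD1, OF this *] have "psd (J \<times> I) L" .
  thus ?thesis unfolding L_def .
qed

lemma CG_induct [consumes 1, case_names zero add]:
  assumes f: "f \<in> carrier CG"
    and 0: "Q \<zero>\<^bsub>CG\<^esub>"
    and add: "\<And>c g h. g \<in> carrier G \<Longrightarrow> h \<in> carrier CG \<Longrightarrow> Q h \<Longrightarrow> Q ((c \<odot>\<^bsub>CG\<^esub> dl g) \<oplus>\<^bsub>CG\<^esub> h)"
  shows "Q f"
proof -
  have *: "Q (\<lambda>x. if x \<in> S then f x else 0)" if "finite S" "S \<subseteq> carrier G" for S
    using that
  proof (induction S)
    case empty
    show ?case using 0 by (simp add: CG_simps(3))
  next
    case (insert g S)
    have "(\<lambda>x. if x \<in> S then f x else 0) \<in> carrier CG"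
      using insert f by (auto simp: CG_simps(1))
    from add[OF _ this, of g "f g"] have "Q ((f g \<odot>\<^bsub>CG\<^esub> dl g) \<oplus>\<^bsub>CG\<^esub> (\<lambda>x. if x \<in> S then f x else 0))"
      using insert by simp
    also have "(f g \<odot>\<^bsub>CG\<^esub> dl g) \<oplus>\<^bsub>CG\<^esub> (\<lambda>x. if x \<in> S then f x else 0) = (\<lambda>x. if x \<in> insert g S then f x else 0)"
      using insert.hyps by (auto simp: CG_simps dl_def)
    finally show ?case .
  qed
  have e: "(\<lambda>x. if x \<in> supp f then f x else 0) = f" by auto
  have "Q (\<lambda>x. if x \<in> supp f then f x else 0)"
    by (rule *) (use f in \<open>simp_all add: CG_simps(1)\<close>)
  thus ?thesis by (simp only: e)
qed

lemma adj_dl_mult: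
  assumes "g \<in> carrier G" "h \<in> carrier G"
  shows "mu (adj CG (dl g)) (dl h) = dl (inv g \<otimes> h)"
proof -
  have a: "adj CG (dl g) = dl (inv g)"
    using assms by (auto simp: CG_simps dl_def fun_eq_iff)
  show ?thesis unfolding a
    using mu_eq[of "{inv g}" "{h}" "dl (inv g)" "dl h"] by (auto simp: dl_supp dl_def fun_eq_iff)
qed

text \<open>Group elements act isometrically for the seminorm of \<omega>, since \<open>dl g\<close>
  is unitary. Hence every finite combination acts boundedly, the GNS seminorm exists, and it is one
  of the seminorms whose supremum is \<open>full_norm\<close>.\<close>

theorem positive_functional_le_full_norm:
  assumes \<omega>: "positive_functional CG \<omega>" and f: "f \<in> carrier CG"
  shows "cmod (\<omega> f) \<le> Re (\<omega> (dl \<one>)) * full_norm G f"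
proof -
  interpret \<omega>: positive_functional CG \<omega> by (rule \<omega>)
  have u: "\<omega>.seminorm (mu (dl g) h) = \<omega>.seminorm h" if g: "g \<in> carrier G" and h: "h \<in> carrier CG" for g h
  proof -
    have "adj CG (mu (dl g) h) \<otimes>\<^bsub>CG\<^esub> mu (dl g) h = mu (adj CG h) (mu (mu (adj CG (dl g)) (dl g)) h)"
      using g h by (simp add: adj_mu dl_closed adj_closed mu_assoc mu_closed)
    also have "mu (adj CG (dl g)) (dl g) = one CG" using g by (simp add: adj_dl_mult one_dl)
    finally show ?thesis using h by (simp add: \<omega>.seminorm_def \<omega>.form_def mu_one)
  qed
  have "\<exists>C\<ge>0. \<forall>h\<in>carrier CG. \<omega>.seminorm (x \<otimes>\<^bsub>CG\<^esub> h) \<le> C * \<omega>.seminorm h" if "x \<in> carrier CG" for x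
    using that
  proof (induction x rule: CG_induct)
    case zero
    have "\<omega>.seminorm (\<zero>\<^bsub>CG\<^esub>) = 0" using \<omega>.seminorm_scale[of "\<zero>\<^bsub>CG\<^esub>" 0] by (simp add: CG_simps)
    thus ?case by (intro exI[of _ 0]) simp
  next
    case (add c g x)
    then obtain C where C: "C \<ge> 0" "\<And>h. h \<in> carrier CG \<Longrightarrow> \<omega>.seminorm (x \<otimes>\<^bsub>CG\<^esub> h) \<le> C * \<omega>.seminorm h"
      by blast
    have "\<omega>.seminorm ((c \<odot>\<^bsub>CG\<^esub> dl g \<oplus>\<^bsub>CG\<^esub> x) \<otimes>\<^bsub>CG\<^esub> h) \<le> (cmod c + C) * \<omega>.seminorm h"
      if h: "h \<in> carrier CG" for h
    proof -
      have g: "dl g \<in> carrier CG" using add by (simp add: dl_closed)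
      have *: "(c \<odot>\<^bsub>CG\<^esub> dl g \<oplus>\<^bsub>CG\<^esub> x) \<otimes>\<^bsub>CG\<^esub> h = (c \<odot>\<^bsub>CG\<^esub> (mu (dl g) h)) \<oplus>\<^bsub>CG\<^esub> (x \<otimes>\<^bsub>CG\<^esub> h)"
        using add g h by (simp add: \<omega>.R.l_distr \<omega>.smult_mult_left)
      have "\<omega>.seminorm ((c \<odot>\<^bsub>CG\<^esub> dl g \<oplus>\<^bsub>CG\<^esub> x) \<otimes>\<^bsub>CG\<^esub> h) \<le> \<omega>.seminorm (c \<odot>\<^bsub>CG\<^esub> (mu (dl g) h)) + \<omega>.seminorm (x \<otimes>\<^bsub>CG\<^esub> h)"
        unfolding * using add g h by (intro \<omega>.seminorm_add) simp_all
      also have "\<dots> \<le> cmod c * \<omega>.seminorm h + C * \<omega>.seminorm h"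
        using add g h C by (simp add: \<omega>.seminorm_scale u)
      finally show ?thesis by (simp add: distrib_right)
    qed
    thus ?case using C(1) by (intro exI[of _ "cmod c + C"]) simp
  qed
  then obtain p where p: "cstar_seminorm CG p" "\<And>x. x \<in> carrier CG \<Longrightarrow> cmod (\<omega> x) \<le> Re (\<omega> (one CG)) * p x"
    using \<omega>.bounded_positive_functional by metis
  have "0 \<le> Re (\<omega> (one CG))"
    using \<omega>.func_pos[of "one CG"] by (simp add: \<omega>.adj_one complex_nonneg_Reals_iff)
  hence "Re (\<omega> (one CG)) * p f \<le> Re (\<omega> (one CG)) * full_norm G f"
    using le_full[of p f] p(1) f by (intro mult_left_mono) simp_all
  thus ?thesis using p(2)[OF f] by (simp add: one_dl)
qed

end

section \<open>Matrix-valued positive definite functions are contractive\<close>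

lemma of_real_sum_norm_sq: "of_real (\<Sum>a\<in>I. (cmod (\<xi> a))\<^sup>2) = (\<Sum>a\<in>I. cnj (\<xi> a) * \<xi> a)"
  by (simp only: of_real_sum complex_norm_square mult.commute[of "cnj _"])

locale pd_function = group_algebra G for G :: "('g, 'm) monoid_scheme" (structure) +
  fixes I :: "'i set" and \<phi> :: "'g \<Rightarrow> 'i \<Rightarrow> 'i \<Rightarrow> complex"
  assumes finite_index: "finite I" and pd: "pd G I \<phi>"
    and phi_one: "\<lbrakk>a \<in> I; b \<in> I\<rbrakk> \<Longrightarrow> \<phi> \<one> a b = (if a = b then 1 else 0)"
begin

definition coef :: "'i \<Rightarrow> 'i \<Rightarrow> ('g \<Rightarrow> complex) \<Rightarrow> complex" where
  "coef a b = lin_ext (\<lambda>g. \<phi> g a b)"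

lemma coef_add: "\<lbrakk>f \<in> carrier CG; h \<in> carrier CG\<rbrakk> \<Longrightarrow> coef a b (f \<oplus>\<^bsub>CG\<^esub> h) = coef a b f + coef a b h"
  by (simp add: coef_def lin_ext_add)

lemma coef_scale: "f \<in> carrier CG \<Longrightarrow> coef a b (c \<odot>\<^bsub>CG\<^esub> f) = c * coef a b f"
  by (simp add: coef_def lin_ext_scale)

lemma coef_dl: "coef a b (dl g) = \<phi> g a b"
  by (simp add: coef_def lin_ext_dl)

lemma psd_coef:
  assumes "finite J" "\<And>j. j \<in> J \<Longrightarrow> h j \<in> carrier CG"
  shows "psd (J \<times> I) (\<lambda>(j, a) (k, b). coef a b (mu (adj CG (h j)) (h k)))"
  unfolding coef_def using psd_lin_ext[OF pd finite_index assms] .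

text \<open>The two-by-two block matrix of the family \<open>dl \<one>\<close>, \<open>x\<close>,
  indexed by \<open>False\<close> and \<open>True\<close>. Its hermitian symmetry gives
  compatibility with adjoints, its positivity the Kadison-Schwarz inequality.\<close>

lemma psd_coef_one:
  assumes "x \<in> carrier CG"
  shows "psd (UNIV \<times> I) (\<lambda>(j, a) (k, b). coef a b (mu (adj CG (if j then x else dl \<one>)) (if k then x else dl \<one>)))"
  using psd_coef[of "UNIV :: bool set" "\<lambda>j. if j then x else dl \<one>"] assms by (auto simp: dl_closed)

lemma adj_dl_one: "adj CG (dl \<one>) = dl \<one>"
  by (auto simp: CG_simps dl_def fun_eq_iff inv_equality)

lemma coef_adj:
  assumes x: "x \<in> carrier CG" and ab: "a \<in> I" "b \<in> I"
  shows "coef b a (adj CG x) = cnj (coef a b x)"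
proof -
  have f: "finite ((UNIV :: bool set) \<times> I)" using finite_index by simp
  have "coef b a (mu (adj CG x) (dl \<one>)) = cnj (coef a b (mu (adj CG (dl \<one>)) x))"
    using psd_hermitian[OF f psd_coef_one[OF x], of "(False, a)" "(True, b)"] ab by simp
  thus ?thesis using x mu_one[OF x] mu_one[OF adj_closed[OF x]] by (simp add: adj_dl_one one_dl)
qed

text \<open>The vector functional of \<xi>. The bound by the universal norm is available for scalar
  positive functionals only, and reaches the matrix-valued map through these.\<close>

definition qf :: "('i \<Rightarrow> complex) \<Rightarrow> ('g \<Rightarrow> complex) \<Rightarrow> complex" where
  "qf \<xi> f = (\<Sum>a\<in>I. \<Sum>b\<in>I. cnj (\<xi> a) * coef a b f * \<xi> b)"

lemma qf_positive: "positive_functional CG (qf \<xi>)"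
proof (rule positive_functional.intro[OF CG_star], unfold_locales)
  fix f assume f: "f \<in> carrier CG"
  show "qf \<xi> (c \<odot>\<^bsub>CG\<^esub> f) = c * qf \<xi> f" for c
    using f by (simp add: qf_def coef_scale sum_distrib_left mult_ac)
  show "qf \<xi> (f \<oplus>\<^bsub>CG\<^esub> h) = qf \<xi> f + qf \<xi> h" if "h \<in> carrier CG" for h
    using f that by (simp add: qf_def coef_add distrib_left distrib_right sum.distrib)
  show "qf \<xi> (adj CG f \<otimes>\<^bsub>CG\<^esub> f) \<in> \<real>\<^sub>\<ge>\<^sub>0"
    using psdD[OF psd_coef[of "{()}" "\<lambda>_. f"], of "\<lambda>(_, a). \<xi> a"] f
    by (simp add: sum.cartesian_product' qf_def)
qed

lemma qf_dl_one: "qf \<xi> (dl \<one>) = of_real (\<Sum>a\<in>I. (cmod (\<xi> a))\<^sup>2)"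
proof -
  have "qf \<xi> (dl \<one>) = (\<Sum>a\<in>I. \<Sum>b\<in>I. if a = b then cnj (\<xi> a) * \<xi> b else 0)"
    unfolding qf_def by (intro sum.cong refl) (simp add: coef_dl phi_one)
  also have "\<dots> = (\<Sum>a\<in>I. cnj (\<xi> a) * \<xi> a)"
    using finite_index by simp
  finally show ?thesis by (simp only: of_real_sum_norm_sq)
qed

lemma qf_bound:
  assumes "f \<in> carrier CG"
  shows "cmod (qf \<xi> f) \<le> (\<Sum>a\<in>I. (cmod (\<xi> a))\<^sup>2) * full_norm G f"
  using positive_functional_le_full_norm[OF qf_positive[of \<xi>] assms] by (simp only: qf_dl_one Re_complex_of_real)

text \<open>Kadison--Schwarz: test the \<open>2 \<times> 2\<close> block matrix with diagonal blocks \<open>1\<close>, \<open>\<phi>(x\<^sup>* x)\<close> and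
  off-diagonal block \<open>\<phi>(x)\<close> against the vector \<open>(- \<phi>(x) \<xi>, \<xi>)\<close>.\<close>

lemma coef_contraction:
  assumes x: "x \<in> carrier CG"
  shows "(\<Sum>a\<in>I. (cmod (\<Sum>b\<in>I. coef a b x * \<xi> b))\<^sup>2) \<le> (full_norm G x)\<^sup>2 * (\<Sum>b\<in>I. (cmod (\<xi> b))\<^sup>2)"
proof -
  define \<eta> where "\<eta> a = (\<Sum>b\<in>I. coef a b x * \<xi> b)" for a
  define s where "s = (\<Sum>a\<in>I. (cmod (\<eta> a))\<^sup>2)"
  have s: "of_real s = (\<Sum>a\<in>I. cnj (\<eta> a) * \<eta> a)"
    unfolding s_def by (rule of_real_sum_norm_sq)
  have xx: "mu (adj CG x) x \<in> carrier CG" using x by (simp add: mu_closed adj_closed)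
  let ?v = "\<lambda>(j, a). if j then \<xi> a else - \<eta> a"
  let ?K = "\<lambda>(j, a) (k, b). coef a b (mu (adj CG (if j then x else dl \<one>)) (if k then x else dl \<one>))"
  have "(\<Sum>p\<in>UNIV \<times> I. \<Sum>q\<in>UNIV \<times> I. cnj (?v p) * ?K p q * ?v q)
     = (\<Sum>a\<in>I. \<Sum>b\<in>I. cnj (\<eta> a) * coef a b (dl \<one>) * \<eta> b)
      - (\<Sum>a\<in>I. \<Sum>b\<in>I. cnj (\<eta> a) * coef a b x * \<xi> b)
      - (\<Sum>a\<in>I. \<Sum>b\<in>I. cnj (\<xi> a) * coef a b (adj CG x) * \<eta> b) + qf \<xi> (mu (adj CG x) x)"
    using x mu_one[OF x] mu_one[OF adj_closed[OF x]] mu_one[OF dl_closed[OF one_closed]]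
    by (simp add: sum.cartesian_product' UNIV_bool adj_dl_one[folded one_dl] one_dl[symmetric] qf_def sum.distrib sum_negf sum_subtractf)
  \<comment> \<open>Each of the three sums involving \<eta> equals \<open>s\<close>: the first
    because \<phi>(1) is the identity, the second by the choice of \<eta>, the third by
    compatibility with adjoints. Their signs are +, -, -, so a single -s remains.\<close>
  also have "(\<Sum>a\<in>I. \<Sum>b\<in>I. cnj (\<eta> a) * coef a b (dl \<one>) * \<eta> b) = of_real s"
    using qf_dl_one[of \<eta>] by (simp add: qf_def s_def)
  also have "(\<Sum>a\<in>I. \<Sum>b\<in>I. cnj (\<eta> a) * coef a b x * \<xi> b) = of_real s"
    unfolding s by (simp add: \<eta>_def sum_distrib_left mult.assoc)
  also have "(\<Sum>a\<in>I. \<Sum>b\<in>I. cnj (\<xi> a) * coef a b (adj CG x) * \<eta> b) = (\<Sum>a\<in>I. \<Sum>b\<in>I. cnj (\<xi> a) * cnj (coef b a x) * \<eta> b)"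
    using x by (intro sum.cong refl) (simp add: coef_adj)
  also have "\<dots> = (\<Sum>b\<in>I. (\<Sum>a\<in>I. cnj (coef b a x * \<xi> a)) * \<eta> b)"
    by (subst sum.swap) (simp add: sum_distrib_left sum_distrib_right mult_ac)
  also have "\<dots> = of_real s" unfolding s by (simp add: \<eta>_def)
  finally have "qf \<xi> (mu (adj CG x) x) - of_real s \<in> \<real>\<^sub>\<ge>\<^sub>0"
    using psdD[OF psd_coef_one[OF x], of ?v] by simp
  hence "s \<le> Re (qf \<xi> (mu (adj CG x) x))" by (simp add: complex_nonneg_Reals_iff)
  also have "\<dots> \<le> (\<Sum>a\<in>I. (cmod (\<xi> a))\<^sup>2) * full_norm G (mu (adj CG x) x)"
    using qf_bound[OF xx, of \<xi>] complex_Re_le_cmod order_trans by blast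
  also have "full_norm G (mu (adj CG x) x) = (full_norm G x)\<^sup>2"
    using full_csn x by (simp add: cstar_seminorm_def)
  finally show ?thesis by (simp add: s_def \<eta>_def mult.commute)
qed

text \<open>\<open>coef_contraction\<close> at the basis vector of \<open>b\<close>, keeping only
  row \<open>a\<close> of the result.\<close>

lemma coef_bound:
  assumes x: "x \<in> carrier CG" and ab: "a \<in> I" "b \<in> I"
  shows "cmod (coef a b x) \<le> full_norm G x"
proof -
  have "(cmod (coef a b x))\<^sup>2 \<le> (\<Sum>c\<in>I. (cmod (\<Sum>d\<in>I. coef c d x * (if d = b then 1 else 0)))\<^sup>2)"
    using finite_index ab by (simp add: if_distrib[of "\<lambda>z. _ * z"] member_le_sum[of a I "\<lambda>c. (cmod (coef c b x))\<^sup>2"] cong: if_cong)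
  also have "\<dots> \<le> (full_norm G x)\<^sup>2 * (\<Sum>d\<in>I. (cmod (if d = b then 1 else 0))\<^sup>2)"
    by (rule coef_contraction[OF x])
  also have "(\<Sum>d\<in>I. (cmod (if d = b then 1 else 0))\<^sup>2) = (\<Sum>d\<in>I. if d = b then 1 else 0)"
    by (intro sum.cong) auto
  also have "\<dots> = 1" using finite_index ab by simp
  finally have "(cmod (coef a b x))\<^sup>2 \<le> (full_norm G x)\<^sup>2" by simp
  thus ?thesis by (rule power2_le_imp_le[OF _ full_nn[OF x]])
qed

end

section \<open>Extension to the completion\<close>

lemma psd_sum:
  assumes "\<And>k. k \<in> R \<Longrightarrow> psd S (K k)"
  shows "psd S (\<lambda>p q. \<Sum>k\<in>R. K k p q)"
proof (rule psdI)
  fix x :: "'b \<Rightarrow> complex"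
  have "(\<Sum>p\<in>S. \<Sum>q\<in>S. cnj (x p) * (\<Sum>k\<in>R. K k p q) * x q)
     = (\<Sum>p\<in>S. \<Sum>k\<in>R. \<Sum>q\<in>S. cnj (x p) * K k p q * x q)"
    by (simp only: sum_distrib_left sum_distrib_right) (intro sum.cong[OF refl] sum.swap)
  also have "\<dots> = (\<Sum>k\<in>R. \<Sum>p\<in>S. \<Sum>q\<in>S. cnj (x p) * K k p q * x q)" by (rule sum.swap)
  also have "\<dots> \<in> \<real>\<^sub>\<ge>\<^sub>0" by (intro sum_nonneg_Reals psdD assms)
  finally show "(\<Sum>p\<in>S. \<Sum>q\<in>S. cnj (x p) * (\<Sum>k\<in>R. K k p q) * x q) \<in> \<real>\<^sub>\<ge>\<^sub>0" .
qed

lemma normed_group_alg_simps [simp]: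
  "carrier (normed_group_alg G) = carrier (group_alg G)" "mult (normed_group_alg G) = mult (group_alg G)"
  "one (normed_group_alg G) = one (group_alg G)" "zero (normed_group_alg G) = zero (group_alg G)"
  "add (normed_group_alg G) = add (group_alg G)" "smult (normed_group_alg G) = smult (group_alg G)"
  "adj (normed_group_alg G) = adj (group_alg G)" "nrm (normed_group_alg G) = full_norm G"
  by (simp_all add: normed_group_alg_def star_alg.defs)

sublocale group_algebra \<subseteq> S: seminormed_star_algebra "normed_group_alg G"
proof (intro seminormed_star_algebra.intro seminormed_star_algebra_axioms.intro)
  show "unital_star_algebra (normed_group_alg G)" by (rule star_cong[OF CG_star]) simp_all
  show "cstar_seminorm (normed_group_alg G) (nrm (normed_group_alg G))"
    using full_csn by (simp add: cstar_seminorm_def)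
qed

text \<open>Meaningful only if all representatives in \<open>S\<close> have the same limit, as for bounded functionals.\<close>

definition lim_ext :: "('f \<Rightarrow> complex) \<Rightarrow> (nat \<Rightarrow> 'f) set \<Rightarrow> complex" where
  "lim_ext l S = (THE z. \<forall>X\<in>S. (\<lambda>n. l (X n)) \<longlonglongrightarrow> z)"

context group_algebra
begin

abbreviation "AG \<equiv> group_cstar G"
abbreviation "CS \<equiv> cauchy_seqs (normed_group_alg G)"

sublocale A: unital_cstar_algebra "group_cstar G"
  by (rule group_cstar_is_cstar)

sublocale A: seminormed_star_algebra "group_cstar G"
  by (intro seminormed_star_algebra.intro A.unital_star_algebra_axioms
      seminormed_star_algebra_axioms.intro A.cstar_seminorm_nrm)

lemmas AG_simps = S.comp_one[folded group_cstar_def] S.comp_add[folded group_cstar_def]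
  S.comp_mult[folded group_cstar_def] S.comp_smult[folded group_cstar_def] S.comp_adj[folded group_cstar_def]
lemmas AG_cases = S.comp_cases[folded group_cstar_def]
lemmas AG_mem = S.comp_mem[folded group_cstar_def]
lemmas AG_nrm = S.comp_nrm[folded group_cstar_def, simplified]
lemmas AG_dense = S.dense[folded group_cstar_def, simplified]

definition bounded_functional :: "(('a \<Rightarrow> complex) \<Rightarrow> complex) \<Rightarrow> bool" where
  "bounded_functional l \<longleftrightarrow> (\<forall>f\<in>carrier CG. \<forall>h\<in>carrier CG. l (f \<oplus>\<^bsub>CG\<^esub> h) = l f + l h) \<and>
     (\<forall>c. \<forall>f\<in>carrier CG. l (c \<odot>\<^bsub>CG\<^esub> f) = c * l f) \<and>
     (\<exists>C>0. \<forall>f\<in>carrier CG. cmod (l f) \<le> C * full_norm G f)"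

lemma bounded_functional_diff:
  assumes l: "bounded_functional l" and f: "f \<in> carrier CG" and h: "h \<in> carrier CG"
  shows "l (f \<ominus>\<^bsub>normed_group_alg G\<^esub> h) = l f - l h"
proof -
  have "f \<ominus>\<^bsub>normed_group_alg G\<^esub> h = f \<oplus>\<^bsub>CG\<^esub> ((-1) \<odot>\<^bsub>CG\<^esub> h)"
    using S.sm_m1[of h] h by (simp add: S.R.minus_eq)
  moreover have "(-1) \<odot>\<^bsub>CG\<^esub> h \<in> carrier CG" using S.sm_closed[of h "-1"] h by simp
  ultimately show ?thesis using l f h unfolding bounded_functional_def by simp
qed

lemma bounded_functional_Cauchy:
  assumes l: "bounded_functional l" and X: "X \<in> CS"
  shows "convergent (\<lambda>n. l (X n))"
proof -
  obtain C where C: "C > 0" "\<And>f. f \<in> carrier CG \<Longrightarrow> cmod (l f) \<le> C * full_norm G f"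
    using l unfolding bounded_functional_def by blast
  have c: "X n \<in> carrier CG" for n using S.csD[OF X] by simp
  have "Cauchy (\<lambda>n. l (X n))"
  proof (rule metric_CauchyI)
    fix e :: real assume e: "e > 0"
    have "e / C > 0" using e C by simp
    then obtain N where N: "\<And>m n. m \<ge> N \<Longrightarrow> n \<ge> N \<Longrightarrow> full_norm G (X m \<ominus>\<^bsub>normed_group_alg G\<^esub> X n) < e / C"
      using S.csE[OF X] unfolding normed_group_alg_simps by blast
    have "dist (l (X m)) (l (X n)) < e" if mn: "m \<ge> N" "n \<ge> N" for m n
    proof -
      have "dist (l (X m)) (l (X n)) = cmod (l (X m \<ominus>\<^bsub>normed_group_alg G\<^esub> X n))"
        by (simp add: dist_norm bounded_functional_diff[OF l c c])
      also have "\<dots> \<le> C * full_norm G (X m \<ominus>\<^bsub>normed_group_alg G\<^esub> X n)"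
        using S.R.minus_closed[of "X m" "X n"] c by (intro C(2)) simp
      also have "\<dots> < C * (e / C)" using N[OF mn] C(1) by (rule mult_strict_left_mono)
      finally show ?thesis using C(1) by simp
    qed
    thus "\<exists>M. \<forall>m\<ge>M. \<forall>n\<ge>M. dist (l (X m)) (l (X n)) < e" by blast
  qed
  thus ?thesis by (simp add: Cauchy_convergent)
qed

text \<open>Two representatives of a class differ by a null sequence, on which a bounded functional
  tends to 0. All representatives thus share one limit, and the definite description in
  \<open>lim_ext\<close> denotes it.\<close>

lemma lim_ext_tendsto:
  assumes l: "bounded_functional l" and X: "X \<in> CS"
  shows "(\<lambda>n. l (X n)) \<longlonglongrightarrow> lim_ext l (S.cl X)"
proof -
  obtain C where C: "C > 0" "\<And>f. f \<in> carrier CG \<Longrightarrow> cmod (l f) \<le> C * full_norm G f"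
    using l unfolding bounded_functional_def by blast
  obtain z where z: "(\<lambda>n. l (X n)) \<longlonglongrightarrow> z"
    using bounded_functional_Cauchy[OF l X] by (auto simp: convergent_def)
  have "(\<lambda>n. l (Y n)) \<longlonglongrightarrow> z" if Y: "Y \<in> S.cl X" for Y
  proof -
    have Yc: "Y \<in> CS" and d: "(\<lambda>n. full_norm G (Y n \<ominus>\<^bsub>normed_group_alg G\<^esub> X n)) \<longlonglongrightarrow> 0"
      using Y unfolding S.cl_mem[OF X] S.NS_iff by auto
    have c: "X n \<in> carrier CG" "Y n \<in> carrier CG" for n using S.csD[OF X] S.csD[OF Yc] by simp_all
    have d': "(\<lambda>n. C * full_norm G (Y n \<ominus>\<^bsub>normed_group_alg G\<^esub> X n)) \<longlonglongrightarrow> 0"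
      using tendsto_mult[OF tendsto_const d, of C] by simp
    have "(\<lambda>n. l (Y n) - l (X n)) \<longlonglongrightarrow> 0"
    proof (rule Lim_null_comparison[OF always_eventually d'], rule allI)
      fix n
      show "cmod (l (Y n) - l (X n)) \<le> C * full_norm G (Y n \<ominus>\<^bsub>normed_group_alg G\<^esub> X n)"
        using C(2)[of "Y n \<ominus>\<^bsub>normed_group_alg G\<^esub> X n"] S.R.minus_closed[of "Y n" "X n"] c
        by (simp add: bounded_functional_diff[OF l])
    qed
    from tendsto_add[OF this z] show ?thesis by simp
  qed
  hence "lim_ext l (S.cl X) = z"
    unfolding lim_ext_def using S.cl_self[OF X] by (intro the_equality) (auto intro: LIMSEQ_unique[OF _ z])
  thus ?thesis using z by simp
qed

lemma lim_ext_eqI: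
  assumes "bounded_functional l" "X \<in> CS" "(\<lambda>n. l (X n)) \<longlonglongrightarrow> z"
  shows "lim_ext l (S.cl X) = z"
  using LIMSEQ_unique[OF lim_ext_tendsto[OF assms(1,2)] assms(3)] .

lemma lim_ext_const:
  assumes "bounded_functional l" "f \<in> carrier CG"
  shows "lim_ext l (S.cl (\<lambda>n. f)) = l f"
  by (rule lim_ext_eqI[OF assms(1)]) (use assms S.cs_const[of f] in auto)

lemma CSD: "X \<in> CS \<Longrightarrow> X n \<in> carrier CG"
  using S.csD[of X n] by simp

lemma CS_closed: "X \<in> CS \<Longrightarrow> Y \<in> CS \<Longrightarrow> (\<lambda>n. X n \<oplus>\<^bsub>CG\<^esub> Y n) \<in> CS"
  "X \<in> CS \<Longrightarrow> Y \<in> CS \<Longrightarrow> (\<lambda>n. X n \<otimes>\<^bsub>CG\<^esub> Y n) \<in> CS"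
  "X \<in> CS \<Longrightarrow> (\<lambda>n. c \<odot>\<^bsub>CG\<^esub> X n) \<in> CS"
  "X \<in> CS \<Longrightarrow> (\<lambda>n. adj CG (X n)) \<in> CS"
  using S.cs_add[of X Y] S.cs_mult[of X Y] S.cs_sm[of X c] S.cs_adj[of X] by simp_all

lemma AG_ops: "X \<in> CS \<Longrightarrow> Y \<in> CS \<Longrightarrow> S.cl X \<oplus>\<^bsub>AG\<^esub> S.cl Y = S.cl (\<lambda>n. X n \<oplus>\<^bsub>CG\<^esub> Y n)"
  "X \<in> CS \<Longrightarrow> Y \<in> CS \<Longrightarrow> S.cl X \<otimes>\<^bsub>AG\<^esub> S.cl Y = S.cl (\<lambda>n. X n \<otimes>\<^bsub>CG\<^esub> Y n)"
  "X \<in> CS \<Longrightarrow> c \<odot>\<^bsub>AG\<^esub> S.cl X = S.cl (\<lambda>n. c \<odot>\<^bsub>CG\<^esub> X n)"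
  "X \<in> CS \<Longrightarrow> adj AG (S.cl X) = S.cl (\<lambda>n. adj CG (X n))"
  "\<one>\<^bsub>AG\<^esub> = S.cl (\<lambda>n. dl \<one>)"
  using AG_simps(2)[of X Y] AG_simps(3)[of X Y] AG_simps(4)[of X c] AG_simps(5)[of X] AG_simps(1) by (simp_all add: one_dl)

lemma lim_ext_add:
  assumes "bounded_functional l" "x \<in> carrier AG" "y \<in> carrier AG"
  shows "lim_ext l (x \<oplus>\<^bsub>AG\<^esub> y) = lim_ext l x + lim_ext l y"
proof -
  obtain X Y where X: "X \<in> CS" "x = S.cl X" and Y: "Y \<in> CS" "y = S.cl Y"
    using assms(2,3) by (metis AG_cases)
  have "(\<lambda>n. l (X n \<oplus>\<^bsub>CG\<^esub> Y n)) \<longlonglongrightarrow> lim_ext l x + lim_ext l y"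
    using tendsto_add[OF lim_ext_tendsto[OF assms(1) X(1)] lim_ext_tendsto[OF assms(1) Y(1)]]
      CSD[OF X(1)] CSD[OF Y(1)] assms(1) X(2) Y(2) unfolding bounded_functional_def by simp
  thus ?thesis unfolding X(2) Y(2) AG_ops(1)[OF X(1) Y(1)]
    by (intro lim_ext_eqI assms CS_closed X Y)
qed

lemma lim_ext_scale:
  assumes "bounded_functional l" "x \<in> carrier AG"
  shows "lim_ext l (c \<odot>\<^bsub>AG\<^esub> x) = c * lim_ext l x"
proof -
  obtain X where X: "X \<in> CS" "x = S.cl X"
    using assms(2) by (metis AG_cases)
  have "(\<lambda>n. l (c \<odot>\<^bsub>CG\<^esub> X n)) \<longlonglongrightarrow> c * lim_ext l x"
    using tendsto_mult[OF tendsto_const lim_ext_tendsto[OF assms(1) X(1)], of c]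
      CSD[OF X(1)] assms(1) X(2) unfolding bounded_functional_def by simp
  thus ?thesis unfolding X(2) AG_ops(3)[OF X(1)]
    by (intro lim_ext_eqI assms CS_closed X)
qed

end

context pd_function
begin

lemma bounded_functional_coef:
  assumes "a \<in> I" "b \<in> I"
  shows "bounded_functional (coef a b)"
  unfolding bounded_functional_def
  using coef_bound[OF _ assms] by (auto simp: coef_add coef_scale intro!: exI[of _ 1])

text \<open>The (a, b) entry of the continuous extension of \<phi> to the full group
  algebra.\<close>

definition E :: "'i \<Rightarrow> 'i \<Rightarrow> (nat \<Rightarrow> 'g \<Rightarrow> complex) set \<Rightarrow> complex" where
  "E a b = lim_ext (coef a b)"

context fixes a b assumes ab: "a \<in> I" "b \<in> I" begin

lemma E_tendsto: "X \<in> CS \<Longrightarrow> (\<lambda>n. coef a b (X n)) \<longlonglongrightarrow> E a b (S.cl X)"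
  unfolding E_def by (rule lim_ext_tendsto[OF bounded_functional_coef[OF ab]])

lemma E_add: "\<lbrakk>x \<in> carrier AG; y \<in> carrier AG\<rbrakk> \<Longrightarrow> E a b (x \<oplus>\<^bsub>AG\<^esub> y) = E a b x + E a b y"
  unfolding E_def by (rule lim_ext_add[OF bounded_functional_coef[OF ab]])

lemma E_scale: "x \<in> carrier AG \<Longrightarrow> E a b (c \<odot>\<^bsub>AG\<^esub> x) = c * E a b x"
  unfolding E_def by (rule lim_ext_scale[OF bounded_functional_coef[OF ab]])

lemma E_const: "f \<in> carrier CG \<Longrightarrow> E a b (S.cl (\<lambda>n. f)) = coef a b f"
  unfolding E_def by (rule lim_ext_const[OF bounded_functional_coef[OF ab]])

lemma E_one: "E a b \<one>\<^bsub>AG\<^esub> = (if a = b then 1 else 0)"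
  using ab by (simp add: AG_ops(5) E_const dl_closed coef_dl phi_one)

lemma E_adj:
  assumes "x \<in> carrier AG"
  shows "E b a (adj AG x) = cnj (E a b x)"
proof -
  obtain X where X: "X \<in> CS" "x = S.cl X" using assms by (metis AG_cases)
  have "(\<lambda>n. coef b a (adj CG (X n))) \<longlonglongrightarrow> cnj (E a b x)"
    using tendsto_cnj[OF E_tendsto[OF X(1)]] CSD[OF X(1)] ab by (simp add: coef_adj X(2))
  thus ?thesis unfolding X(2) AG_ops(4)[OF X(1)] E_def
    by (intro lim_ext_eqI bounded_functional_coef ab CS_closed X)
qed

lemma E_finsum:
  assumes "finite R" "\<And>k. k \<in> R \<Longrightarrow> f k \<in> carrier AG"
  shows "E a b (finsum AG f R) = (\<Sum>k\<in>R. E a b (f k))"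
  using assms
proof (induction R)
  case empty
  have "E a b (0 \<odot>\<^bsub>AG\<^esub> \<one>\<^bsub>AG\<^esub>) = 0" by (subst E_scale) simp_all
  thus ?case by simp
next
  case (insert k R)
  thus ?case by (simp add: A.R.finsum_insert Pi_def E_add)
qed

end

text \<open>Along representing Cauchy sequences the kernel is a pointwise limit of the kernels from
  the dense group algebra, and positive semidefiniteness is a closed condition.\<close>

lemma psd_E:
  assumes J: "finite J" and Y: "\<And>j. j \<in> J \<Longrightarrow> Y j \<in> carrier AG"
  shows "psd (J \<times> I) (\<lambda>(j, a) (k, b). E a b (adj AG (Y j) \<otimes>\<^bsub>AG\<^esub> Y k))"
proof -
  have "\<forall>j\<in>J. \<exists>X. X \<in> CS \<and> Y j = S.cl X" using Y by (metis AG_cases)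
  then obtain X where X: "\<And>j. j \<in> J \<Longrightarrow> X j \<in> CS" "\<And>j. j \<in> J \<Longrightarrow> Y j = S.cl (X j)" by metis
  show ?thesis
  proof (rule psd_tendsto)
    show "finite (J \<times> I)" using J finite_index by simp
    show "psd (J \<times> I) (\<lambda>(j, a) (k, b). coef a b (mu (adj CG (X j n)) (X k n)))" for n
      using J CSD[OF X(1)] by (intro psd_coef)
    fix p q assume "p \<in> J \<times> I" "q \<in> J \<times> I"
    then obtain j a k b where p: "p = (j, a)" "q = (k, b)" "j \<in> J" "a \<in> I" "k \<in> J" "b \<in> I" by auto
    have "(\<lambda>n. coef a b (mu (adj CG (X j n)) (X k n))) \<longlonglongrightarrow> E a b (S.cl (\<lambda>n. mu (adj CG (X j n)) (X k n)))"
      using p X by (intro E_tendsto CS_closed) auto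
    also have "S.cl (\<lambda>n. mu (adj CG (X j n)) (X k n)) = adj AG (Y j) \<otimes>\<^bsub>AG\<^esub> Y k"
      using p X by (simp add: AG_ops(2,4) CS_closed)
    finally show "(\<lambda>n. (case p of (j, a) \<Rightarrow> \<lambda>(k, b). coef a b (mu (adj CG (X j n)) (X k n))) q)
      \<longlonglongrightarrow> (case p of (j, a) \<Rightarrow> \<lambda>(k, b). E a b (adj AG (Y j) \<otimes>\<^bsub>AG\<^esub> Y k)) q"
      by (simp add: p)
  qed
qed

lemma E_contraction:
  assumes x: "x \<in> carrier AG"
  shows "(\<Sum>a\<in>I. (cmod (\<Sum>b\<in>I. E a b x * \<xi> b))\<^sup>2) \<le> (nrm AG x)\<^sup>2 * (\<Sum>b\<in>I. (cmod (\<xi> b))\<^sup>2)"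
proof -
  obtain X where X: "X \<in> CS" "x = S.cl X" using x by (metis AG_cases)
  have 1: "(\<lambda>n. \<Sum>a\<in>I. (cmod (\<Sum>b\<in>I. coef a b (X n) * \<xi> b))\<^sup>2) \<longlonglongrightarrow> (\<Sum>a\<in>I. (cmod (\<Sum>b\<in>I. E a b x * \<xi> b))\<^sup>2)"
    unfolding X(2) by (intro tendsto_intros E_tendsto X(1))
  have 2: "(\<lambda>n. (full_norm G (X n))\<^sup>2 * (\<Sum>b\<in>I. (cmod (\<xi> b))\<^sup>2)) \<longlonglongrightarrow> (nrm AG x)\<^sup>2 * (\<Sum>b\<in>I. (cmod (\<xi> b))\<^sup>2)"
    unfolding X(2) by (intro tendsto_intros AG_nrm X(1))
  show ?thesis by (rule LIMSEQ_le[OF 1 2]) (use coef_contraction CSD[OF X(1)] in blast)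
qed

end

section \<open>Completely positive maps into matrix algebras\<close>

lemma mat_adjoint_carrier [simp]: "X \<in> carrier_mat n n \<Longrightarrow> mat_adjoint X \<in> carrier_mat n (n :: nat)"
  by (auto simp: mat_adjoint_def mat_of_rows_def)

lemma mat_adjoint_entry:
  "X \<in> carrier_mat n n \<Longrightarrow> i < n \<Longrightarrow> j < n \<Longrightarrow> mat_adjoint X $$ (i, j) = cnj (X $$ (j, i) :: complex)"
  by (auto simp: mat_adjoint_def mat_of_rows_index)

lemma mat_mult_entry:
  assumes "X \<in> carrier_mat n n" "Y \<in> carrier_mat n n" "i < n" "j < n"
  shows "(X * Y) $$ (i, j) = (\<Sum>k<n. X $$ (i, k) * (Y $$ (k, j) :: complex))"
  using assms by (auto simp: scalar_prod_def lessThan_atLeast0 intro!: sum.cong)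

lemma complex_mat_alg_simps [simp]:
  "carrier (complex_mat_alg n) = carrier_mat n n" "mult (complex_mat_alg n) = (*)"
  "one (complex_mat_alg n) = 1\<^sub>m n" "zero (complex_mat_alg n) = 0\<^sub>m n n"
  "add (complex_mat_alg n) = (+)" "smult (complex_mat_alg n) = (\<cdot>\<^sub>m)"
  "adj (complex_mat_alg n) = mat_adjoint"
  by (simp_all add: complex_mat_alg_def module.defs module_mat_def)

lemma abelian_monoid_complex_mat: "abelian_monoid (complex_mat_alg n)"
  by (rule abelian_monoidI) (auto intro: assoc_add_mat comm_add_mat)

lemma finsum_complex_mat:
  assumes "finite R" "\<And>k. k \<in> R \<Longrightarrow> f k \<in> carrier_mat n n"
  shows "finsum (complex_mat_alg n) f R \<in> carrier_mat n n \<and>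
    (\<forall>a<n. \<forall>b<n. finsum (complex_mat_alg n) f R $$ (a, b) = (\<Sum>k\<in>R. f k $$ (a, b)))"
proof -
  interpret M: abelian_monoid "complex_mat_alg n" by (rule abelian_monoid_complex_mat)
  show ?thesis using assms
  proof (induction R)
    case empty
    show ?case using M.finsum_empty[of f] by simp
  next
    case (insert k R)
    have "finsum (complex_mat_alg n) f (insert k R) = f k + finsum (complex_mat_alg n) f R"
      using M.finsum_insert[of R k f] insert by (simp add: Pi_def)
    moreover have "f k \<in> carrier_mat n n" using insert by simp
    ultimately show ?case using insert by auto
  qed
qed

section \<open>Entrywise form of positivity, shared by the full group algebra and the complex
  matrices\<close>

context
  fixes A :: "('a, 'm) star_alg_scheme" (structure)
  assumes A: "abelian_monoid A" "\<And>x. x \<in> carrier A \<Longrightarrow> adj A x \<in> carrier A"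
    "\<And>x y. x \<in> carrier A \<Longrightarrow> y \<in> carrier A \<Longrightarrow> x \<otimes> y \<in> carrier A"
begin

lemma matrix_alg_adj_mult:
  assumes W: "W \<in> carrier (matrix_alg m A)" and ij: "i < m" "j < m"
  shows "(adj (matrix_alg m A) W \<otimes>\<^bsub>matrix_alg m A\<^esub> W) $$ (i, j)
    = (\<Oplus>k\<in>{..<m}. adj A (W $$ (k, i)) \<otimes> W $$ (k, j))"
proof -
  interpret abelian_monoid A by (rule A)
  have W: "W \<in> carrier_mat m m" "elements_mat W \<subseteq> carrier A" using W by (auto simp: matrix_alg_def)
  have c: "W $$ (k, i) \<in> carrier A" if "k < m" "i < m" for k i
    using subsetD[OF W(2) elements_matI[OF W(1) that refl]] .
  have "(adj (matrix_alg m A) W \<otimes>\<^bsub>matrix_alg m A\<^esub> W) $$ (i, j)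
    = (\<Oplus>k\<in>{..<m}. mat m m (\<lambda>(i, j). adj A (W $$ (j, i))) $$ (i, k) \<otimes> W $$ (k, j))"
    using ij by (simp add: matrix_alg_def)
  also have "\<dots> = (\<Oplus>k\<in>{..<m}. adj A (W $$ (k, i)) \<otimes> W $$ (k, j))"
    by (rule finsum_cong') (use ij c A in auto)
  finally show ?thesis .
qed

lemma positive_elem_matrix_algD:
  assumes "positive_elem (matrix_alg m A) X"
  shows "\<exists>Y. (\<forall>k<m. \<forall>i<m. Y k i \<in> carrier A) \<and>
    (\<forall>i<m. \<forall>j<m. X $$ (i, j) = (\<Oplus>k\<in>{..<m}. adj A (Y k i) \<otimes> Y k j))"
proof -
  obtain W where W: "W \<in> carrier (matrix_alg m A)"
    and X: "X = adj (matrix_alg m A) W \<otimes>\<^bsub>matrix_alg m A\<^esub> W"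
    using assms by (auto simp: positive_elem_def)
  have "W $$ (k, i) \<in> carrier A" if "k < m" "i < m" for k i
    using W that elements_matI[of W m m k i] unfolding matrix_alg_def by auto
  thus ?thesis using matrix_alg_adj_mult[OF W]
    by (intro exI[of _ "\<lambda>k i. W $$ (k, i)"]) (simp add: X)
qed

lemma positive_elem_matrix_algI:
  assumes Y: "\<And>k i. k < m \<Longrightarrow> i < m \<Longrightarrow> Y k i \<in> carrier A" and X: "X \<in> carrier_mat m m"
    and eq: "\<And>i j. i < m \<Longrightarrow> j < m \<Longrightarrow> X $$ (i, j) = (\<Oplus>k\<in>{..<m}. adj A (Y k i) \<otimes> Y k j)"
  shows "positive_elem (matrix_alg m A) X"
proof -
  interpret abelian_monoid A by (rule A)
  define W where "W = mat m m (\<lambda>(k, i). Y k i)"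
  have W: "W \<in> carrier (matrix_alg m A)"
    using Y by (auto simp: matrix_alg_def W_def elements_mat_def)
  have "X = adj (matrix_alg m A) W \<otimes>\<^bsub>matrix_alg m A\<^esub> W"
  proof (rule eq_matI)
    show "dim_row X = dim_row (adj (matrix_alg m A) W \<otimes>\<^bsub>matrix_alg m A\<^esub> W)"
      "dim_col X = dim_col (adj (matrix_alg m A) W \<otimes>\<^bsub>matrix_alg m A\<^esub> W)"
      using X by (simp_all add: matrix_alg_def)
    fix i j assume "i < dim_row (adj (matrix_alg m A) W \<otimes>\<^bsub>matrix_alg m A\<^esub> W)"
      "j < dim_col (adj (matrix_alg m A) W \<otimes>\<^bsub>matrix_alg m A\<^esub> W)"
    hence ij: "i < m" "j < m" by (simp_all add: matrix_alg_def)
    show "X $$ (i, j) = (adj (matrix_alg m A) W \<otimes>\<^bsub>matrix_alg m A\<^esub> W) $$ (i, j)"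
      unfolding matrix_alg_adj_mult[OF W ij] eq[OF ij]
      by (rule finsum_cong') (use ij Y A in \<open>auto simp: W_def\<close>)
  qed
  thus ?thesis using W by (auto simp: positive_elem_def)
qed

end

lemma complex_mat_alg_closed:
  "x \<in> carrier (complex_mat_alg n) \<Longrightarrow> adj (complex_mat_alg n) x \<in> carrier (complex_mat_alg n)"
  "x \<in> carrier (complex_mat_alg n) \<Longrightarrow> y \<in> carrier (complex_mat_alg n) \<Longrightarrow>
    x \<otimes>\<^bsub>complex_mat_alg n\<^esub> y \<in> carrier (complex_mat_alg n)"
  by simp_all

lemma finsum_adj_mult_entry:
  fixes m n :: nat
  assumes "\<And>k i. k < m \<Longrightarrow> i < m \<Longrightarrow> Y k i \<in> carrier_mat n n" "i < m" "j < m" "a < n" "b < n"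
  shows "(\<Oplus>\<^bsub>complex_mat_alg n\<^esub>k\<in>{..<m}. adj (complex_mat_alg n) (Y k i) \<otimes>\<^bsub>complex_mat_alg n\<^esub> Y k j) $$ (a, b)
    = (\<Sum>k<m. \<Sum>c<n. cnj (Y k i $$ (c, a)) * Y k j $$ (c, b))"
proof -
  have "(\<Oplus>\<^bsub>complex_mat_alg n\<^esub>k\<in>{..<m}. mat_adjoint (Y k i) * Y k j) $$ (a, b)
    = (\<Sum>k<m. (mat_adjoint (Y k i) * Y k j) $$ (a, b))"
    using assms by (intro finsum_complex_mat[THEN conjunct2, rule_format]) (auto intro!: mult_carrier_mat[of _ n n])
  also have "\<dots> = (\<Sum>k<m. \<Sum>c<n. cnj (Y k i $$ (c, a)) * Y k j $$ (c, b))"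
    using assms by (intro sum.cong refl) (simp add: mat_mult_entry[of _ n] mat_adjoint_entry[of _ n])
  finally show ?thesis by simp
qed

text \<open>An m-by-m matrix of n-by-n blocks is flattened to a scalar kernel on pairs; for a
  product adj Y times Y this is the Gram kernel of the flattened rows (k, c) of Y.\<close>

lemma positive_matrix_imp_psd:
  assumes "positive_elem (matrix_alg m (complex_mat_alg n)) X"
  shows "psd ({..<m} \<times> {..<n}) (\<lambda>(i, a) (j, b). X $$ (i, j) $$ (a, b))"
proof -
  obtain Y where Yc: "\<And>k i. k < m \<Longrightarrow> i < m \<Longrightarrow> Y k i \<in> carrier (complex_mat_alg n)"
    and eq: "\<And>i j. i < m \<Longrightarrow> j < m \<Longrightarrow> X $$ (i, j)
      = (\<Oplus>\<^bsub>complex_mat_alg n\<^esub>k\<in>{..<m}. adj (complex_mat_alg n) (Y k i) \<otimes>\<^bsub>complex_mat_alg n\<^esub> Y k j)"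
    using positive_elem_matrix_algD[OF abelian_monoid_complex_mat complex_mat_alg_closed assms] by blast
  have Y: "\<And>k i. k < m \<Longrightarrow> i < m \<Longrightarrow> Y k i \<in> carrier_mat n n" using Yc by simp
  show ?thesis
    by (rule psd_gram[where R = "{..<m} \<times> {..<n}" and Z = "\<lambda>(k, c) (i, a). Y k i $$ (c, a)"])
       (use Y in \<open>auto simp: eq finsum_adj_mult_entry sum.cartesian_product' simp del: complex_mat_alg_simps\<close>)
qed

text \<open>The Cholesky factor has its rows indexed by the same set as its columns, so it can be
  cut back into an m-by-m matrix of n-by-n blocks. That matrix is the witness which
  \<open>positive_elem\<close> demands.\<close>

lemma psd_imp_positive_matrix:
  assumes X: "X \<in> carrier_mat m m" "\<And>i j. i < m \<Longrightarrow> j < m \<Longrightarrow> X $$ (i, j) \<in> carrier_mat n n"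
    and psd: "psd ({..<m} \<times> {..<n}) (\<lambda>(i, a) (j, b). X $$ (i, j) $$ (a, b))"
  shows "positive_elem (matrix_alg m (complex_mat_alg n)) X"
proof -
  let ?S = "{..<m} \<times> {..<n}"
  have S: "finite ?S" by simp
  obtain Z where Z: "\<And>p q. p \<in> ?S \<Longrightarrow> q \<in> ?S \<Longrightarrow>
      (\<lambda>(i, a) (j, b). X $$ (i, j) $$ (a, b)) p q = (\<Sum>r\<in>?S. cnj (Z r p) * Z r q)"
    using psd_imp_gram[OF S psd] by blast
  define Y where "Y k i = mat n n (\<lambda>(c, a). Z (k, c) (i, a))" for k i
  have Yc: "Y k i \<in> carrier_mat n n" for k i by (simp add: Y_def)
  show ?thesis
  proof (rule positive_elem_matrix_algI[OF abelian_monoid_complex_mat complex_mat_alg_closed _ X(1)])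
    show "Y k i \<in> carrier (complex_mat_alg n)" for k i by (simp add: Yc)
    fix i j assume ij: "i < m" "j < m"
    let ?R = "\<Oplus>\<^bsub>complex_mat_alg n\<^esub>k\<in>{..<m}. adj (complex_mat_alg n) (Y k i) \<otimes>\<^bsub>complex_mat_alg n\<^esub> Y k j"
    have R: "?R \<in> carrier_mat n n"
      using finsum_complex_mat[of "{..<m}" "\<lambda>k. adj (complex_mat_alg n) (Y k i) \<otimes>\<^bsub>complex_mat_alg n\<^esub> Y k j" n]
      using mult_carrier_mat[OF mat_adjoint_carrier[OF Yc] Yc] by simp
    show "X $$ (i, j) = ?R"
    proof (rule eq_matI)
      fix a b assume "a < dim_row ?R" "b < dim_col ?R"
      hence ab: "a < n" "b < n" using R by auto
      have "X $$ (i, j) $$ (a, b) = (\<Sum>k<m. \<Sum>c<n. cnj (Z (k, c) (i, a)) * Z (k, c) (j, b))"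
        using Z[of "(i, a)" "(j, b)"] ij ab by (simp add: sum.cartesian_product')
      also have "\<dots> = ?R $$ (a, b)"
      proof -
        have "?R $$ (a, b) = (\<Sum>k<m. \<Sum>c<n. cnj (Y k i $$ (c, a)) * Y k j $$ (c, b))"
          by (rule finsum_adj_mult_entry) (use Yc ij ab in auto)
        thus ?thesis using ab by (simp add: Y_def)
      qed
      finally show "X $$ (i, j) $$ (a, b) = ?R $$ (a, b)" .
    qed (use R X(2)[OF ij] in auto)
  qed
qed

context pd_function
begin

text \<open>A product adj Y times Y is the sum over \<open>k\<close> of the matrices built from row
  \<open>k\<close> of Y alone, and each of these is covered by \<open>psd_E\<close>.\<close>

lemma psd_E_positive:
  assumes "positive_elem (matrix_alg m AG) X"
  shows "psd ({..<m} \<times> I) (\<lambda>(i, a) (j, b). E a b (X $$ (i, j)))"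
proof -
  obtain Y where Y: "\<And>k i. k < m \<Longrightarrow> i < m \<Longrightarrow> Y k i \<in> carrier AG"
    and X: "\<And>i j. i < m \<Longrightarrow> j < m \<Longrightarrow> X $$ (i, j) = (\<Oplus>\<^bsub>AG\<^esub>k\<in>{..<m}. adj AG (Y k i) \<otimes>\<^bsub>AG\<^esub> Y k j)"
    using positive_elem_matrix_algD[OF A.R.abelian_monoid_axioms A.adj_closed A.R.m_closed assms] by blast
  have 1: "psd ({..<m} \<times> I) (\<lambda>p q. \<Sum>k<m. (\<lambda>(i, a) (j, b). E a b (adj AG (Y k i) \<otimes>\<^bsub>AG\<^esub> Y k j)) p q)"
    by (intro psd_sum psd_E) (use Y in auto)
  have 2: "(\<lambda>(i, a) (j, b). E a b (X $$ (i, j))) p q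
      = (\<Sum>k<m. (\<lambda>(i, a) (j, b). E a b (adj AG (Y k i) \<otimes>\<^bsub>AG\<^esub> Y k j)) p q)"
    if "p \<in> {..<m} \<times> I" "q \<in> {..<m} \<times> I" for p q
    using that Y by (auto simp: X intro!: E_finsum A.R.m_closed A.adj_closed)
  show ?thesis by (rule psd_cong[THEN iffD2, OF 2 1])
qed

end

locale pd_matrix = pd_function G "{..<n}" \<phi>
  for G :: "('g, 'm) monoid_scheme" (structure) and n and \<phi> :: "'g \<Rightarrow> nat \<Rightarrow> nat \<Rightarrow> complex"
begin

definition Phi :: "(nat \<Rightarrow> 'g \<Rightarrow> complex) set \<Rightarrow> complex mat" where
  "Phi x = mat n n (\<lambda>(a, b). E a b x)"

lemma Phi_carrier [simp]: "Phi x \<in> carrier_mat n n"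
  by (simp add: Phi_def)

lemma ucp_Phi: "ucp AG (complex_mat_alg n) Phi"
  unfolding ucp_def
proof (intro conjI)
  show "linear_on AG (complex_mat_alg n) Phi"
    unfolding linear_on_def by (auto simp: E_add E_scale Phi_def intro!: eq_matI)
  show "Phi \<one>\<^bsub>AG\<^esub> = \<one>\<^bsub>complex_mat_alg n\<^esub>"
    by (auto simp: E_one Phi_def intro!: eq_matI)
  show "completely_positive AG (complex_mat_alg n) Phi"
    unfolding completely_positive_def
  proof (intro allI impI)
    fix m X assume X: "positive_elem (matrix_alg m AG) X"
    have Xc: "X \<in> carrier_mat m m"
      using X by (auto simp: positive_elem_def matrix_alg_def)
    show "positive_elem (matrix_alg m (complex_mat_alg n)) (map_mat Phi X)"
    proof (rule psd_imp_positive_matrix)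
      show "psd ({..<m} \<times> {..<n}) (\<lambda>(i, a) (j, b). map_mat Phi X $$ (i, j) $$ (a, b))"
        by (rule psd_cong[THEN iffD1, OF _ psd_E_positive[OF X]])
           (use Xc in \<open>auto simp: Phi_def\<close>)
    qed (use Xc in auto)
  qed
qed

end

section \<open>The Hilbert--Schmidt norm and the canonical trace\<close>

text \<open>Identifies the normalized Hilbert-Schmidt norm with a Euclidean norm of the entries,
  from which the triangle inequality is inherited.\<close>

lemma norm2_eq:
  assumes X: "X \<in> carrier_mat n n"
  shows "norm2 n X = L2_set (\<lambda>(a, b). cmod (X $$ (a, b))) ({..<n} \<times> {..<n}) / sqrt n"
proof -
  have "ntr n (mat_adjoint X * X) = (\<Sum>i<n. \<Sum>k<n. of_real ((cmod (X $$ (k, i)))\<^sup>2)) / of_nat n"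
    unfolding ntr_def using X
    by (intro arg_cong2[where f = "(/)"] sum.cong refl)
       (simp only: mat_mult_entry[of _ n] mat_adjoint_carrier lessThan_iff, intro sum.cong refl,
        simp only: lessThan_iff mat_adjoint_entry complex_norm_square mult.commute)
  hence "Re (ntr n (mat_adjoint X * X)) = (\<Sum>i<n. \<Sum>k<n. (cmod (X $$ (k, i)))\<^sup>2) / n"
    by (simp flip: of_real_sum of_real_power)
  also have "(\<Sum>i<n. \<Sum>k<n. (cmod (X $$ (k, i)))\<^sup>2) = (\<Sum>k<n. \<Sum>i<n. (cmod (X $$ (k, i)))\<^sup>2)"
    by (rule sum.swap)
  finally show ?thesis
    unfolding norm2_def by (simp add: L2_set_def sum.cartesian_product' real_sqrt_divide)
qed

lemma norm2_nonneg: "X \<in> carrier_mat n n \<Longrightarrow> 0 \<le> norm2 n X"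
  by (simp add: norm2_eq)

lemma norm2_sq:
  assumes "X \<in> carrier_mat n n"
  shows "(norm2 n X)\<^sup>2 = (\<Sum>a<n. \<Sum>b<n. (cmod (X $$ (a, b)))\<^sup>2) / n"
  unfolding norm2_eq[OF assms]
  by (simp add: L2_set_def power_divide sum_nonneg sum.cartesian_product' case_prod_beta)

lemma norm2_add:
  assumes X: "X \<in> carrier_mat n n" and Y: "Y \<in> carrier_mat n n"
  shows "norm2 n (X + Y) \<le> norm2 n X + norm2 n Y"
proof -
  let ?S = "{..<n} \<times> {..<n}"
  have "L2_set (\<lambda>(a, b). cmod ((X + Y) $$ (a, b))) ?S
      \<le> L2_set (\<lambda>p. (\<lambda>(a, b). cmod (X $$ (a, b))) p + (\<lambda>(a, b). cmod (Y $$ (a, b))) p) ?S"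
    using X Y by (intro L2_set_mono) (auto intro: norm_triangle_ineq)
  also have "\<dots> \<le> L2_set (\<lambda>(a, b). cmod (X $$ (a, b))) ?S + L2_set (\<lambda>(a, b). cmod (Y $$ (a, b))) ?S"
    by (rule L2_set_triangle_ineq)
  finally show ?thesis using X Y
    by (simp add: norm2_eq divide_right_mono flip: add_divide_distrib)
qed

lemma norm2_scale:
  assumes X: "X \<in> carrier_mat n n"
  shows "norm2 n (c \<cdot>\<^sub>m X) = cmod c * norm2 n X"
proof (rule power2_eq_imp_eq)
  show "(norm2 n (c \<cdot>\<^sub>m X))\<^sup>2 = (cmod c * norm2 n X)\<^sup>2"
    using X by (simp add: norm2_sq power_mult_distrib norm_mult sum_distrib_left)
qed (use X norm2_nonneg in auto)

text \<open>The columns of the product are \<open>X\<close> applied to the columns of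
  \<open>Y\<close>, so an operator bound \<open>C\<close> on \<open>X\<close> can be used column by
  column.\<close>

lemma norm2_mult_le:
  assumes X: "X \<in> carrier_mat n n" and Y: "Y \<in> carrier_mat n n" and C: "0 \<le> C"
    and contr: "\<And>\<xi>. (\<Sum>a<n. (cmod (\<Sum>b<n. X $$ (a, b) * \<xi> b))\<^sup>2) \<le> C\<^sup>2 * (\<Sum>b<n. (cmod (\<xi> b))\<^sup>2)"
  shows "norm2 n (X * Y) \<le> C * norm2 n Y"
proof (rule power2_le_imp_le)
  have "(\<Sum>a<n. \<Sum>b<n. (cmod ((X * Y) $$ (a, b)))\<^sup>2) = (\<Sum>b<n. \<Sum>a<n. (cmod (\<Sum>c<n. X $$ (a, c) * Y $$ (c, b)))\<^sup>2)"
    using X Y by (subst sum.swap) (simp add: mat_mult_entry[of _ n] del: index_mult_mat(1))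
  also have "\<dots> \<le> (\<Sum>b<n. C\<^sup>2 * (\<Sum>c<n. (cmod (Y $$ (c, b)))\<^sup>2))"
    by (intro sum_mono contr)
  also have "\<dots> = C\<^sup>2 * (\<Sum>a<n. \<Sum>b<n. (cmod (Y $$ (a, b)))\<^sup>2)"
    by (subst sum.swap) (simp add: sum_distrib_left)
  finally show "(norm2 n (X * Y))\<^sup>2 \<le> (C * norm2 n Y)\<^sup>2"
    using X Y by (simp add: norm2_sq[of _ n] power_mult_distrib divide_right_mono)
qed (use C Y norm2_nonneg in simp)

lemma norm2_one: "0 < n \<Longrightarrow> norm2 n (1\<^sub>m n) = 1"
proof (rule power2_eq_imp_eq)
  assume n: "0 < n"
  have "(\<Sum>a<n. \<Sum>b<n. (cmod ((1\<^sub>m n :: complex mat) $$ (a, b)))\<^sup>2) = (\<Sum>a<n. \<Sum>b<n. if a = b then 1 else 0)"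
    by (intro sum.cong refl) simp
  thus "(norm2 n (1\<^sub>m n))\<^sup>2 = 1\<^sup>2" using n by (simp add: norm2_sq)
qed (use norm2_nonneg[of "1\<^sub>m n" n] in auto)

context group_algebra
begin

text \<open>The canonical trace is the one-dimensional case of the theory: its kernel is the
  constant kernel 1 with all entries off the diagonal deleted. Boundedness and positivity of the
  trace on the completion are then instances of results on \<open>pd_function\<close>.\<close>

lemma delta_pd_function: "pd_function G {()} (\<lambda>g _ _. if g = \<one> then 1 else 0)"
proof unfold_locales
  show "pd G {()} (\<lambda>g _ _. if g = \<one> then 1 else 0)"
    unfolding pd_def
  proof (intro allI impI)
    fix F assume F: "finite F \<and> F \<subseteq> carrier G"
    have "psd (F \<times> {()}) (\<lambda>p q. if fst p = fst q then 1 else 0)"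
      by (rule psd_block, use F in simp, rule psd_gram[where R = "{()}" and Z = "\<lambda>_ _. 1"]) simp
    moreover have "inv g \<otimes> h = \<one> \<longleftrightarrow> g = h" if "g \<in> F" "h \<in> F" for g h
      using F that by (metis inv_closed inv_equality inv_inv l_inv subsetD)
    ultimately show "psd (F \<times> {()}) (\<lambda>(g, a) (h, b). if inv g \<otimes> h = \<one> then 1 else 0)"
      by (subst psd_cong[where L = "\<lambda>p q. if fst p = fst q then 1 else 0"]) auto
  qed
qed auto

lemma delta_coef:
  assumes "f \<in> carrier CG"
  shows "pd_function.coef (\<lambda>g _ _. if g = \<one> then 1 else 0) () () f = f \<one>"
proof -
  interpret D: pd_function G "{()}" "\<lambda>g _ _. if g = \<one> then 1 else 0" by (rule delta_pd_function)
  have "D.coef () () f = (\<Sum>x\<in>supp f. if x = \<one> then f x else 0)"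
    unfolding D.coef_def lin_ext_def by (intro sum.cong) auto
  thus ?thesis using assms by (simp add: CG_simps(1))
qed

lemma bounded_functional_eval_one: "bounded_functional (\<lambda>f. f \<one>)"
proof -
  interpret D: pd_function G "{()}" "\<lambda>g _ _. if g = \<one> then 1 else 0" by (rule delta_pd_function)
  have "cmod (f \<one>) \<le> 1 * full_norm G f" if "f \<in> carrier CG" for f
    using D.coef_bound[OF that, of "()" "()"] delta_coef[OF that] by simp
  thus ?thesis unfolding bounded_functional_def by (auto simp: CG_simps(4,5) intro!: exI[of _ 1])
qed

lemma canonical_trace_eq: "canonical_trace G = lim_ext (\<lambda>f. f \<one>)"
  by (simp add: fun_eq_iff canonical_trace_def lim_ext_def)

lemma canonical_trace_eq_delta:
  assumes "x \<in> carrier AG"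
  shows "canonical_trace G x = pd_function.E (\<lambda>g _ _. if g = \<one> then 1 else 0) () () x"
proof -
  interpret D: pd_function G "{()}" "\<lambda>g _ _. if g = \<one> then 1 else 0" by (rule delta_pd_function)
  obtain X where X: "X \<in> CS" "x = S.cl X" using assms by (metis AG_cases)
  have "(\<lambda>n. X n \<one>) \<longlonglongrightarrow> D.E () () x"
    using D.E_tendsto[OF _ _ X(1), of "()" "()"] delta_coef[OF CSD[OF X(1)]] X(2) by simp
  thus ?thesis unfolding canonical_trace_eq X(2)
    by (intro lim_ext_eqI bounded_functional_eval_one X)
qed

text \<open>In a group \<open>y \<otimes> z = \<one>\<close> exactly if
  \<open>z \<otimes> y = \<one>\<close>, so both convolutions at the unit sum the same
  products.\<close>

lemma mu_at_one_commute:
  assumes "f \<in> carrier CG" "h \<in> carrier CG"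
  shows "mu f h \<one> = mu h f \<one>"
proof -
  note c = assms[unfolded CG_simps, simplified]
  have "mu f h \<one> = (\<Sum>y\<in>supp f. \<Sum>z\<in>supp h. if y \<otimes> z = \<one> then f y * h z else 0)"
    by (rule mu_eq) (use c in auto)
  also have "\<dots> = (\<Sum>y\<in>supp f. \<Sum>z\<in>supp h. if z \<otimes> y = \<one> then h z * f y else 0)"
  proof (intro sum.cong refl)
    fix y z assume "y \<in> supp f" "z \<in> supp h"
    hence "y \<in> carrier G" "z \<in> carrier G" using c by auto
    hence "y \<otimes> z = \<one> \<longleftrightarrow> z \<otimes> y = \<one>" using inv_comm by blast
    thus "(if y \<otimes> z = \<one> then f y * h z else 0) = (if z \<otimes> y = \<one> then h z * f y else 0)" by simp
  qed
  also have "\<dots> = (\<Sum>z\<in>supp h. \<Sum>y\<in>supp f. if z \<otimes> y = \<one> then h z * f y else 0)" by (rule sum.swap)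
  also have "\<dots> = mu h f \<one>" by (rule mu_eq[symmetric]) (use c in auto)
  finally show ?thesis .
qed

lemma canonical_trace_bound:
  assumes "x \<in> carrier AG"
  shows "cmod (canonical_trace G x) \<le> nrm AG x"
proof -
  interpret D: pd_function G "{()}" "\<lambda>g _ _. if g = \<one> then 1 else 0" by (rule delta_pd_function)
  have "(cmod (canonical_trace G x))\<^sup>2 \<le> (nrm AG x)\<^sup>2"
    using D.E_contraction[OF assms, of "\<lambda>_. 1"] canonical_trace_eq_delta[OF assms] by simp
  thus ?thesis by (rule power2_le_imp_le) (rule A.nn[OF assms])
qed

lemma tracial_state_canonical_trace: "tracial_state AG (canonical_trace G)"
proof -
  interpret D: pd_function G "{()}" "\<lambda>g _ _. if g = \<one> then 1 else 0" by (rule delta_pd_function)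
  note eq = canonical_trace_eq_delta
  show ?thesis unfolding tracial_state_def
  proof (intro conjI ballI allI)
    fix x assume x: "x \<in> carrier AG"
    show "canonical_trace G (c \<odot>\<^bsub>AG\<^esub> x) = c * canonical_trace G x" for c
      using x by (simp add: eq D.E_scale)
    have "D.E () () (adj AG x \<otimes>\<^bsub>AG\<^esub> x) \<in> \<real>\<^sub>\<ge>\<^sub>0"
      using psd_diag[OF _ D.psd_E[of "{()}" "\<lambda>_. x"], of "((), ())"] x by simp
    thus "canonical_trace G (adj AG x \<otimes>\<^bsub>AG\<^esub> x) \<in> \<real>" "0 \<le> Re (canonical_trace G (adj AG x \<otimes>\<^bsub>AG\<^esub> x))"
      using x by (simp_all add: eq A.adj_closed complex_nonneg_Reals_iff complex_is_Real_iff)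
    fix y assume y: "y \<in> carrier AG"
    show "canonical_trace G (x \<oplus>\<^bsub>AG\<^esub> y) = canonical_trace G x + canonical_trace G y"
      using x y by (simp add: eq D.E_add)
    obtain X Y where X: "X \<in> CS" "x = S.cl X" and Y: "Y \<in> CS" "y = S.cl Y"
      using x y by (metis AG_cases)
    have "(\<lambda>n. mu (X n) (Y n) \<one>) \<longlonglongrightarrow> canonical_trace G (x \<otimes>\<^bsub>AG\<^esub> y)"
      using lim_ext_tendsto[OF bounded_functional_eval_one CS_closed(2)[OF X(1) Y(1)]]
      by (simp add: X(2) Y(2) AG_ops(2)[OF X(1) Y(1)] canonical_trace_eq)
    moreover have "(\<lambda>n. mu (X n) (Y n) \<one>) \<longlonglongrightarrow> canonical_trace G (y \<otimes>\<^bsub>AG\<^esub> x)"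
      using lim_ext_tendsto[OF bounded_functional_eval_one CS_closed(2)[OF Y(1) X(1)]]
        mu_at_one_commute[OF CSD[OF X(1)] CSD[OF Y(1)]]
      by (simp add: X(2) Y(2) AG_ops(2)[OF Y(1) X(1)] canonical_trace_eq)
    ultimately show "canonical_trace G (x \<otimes>\<^bsub>AG\<^esub> y) = canonical_trace G (y \<otimes>\<^bsub>AG\<^esub> x)"
      by (rule LIMSEQ_unique)
  next
    show "canonical_trace G \<one>\<^bsub>AG\<^esub> = 1" by (simp add: eq D.E_one)
  qed
qed

end

lemma mat_diff_eq: "X \<in> carrier_mat n n \<Longrightarrow> Y \<in> carrier_mat n n \<Longrightarrow> X - Y = X + (-1 :: complex) \<cdot>\<^sub>m Y"
  by (auto intro!: eq_matI)

lemma norm2_diff: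
  assumes "X \<in> carrier_mat n n" "Y \<in> carrier_mat n n"
  shows "norm2 n (X - Y) \<le> norm2 n X + norm2 n Y"
  using norm2_add[of X n "(-1) \<cdot>\<^sub>m Y"] norm2_scale[of Y n "-1"] assms by (simp add: mat_diff_eq)

context group_algebra
begin

text \<open>The canonical unitary of a group element, as the class of a constant sequence.\<close>

abbreviation em :: "'a \<Rightarrow> (nat \<Rightarrow> 'a \<Rightarrow> complex) set" where
  "em g \<equiv> S.cl (\<lambda>_. dl g)"

lemma const_CS: "f \<in> carrier CG \<Longrightarrow> (\<lambda>_. f) \<in> CS"
  using S.cs_const[of f] by simp

lemma em_closed: "g \<in> carrier G \<Longrightarrow> em g \<in> carrier AG"
  by (intro AG_mem const_CS dl_closed)

lemma em_adj_mult:
  assumes "g \<in> carrier G" "h \<in> carrier G"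
  shows "adj AG (em g) \<otimes>\<^bsub>AG\<^esub> em h = em (inv g \<otimes> h)"
  using assms by (simp add: AG_ops const_CS dl_closed CS_closed adj_dl_mult)

lemma canonical_trace_em: "g \<in> carrier G \<Longrightarrow> canonical_trace G (em g) = (if g = \<one> then 1 else 0)"
  by (simp add: canonical_trace_eq lim_ext_const bounded_functional_eval_one dl_closed) (simp add: dl_def)

text \<open>Convergence of the trace and of the multiplicative defect on the completion is reduced to group
  elements by linearity and density; only subadditivity and a uniform Lipschitz bound enter.\<close>

lemma seminorm_family_tendsto:
  fixes u :: "'z \<Rightarrow> (nat \<Rightarrow> 'a \<Rightarrow> complex) set \<Rightarrow> real"
  assumes F: "\<forall>\<^sub>F z in F. \<forall>x\<in>carrier AG. 0 \<le> u z x \<and> u z x \<le> C * nrm AG x \<and>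
      (\<forall>c. u z (c \<odot>\<^bsub>AG\<^esub> x) \<le> cmod c * u z x) \<and> (\<forall>y\<in>carrier AG. u z (x \<oplus>\<^bsub>AG\<^esub> y) \<le> u z x + u z y)"
    and dl: "\<And>g. g \<in> carrier G \<Longrightarrow> ((\<lambda>z. u z (em g)) \<longlongrightarrow> 0) F"
    and a: "a \<in> carrier AG"
  shows "((\<lambda>z. u z a) \<longlongrightarrow> 0) F"
proof -
  have CG: "((\<lambda>z. u z (S.cl (\<lambda>_. f))) \<longlongrightarrow> 0) F" if "f \<in> carrier CG" for f
    using that
  proof (induction f rule: CG_induct)
    case zero
    \<comment> \<open>Zero is written as a multiple of a genuine element, so that homogeneity forces
      \<open>u\<close> to vanish on it.\<close>
    have e: "S.cl (\<lambda>_. \<zero>\<^bsub>CG\<^esub>) = 0 \<odot>\<^bsub>AG\<^esub> em \<one>"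
      by (simp add: AG_ops const_CS dl_closed CG_simps(3,5))
    show ?case
    proof (rule tendsto_eventually, use F in eventually_elim)
      case (elim z)
      have "em \<one> \<in> carrier AG" "0 \<odot>\<^bsub>AG\<^esub> em \<one> \<in> carrier AG" by (simp_all add: em_closed del: A.sm_zero)
      hence "u z (0 \<odot>\<^bsub>AG\<^esub> em \<one>) \<le> cmod 0 * u z (em \<one>)" "0 \<le> u z (0 \<odot>\<^bsub>AG\<^esub> em \<one>)" using elim by blast+
      thus "u z (S.cl (\<lambda>_. \<zero>\<^bsub>CG\<^esub>)) = 0" unfolding e by simp
    qed
  next
    case (add c g h)
    have c: "c \<odot>\<^bsub>CG\<^esub> dl g \<in> carrier CG" using S.sm_closed[of "dl g" c] add(1) by (simp add: dl_closed)
    have cl: "em g \<in> carrier AG" "S.cl (\<lambda>_. h) \<in> carrier AG" "c \<odot>\<^bsub>AG\<^esub> em g \<in> carrier AG"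
      using add by (auto intro: em_closed AG_mem const_CS)
    have e: "S.cl (\<lambda>_. c \<odot>\<^bsub>CG\<^esub> dl g \<oplus>\<^bsub>CG\<^esub> h) = (c \<odot>\<^bsub>AG\<^esub> em g) \<oplus>\<^bsub>AG\<^esub> S.cl (\<lambda>_. h)"
      using add c by (simp add: AG_ops const_CS dl_closed)
    show ?case
    proof (rule tendsto_sandwich)
      show "\<forall>\<^sub>F z in F. 0 \<le> u z (S.cl (\<lambda>_. c \<odot>\<^bsub>CG\<^esub> dl g \<oplus>\<^bsub>CG\<^esub> h))"
        using F by eventually_elim (use cl e in auto)
      show "\<forall>\<^sub>F z in F. u z (S.cl (\<lambda>_. c \<odot>\<^bsub>CG\<^esub> dl g \<oplus>\<^bsub>CG\<^esub> h)) \<le> cmod c * u z (em g) + u z (S.cl (\<lambda>_. h))"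
        using F
      proof eventually_elim
        case (elim z)
        have "u z ((c \<odot>\<^bsub>AG\<^esub> em g) \<oplus>\<^bsub>AG\<^esub> S.cl (\<lambda>_. h)) \<le> u z (c \<odot>\<^bsub>AG\<^esub> em g) + u z (S.cl (\<lambda>_. h))"
          "u z (c \<odot>\<^bsub>AG\<^esub> em g) \<le> cmod c * u z (em g)"
          using elim cl by blast+
        thus ?case unfolding e by linarith
      qed
      show "((\<lambda>z. cmod c * u z (em g) + u z (S.cl (\<lambda>_. h))) \<longlongrightarrow> 0) F"
        using tendsto_add[OF tendsto_mult[OF tendsto_const dl[OF add(1)], of "cmod c"] add(3)] by simp
    qed simp
  qed
  show ?thesis
  proof (rule tendstoI)
    fix e :: real assume e: "e > 0"
    \<comment> \<open>A strictly positive replacement for \<open>C\<close>, whose sign is not fixed,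
      so that the approximation error may be divided by it.\<close>
    define C' where "C' = \<bar>C\<bar> + 1"
    have C': "C' > 0" "C \<le> C'" by (auto simp: C'_def)
    have "e / (2 * C') > 0" using e C' by simp
    then obtain x where x: "x \<in> carrier CG" "nrm AG (a \<ominus>\<^bsub>AG\<^esub> S.cl (\<lambda>_. x)) < e / (2 * C')"
      using AG_dense[OF a] by blast
    let ?x = "S.cl (\<lambda>_. x)"
    have cx: "?x \<in> carrier AG" "a \<ominus>\<^bsub>AG\<^esub> ?x \<in> carrier AG" using x a by (simp_all add: AG_mem const_CS)
    have ae: "a = (a \<ominus>\<^bsub>AG\<^esub> ?x) \<oplus>\<^bsub>AG\<^esub> ?x" using a cx(1)
      by (simp add: A.R.minus_eq A.R.a_assoc A.R.l_neg)
    have n: "C * nrm AG (a \<ominus>\<^bsub>AG\<^esub> ?x) < e / 2"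
    proof -
      have "C * nrm AG (a \<ominus>\<^bsub>AG\<^esub> ?x) \<le> C' * nrm AG (a \<ominus>\<^bsub>AG\<^esub> ?x)"
        using C'(2) A.nn[OF cx(2)] by (rule mult_right_mono)
      also have "\<dots> < C' * (e / (2 * C'))" using x(2) C'(1) by (rule mult_strict_left_mono)
      finally show ?thesis using C' by simp
    qed
    have "\<forall>\<^sub>F z in F. u z ?x < e / 2"
      using order_tendstoD(2)[OF CG[OF x(1)], of "e / 2"] e by simp
    thus "\<forall>\<^sub>F z in F. dist (u z a) 0 < e" using F
    proof eventually_elim
      case (elim z)
      have "u z ((a \<ominus>\<^bsub>AG\<^esub> ?x) \<oplus>\<^bsub>AG\<^esub> ?x) \<le> u z (a \<ominus>\<^bsub>AG\<^esub> ?x) + u z ?x" "0 \<le> u z a"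
        "u z (a \<ominus>\<^bsub>AG\<^esub> ?x) \<le> C * nrm AG (a \<ominus>\<^bsub>AG\<^esub> ?x)"
        using elim(2) cx a by blast+
      thus ?case using elim(1) n ae by simp
    qed
  qed
qed

end

context pd_matrix
begin

lemma Phi_entry: "a < n \<Longrightarrow> b < n \<Longrightarrow> Phi x $$ (a, b) = E a b x"
  by (simp add: Phi_def)

lemma Phi_adj:
  assumes "x \<in> carrier AG"
  shows "mat_adjoint (Phi x) = Phi (adj AG x)"
proof (rule eq_matI)
  fix i j assume "i < dim_row (Phi (adj AG x))" "j < dim_col (Phi (adj AG x))"
  hence "i < n" "j < n" by (simp_all add: Phi_def)
  thus "mat_adjoint (Phi x) $$ (i, j) = Phi (adj AG x) $$ (i, j)"
    using assms by (simp add: mat_adjoint_entry[OF Phi_carrier] Phi_entry E_adj)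
qed (use carrier_matD[OF mat_adjoint_carrier[OF Phi_carrier]] carrier_matD[OF Phi_carrier] in auto)

lemma norm2_Phi_mult:
  assumes "x \<in> carrier AG" "Y \<in> carrier_mat n n"
  shows "norm2 n (Phi x * Y) \<le> nrm AG x * norm2 n Y"
proof (rule norm2_mult_le)
  show "(\<Sum>a<n. (cmod (\<Sum>b<n. Phi x $$ (a, b) * \<xi> b))\<^sup>2) \<le> (nrm AG x)\<^sup>2 * (\<Sum>b<n. (cmod (\<xi> b))\<^sup>2)" for \<xi>
    using E_contraction[OF assms(1), of \<xi>] by (simp add: Phi_def)
qed (use assms A.nn in auto)

lemma norm2_Phi:
  assumes "x \<in> carrier AG" "0 < n"
  shows "norm2 n (Phi x) \<le> nrm AG x"
  using norm2_Phi_mult[OF assms(1), of "1\<^sub>m n"] norm2_one[OF assms(2)] right_mult_one_mat[OF Phi_carrier] by simp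

text \<open>Conjugate linear in \<open>x\<close> and linear in \<open>y\<close>. Its normalized
  Hilbert-Schmidt norm is therefore a seminorm in each variable, as the density argument
  requires.\<close>

definition defect :: "(nat \<Rightarrow> 'g \<Rightarrow> complex) set \<Rightarrow> (nat \<Rightarrow> 'g \<Rightarrow> complex) set \<Rightarrow> complex mat" where
  "defect x y = Phi (adj AG x \<otimes>\<^bsub>AG\<^esub> y) - mat_adjoint (Phi x) * Phi y"

lemma defect_carrier [simp]: "defect x y \<in> carrier_mat n n"
  unfolding defect_def by (intro minus_carrier_mat mult_carrier_mat[of _ n n]) simp_all

lemma defect_entry:
  assumes "x \<in> carrier AG" "y \<in> carrier AG" "a < n" "b < n"
  shows "defect x y $$ (a, b) = E a b (adj AG x \<otimes>\<^bsub>AG\<^esub> y) - (\<Sum>c<n. cnj (E c a x) * E c b y)"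
proof -
  have "(mat_adjoint (Phi x) * Phi y) $$ (a, b) = (\<Sum>c<n. mat_adjoint (Phi x) $$ (a, c) * Phi y $$ (c, b))"
    using assms by (intro mat_mult_entry) simp_all
  also have "\<dots> = (\<Sum>c<n. cnj (E c a x) * E c b y)"
    using assms by (intro sum.cong refl) (simp add: mat_adjoint_entry[OF Phi_carrier], simp add: Phi_def)
  finally show ?thesis
    using assms carrier_matD[OF mult_carrier_mat[OF mat_adjoint_carrier[OF Phi_carrier[of x]] Phi_carrier[of y]]]
    unfolding defect_def by (subst index_minus_mat) (simp_all, simp add: Phi_def)
qed

lemma defect_add:
  assumes "x \<in> carrier AG" "y \<in> carrier AG" "z \<in> carrier AG"
  shows "defect (x \<oplus>\<^bsub>AG\<^esub> z) y = defect x y + defect z y" "defect x (y \<oplus>\<^bsub>AG\<^esub> z) = defect x y + defect x z"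
  using assms carrier_matD[OF defect_carrier]
  by (auto simp: defect_entry A.adj_add A.R.l_distr A.R.r_distr A.adj_closed E_add algebra_simps sum.distrib intro!: eq_matI)

lemma defect_scale:
  assumes "x \<in> carrier AG" "y \<in> carrier AG"
  shows "defect (c \<odot>\<^bsub>AG\<^esub> x) y = cnj c \<cdot>\<^sub>m defect x y" "defect x (c \<odot>\<^bsub>AG\<^esub> y) = c \<cdot>\<^sub>m defect x y"
  using assms carrier_matD[OF defect_carrier]
  by (auto simp: defect_entry A.adj_smult A.smult_mult_left A.smult_mult_right A.adj_closed E_scale
      algebra_simps sum_distrib_left intro!: eq_matI)

text \<open>Both terms are bounded by the product of the two norms, whence the factor 2. The second
  term uses that \<open>Phi\<close> commutes with adjoints and acts as a contraction on the left.
  The bound does not depend on \<open>n\<close>.\<close>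

lemma norm2_defect_le:
  assumes x: "x \<in> carrier AG" and y: "y \<in> carrier AG" and n: "0 < n"
  shows "norm2 n (defect x y) \<le> 2 * nrm AG x * nrm AG y"
proof -
  have ax: "adj AG x \<in> carrier AG" using x by (rule A.adj_closed)
  have "norm2 n (defect x y) \<le> norm2 n (Phi (adj AG x \<otimes>\<^bsub>AG\<^esub> y)) + norm2 n (Phi (adj AG x) * Phi y)"
    unfolding defect_def Phi_adj[OF x] by (intro norm2_diff mult_carrier_mat[of _ n n]) simp_all
  also have "norm2 n (Phi (adj AG x \<otimes>\<^bsub>AG\<^esub> y)) \<le> nrm AG (adj AG x) * nrm AG y"
    using norm2_Phi[OF _ n, of "adj AG x \<otimes>\<^bsub>AG\<^esub> y"] A.nmul[OF ax y] ax y by simp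
  also have "norm2 n (Phi (adj AG x) * Phi y) \<le> nrm AG (adj AG x) * nrm AG y"
    using norm2_Phi_mult[OF ax Phi_carrier[of y]] mult_left_mono[OF norm2_Phi[OF y n] A.nn[OF ax]] by linarith
  finally show ?thesis by (simp add: A.nadj[OF x])
qed

definition trace_defect :: "(nat \<Rightarrow> 'g \<Rightarrow> complex) set \<Rightarrow> complex" where
  "trace_defect x = ntr n (Phi x) - canonical_trace G x"

lemma ntr_Phi: "ntr n (Phi x) = (\<Sum>a<n. E a a x) / of_nat n"
  by (simp add: ntr_def Phi_def)

lemma E_bound:
  assumes x: "x \<in> carrier AG" and a: "a < n"
  shows "cmod (E a a x) \<le> nrm AG x"
proof -
  have "(cmod (E a a x))\<^sup>2 \<le> (\<Sum>c<n. (cmod (\<Sum>b<n. E c b x * (if b = a then 1 else 0)))\<^sup>2)"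
    using a by (simp add: if_distrib[of "\<lambda>z. _ * z"] member_le_sum[of a "{..<n}" "\<lambda>c. (cmod (E c a x))\<^sup>2"] cong: if_cong)
  also have "\<dots> \<le> (nrm AG x)\<^sup>2 * (\<Sum>b<n. (cmod (if b = a then 1 else 0))\<^sup>2)"
    by (rule E_contraction[OF x])
  also have "(\<Sum>b<n. (cmod (if b = a then 1 else 0))\<^sup>2) = (\<Sum>b<n. if b = a then 1 else 0)"
    by (intro sum.cong) auto
  also have "\<dots> = 1" using a by simp
  finally have "(cmod (E a a x))\<^sup>2 \<le> (nrm AG x)\<^sup>2" by simp
  thus ?thesis by (rule power2_le_imp_le[OF _ A.nn[OF x]])
qed

lemma trace_defect_le:
  assumes x: "x \<in> carrier AG" and n: "0 < n"
  shows "cmod (trace_defect x) \<le> 2 * nrm AG x"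
proof -
  have "cmod (\<Sum>a<n. E a a x) \<le> (\<Sum>a<n. nrm AG x)"
    by (rule order_trans[OF norm_sum sum_mono]) (simp add: E_bound[OF x])
  hence "cmod (ntr n (Phi x)) \<le> nrm AG x" using n by (simp add: ntr_Phi norm_divide divide_le_eq mult.commute)
  thus ?thesis unfolding trace_defect_def
    using norm_triangle_ineq4[of "ntr n (Phi x)" "canonical_trace G x"] canonical_trace_bound[OF x] by linarith
qed

lemma trace_defect_linear:
  assumes "x \<in> carrier AG" "y \<in> carrier AG"
  shows "trace_defect (x \<oplus>\<^bsub>AG\<^esub> y) = trace_defect x + trace_defect y"
    "trace_defect (c \<odot>\<^bsub>AG\<^esub> x) = c * trace_defect x"
  using assms tracial_state_canonical_trace unfolding trace_defect_def ntr_Phi tracial_state_def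
  by (auto simp: E_add E_scale sum.distrib add_divide_distrib sum_distrib_left[symmetric] right_diff_distrib)

end

section \<open>Property (F) in terms of positive definite functions\<close>

text \<open>The multiplicative defect is measured by the squared Hilbert-Schmidt norm without
  normalization, hence the factor \<open>card I\<close> on the right; \<open>e\<close> bounds the
  square of the normalized norm, not the norm itself.\<close>

definition pd_approx ::
  "('g, 'm) monoid_scheme \<Rightarrow> 'i set \<Rightarrow> ('g \<Rightarrow> 'i \<Rightarrow> 'i \<Rightarrow> complex) \<Rightarrow> 'g set \<Rightarrow> real \<Rightarrow> bool" where
  "pd_approx G I \<phi> S e \<longleftrightarrow> finite I \<and> I \<noteq> {} \<and> pd G I \<phi> \<and>
     (\<forall>a\<in>I. \<forall>b\<in>I. \<phi> \<one>\<^bsub>G\<^esub> a b = (if a = b then 1 else 0)) \<and>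
     (\<forall>g\<in>S. cmod ((\<Sum>a\<in>I. \<phi> g a a) / of_nat (card I) - (if g = \<one>\<^bsub>G\<^esub> then 1 else 0)) < e) \<and>
     (\<forall>g\<in>S. \<forall>h\<in>S. (\<Sum>a\<in>I. \<Sum>b\<in>I. (cmod (\<phi> (inv\<^bsub>G\<^esub> g \<otimes>\<^bsub>G\<^esub> h) a b
        - (\<Sum>c\<in>I. cnj (\<phi> g c a) * \<phi> h c b)))\<^sup>2) < e * card I)"

lemma pd_approx_mono:
  assumes "pd_approx G I \<phi> S e" "T \<subseteq> S" "e \<le> d"
  shows "pd_approx G I \<phi> T d"
proof -
  have "e * card I \<le> d * card I" using assms(3) by (rule mult_right_mono) simp
  thus ?thesis using assms unfolding pd_approx_def by (meson less_le_trans subsetD)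
qed

text \<open>Supplies the filter of the net over pairs (S, e): directedness makes the sets
  \<open>D b\<close> a filter base, and their nonemptiness keeps the filter proper.\<close>

lemma directed_sets_filter:
  assumes B: "B \<noteq> {}" and D: "\<And>b. b \<in> B \<Longrightarrow> D b \<noteq> {}"
    and dir: "\<And>a b. a \<in> B \<Longrightarrow> b \<in> B \<Longrightarrow> \<exists>c\<in>B. D c \<subseteq> D a \<inter> D b"
  shows "\<exists>F. F \<noteq> bot \<and> (\<forall>b\<in>B. \<forall>\<^sub>F z in F. z \<in> D b)"
proof (intro exI conjI ballI)
  let ?F = "INF b\<in>B. principal (D b)"
  have *: "eventually P ?F \<longleftrightarrow> (\<exists>b\<in>B. eventually P (principal (D b)))" for P
    by (rule eventually_INF_base[OF B]) (use dir in auto)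
  show "?F \<noteq> bot"
    unfolding trivial_limit_def * eventually_principal using D by blast
  show "\<forall>\<^sub>F z in ?F. z \<in> D b" if "b \<in> B" for b
    unfolding * eventually_principal using that by blast
qed

context group_algebra
begin

text \<open>Enlarging S and shrinking e directs the approximants. Along the resulting filter,
  convergence at group elements holds by the choice of tolerance, and uniform bounds carry it over
  to the whole algebra.\<close>

lemma property_F_I:
  assumes approx: "\<And>S e. finite S \<Longrightarrow> S \<subseteq> carrier G \<Longrightarrow> 0 < e \<Longrightarrow> \<exists>n \<phi>. pd_approx G {..<n :: nat} \<phi> S e"
  shows "property_F G"
proof -
  define B where "B = {(S, e :: real). finite S \<and> S \<subseteq> carrier G \<and> 0 < e}"
  define D where "D = (\<lambda>(S, e). {(n, \<Phi>). \<exists>\<phi>. pd_approx G {..<n} \<phi> S e \<and> \<Phi> = pd_matrix.Phi n \<phi>})"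
  have "\<exists>F. F \<noteq> bot \<and> (\<forall>b\<in>B. \<forall>\<^sub>F z in F. z \<in> D b)"
  proof (rule directed_sets_filter)
    have "({}, 1) \<in> B" by (simp add: B_def)
    thus "B \<noteq> {}" by blast
    show "D b \<noteq> {}" if "b \<in> B" for b using that approx by (fastforce simp: B_def D_def)
    fix a b assume "a \<in> B" "b \<in> B"
    then obtain S e T d where *: "a = (S, e)" "b = (T, d)" "finite S" "finite T"
      "S \<subseteq> carrier G" "T \<subseteq> carrier G" "0 < e" "0 < d" by (auto simp: B_def)
    show "\<exists>c\<in>B. D c \<subseteq> D a \<inter> D b"
    proof (intro bexI[of _ "(S \<union> T, min e d)"] subsetI)
      show "(S \<union> T, min e d) \<in> B" using * by (simp add: B_def)
      fix z assume "z \<in> D (S \<union> T, min e d)"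
      thus "z \<in> D a \<inter> D b" unfolding * D_def by (auto intro!: exI elim!: pd_approx_mono)
    qed
  qed
  then obtain F where F: "F \<noteq> bot" and ev: "\<And>S e. finite S \<Longrightarrow> S \<subseteq> carrier G \<Longrightarrow> 0 < e \<Longrightarrow>
      \<forall>\<^sub>F z in F. z \<in> D (S, e)" by (auto simp: B_def)
  have mat: "pd_matrix G n \<phi> \<and> 0 < n" if "pd_approx G {..<n} \<phi> S e" for n \<phi> S e
    using that unfolding pd_approx_def
    by (auto intro!: pd_matrix.intro pd_function.intro pd_function_axioms.intro group_algebra_axioms)
  \<comment> \<open>What every approximant satisfies regardless of its tolerance: it comes from a
    normalized positive definite function. Complete positivity and the bounds uniform along the
    filter follow from this alone.\<close>
  define good where "good z = (\<exists>\<phi>. pd_matrix G (fst z) \<phi> \<and> 0 < fst z \<and> snd z = pd_matrix.Phi (fst z) \<phi>)"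
    for z :: "nat \<times> ((nat \<Rightarrow> 'a \<Rightarrow> complex) set \<Rightarrow> complex mat)"
  have good: "\<forall>\<^sub>F z in F. good z"
  proof (rule eventually_mono[OF ev[of "{}" 1]])
    fix z assume "z \<in> D ({}, 1)"
    then obtain \<phi> where "pd_approx G {..<fst z} \<phi> {} 1" "snd z = pd_matrix.Phi (fst z) \<phi>"
      by (auto simp: D_def)
    thus "good z" using mat unfolding good_def by blast
  qed simp_all
  define t where "t z x = cmod (ntr (fst z) (snd z x) - canonical_trace G x)"
    for z :: "nat \<times> ((nat \<Rightarrow> 'a \<Rightarrow> complex) set \<Rightarrow> complex mat)" and x
  define v where "v z x y = norm2 (fst z) (snd z (adj AG x \<otimes>\<^bsub>AG\<^esub> y) - mat_adjoint (snd z x) * snd z y)"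
    for z :: "nat \<times> ((nat \<Rightarrow> 'a \<Rightarrow> complex) set \<Rightarrow> complex mat)" and x y
  have t_dl: "((\<lambda>z. t z (em g)) \<longlongrightarrow> 0) F" if g: "g \<in> carrier G" for g
  proof (rule tendstoI)
    fix e :: real assume e: "e > 0"
    have "\<forall>\<^sub>F z in F. z \<in> D ({g}, e)" using ev[of "{g}" e] g e by blast
    thus "\<forall>\<^sub>F z in F. dist (t z (em g)) 0 < e"
    proof eventually_elim
      case (elim z)
      then obtain n \<phi> where z: "z = (n, pd_matrix.Phi n \<phi>)" and p: "pd_approx G {..<n} \<phi> {g} e"
        by (auto simp: D_def)
      interpret M: pd_matrix G n \<phi> using mat[OF p] by simp
      have "(\<Sum>a<n. M.E a a (em g)) = (\<Sum>a<n. \<phi> g a a)"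
        using g by (intro sum.cong refl) (simp add: M.E_const dl_closed M.coef_dl)
      thus ?case using p g by (simp add: t_def z M.ntr_Phi canonical_trace_em pd_approx_def)
    qed
  qed
  have v_dl: "((\<lambda>z. v z (em g) (em h)) \<longlongrightarrow> 0) F" if g: "g \<in> carrier G" and h: "h \<in> carrier G" for g h
  proof (rule tendstoI)
    fix e :: real assume e: "e > 0"
    \<comment> \<open>\<open>pd_approx\<close> controls the squared norm, so the tolerance requested
      is the square of \<open>e\<close>.\<close>
    hence e2: "0 < e\<^sup>2" by simp
    have "\<forall>\<^sub>F z in F. z \<in> D ({g, h}, e\<^sup>2)" using ev[of "{g, h}" "e\<^sup>2"] g h e2 by blast
    thus "\<forall>\<^sub>F z in F. dist (v z (em g) (em h)) 0 < e"
    proof eventually_elim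
      case (elim z)
      then obtain n \<phi> where z: "z = (n, pd_matrix.Phi n \<phi>)" and p: "pd_approx G {..<n} \<phi> {g, h} (e\<^sup>2)"
        by (auto simp: D_def)
      interpret M: pd_matrix G n \<phi> using mat[OF p] by simp
      have n: "0 < n" using mat[OF p] by simp
      have "M.defect (em g) (em h) $$ (a, b) = \<phi> (inv g \<otimes> h) a b - (\<Sum>c<n. cnj (\<phi> g c a) * \<phi> h c b)"
        if "a < n" "b < n" for a b
        using g h that by (simp add: M.defect_entry em_closed em_adj_mult M.E_const dl_closed M.coef_dl)
      hence "(norm2 n (M.defect (em g) (em h)))\<^sup>2 = (\<Sum>a<n. \<Sum>b<n. (cmod (\<phi> (inv g \<otimes> h) a b
          - (\<Sum>c<n. cnj (\<phi> g c a) * \<phi> h c b)))\<^sup>2) / n"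
        by (simp add: norm2_sq)
      also have "\<dots> < e\<^sup>2"
        using p n by (simp add: pd_approx_def divide_less_eq)
      finally have "norm2 n (M.defect (em g) (em h)) < e" using e by (simp add: power2_less_imp_less)
      moreover have "v z (em g) (em h) = norm2 n (M.defect (em g) (em h))"
        by (simp add: v_def z M.defect_def)
      ultimately show ?case by (simp add: norm2_nonneg)
    qed
  qed
  have t_lim: "((\<lambda>z. t z x) \<longlongrightarrow> 0) F" if x: "x \<in> carrier AG" for x
  proof (rule seminorm_family_tendsto[where u = t and C = 2, OF _ t_dl x])
    show "\<forall>\<^sub>F z in F. \<forall>x\<in>carrier AG. 0 \<le> t z x \<and> t z x \<le> 2 * nrm AG x \<and>
      (\<forall>c. t z (c \<odot>\<^bsub>AG\<^esub> x) \<le> cmod c * t z x) \<and> (\<forall>y\<in>carrier AG. t z (x \<oplus>\<^bsub>AG\<^esub> y) \<le> t z x + t z y)"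
      using good
    proof eventually_elim
      case (elim z)
      then obtain \<phi> where M: "pd_matrix G (fst z) \<phi>" and n: "0 < fst z" and z: "snd z = pd_matrix.Phi (fst z) \<phi>"
        by (auto simp: good_def)
      interpret M: pd_matrix G "fst z" \<phi> by (rule M)
      have "t z x = cmod (M.trace_defect x)" for x by (simp add: t_def z M.trace_defect_def)
      thus ?case using n by (simp add: M.trace_defect_le M.trace_defect_linear norm_mult norm_triangle_ineq)
    qed
  qed
  have v_ev: "\<forall>\<^sub>F z in F. \<forall>x\<in>carrier AG. \<forall>y\<in>carrier AG. 0 \<le> v z x y \<and> v z x y \<le> 2 * nrm AG x * nrm AG y \<and>
      (\<forall>c. v z (c \<odot>\<^bsub>AG\<^esub> x) y \<le> cmod c * v z x y \<and> v z x (c \<odot>\<^bsub>AG\<^esub> y) \<le> cmod c * v z x y) \<and>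
      (\<forall>w\<in>carrier AG. v z (x \<oplus>\<^bsub>AG\<^esub> w) y \<le> v z x y + v z w y \<and> v z x (y \<oplus>\<^bsub>AG\<^esub> w) \<le> v z x y + v z x w)"
    using good
  proof eventually_elim
    case (elim z)
    then obtain \<phi> where M: "pd_matrix G (fst z) \<phi>" and n: "0 < fst z" and z: "snd z = pd_matrix.Phi (fst z) \<phi>"
      by (auto simp: good_def)
    interpret M: pd_matrix G "fst z" \<phi> by (rule M)
    have "v z x y = norm2 (fst z) (M.defect x y)" for x y by (simp add: v_def z M.defect_def)
    thus ?case using n by (simp add: M.norm2_defect_le M.defect_add M.defect_scale norm2_scale norm2_add norm2_nonneg)
  qed
  \<comment> \<open>The density argument treats one variable at a time: here the first is a group
    element and the second becomes arbitrary; afterwards the second is fixed. Conjugate linearity in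
    the first variable is harmless, as only absolute values of scalars enter.\<close>
  have v_lim1: "((\<lambda>z. v z (em g) y) \<longlongrightarrow> 0) F" if g: "g \<in> carrier G" and y: "y \<in> carrier AG" for g y
  proof (rule seminorm_family_tendsto[where u = "\<lambda>z. v z (em g)" and C = "2 * nrm AG (em g)", OF _ v_dl[OF g] y])
    show "\<forall>\<^sub>F z in F. \<forall>x\<in>carrier AG. 0 \<le> v z (em g) x \<and> v z (em g) x \<le> 2 * nrm AG (em g) * nrm AG x \<and>
      (\<forall>c. v z (em g) (c \<odot>\<^bsub>AG\<^esub> x) \<le> cmod c * v z (em g) x) \<and>
      (\<forall>y\<in>carrier AG. v z (em g) (x \<oplus>\<^bsub>AG\<^esub> y) \<le> v z (em g) x + v z (em g) y)"
      using v_ev by eventually_elim (use em_closed[OF g] in blast)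
  qed
  have v_lim: "((\<lambda>z. v z x y) \<longlongrightarrow> 0) F" if x: "x \<in> carrier AG" and y: "y \<in> carrier AG" for x y
  proof (rule seminorm_family_tendsto[where u = "\<lambda>z x. v z x y" and C = "2 * nrm AG y", OF _ v_lim1[OF _ y] x])
    show "\<forall>\<^sub>F z in F. \<forall>x\<in>carrier AG. 0 \<le> v z x y \<and> v z x y \<le> 2 * nrm AG y * nrm AG x \<and>
      (\<forall>c. v z (c \<odot>\<^bsub>AG\<^esub> x) y \<le> cmod c * v z x y) \<and>
      (\<forall>w\<in>carrier AG. v z (x \<oplus>\<^bsub>AG\<^esub> w) y \<le> v z x y + v z w y)"
      using v_ev
    proof eventually_elim
      case (elim z)
      have "v z x y \<le> 2 * nrm AG y * nrm AG x" if "x \<in> carrier AG" for x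
      proof -
        have "v z x y \<le> 2 * nrm AG x * nrm AG y" using elim that y by blast
        thus ?thesis by (simp add: mult_ac)
      qed
      thus ?case using elim y by blast
    qed
  qed
  show ?thesis
    unfolding property_F_def amenable_trace_def
  proof (intro conjI exI[of _ F] ballI)
    show "unital_cstar_algebra AG" by (rule group_cstar_is_cstar)
    show "tracial_state AG (canonical_trace G)" by (rule tracial_state_canonical_trace)
    show "F \<noteq> bot" by (rule F)
    show "\<forall>\<^sub>F (n, \<phi>) in F. 0 < n \<and> ucp AG (complex_mat_alg n) \<phi>"
      using good by eventually_elim (auto simp: good_def pd_matrix.ucp_Phi)
    fix a assume a: "a \<in> carrier AG"
    have "((\<lambda>z. ntr (fst z) (snd z a) - canonical_trace G a) \<longlongrightarrow> 0) F"
      using t_lim[OF a] unfolding t_def by (rule tendsto_norm_zero_cancel)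
    thus "((\<lambda>(n, \<phi>). ntr n (\<phi> a)) \<longlongrightarrow> canonical_trace G a) F"
      by (simp add: case_prod_unfold LIM_zero_cancel)
    fix b assume b: "b \<in> carrier AG"
    show "((\<lambda>(n, \<phi>). norm2 n (\<phi> (adj AG a \<otimes>\<^bsub>AG\<^esub> b) - mat_adjoint (\<phi> a) * \<phi> b)) \<longlongrightarrow> 0) F"
      using v_lim[OF a b] by (simp add: v_def case_prod_unfold)
  qed
qed

text \<open>The matrix \<open>(u\<^sub>i\<^sup>* u\<^sub>j)\<close> is \<open>Y\<^sup>* Y\<close>, where \<open>Y\<close> has first row \<open>(u\<^sub>j)\<close> and all other rows zero.\<close>

lemma ucp_pd:
  assumes ucp: "ucp AG (complex_mat_alg n) \<Phi>"
  shows "pd G {..<n} (\<lambda>g a b. \<Phi> (em g) $$ (a, b))"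
  unfolding pd_def
proof (intro allI impI)
  fix F assume F: "finite F \<and> F \<subseteq> carrier G"
  define m where "m = card F"
  obtain g where g: "bij_betw g {..<m} F"
    using F ex_bij_betw_nat_finite[of F] by (auto simp: m_def lessThan_atLeast0)
  have gc: "g i \<in> carrier G" if "i < m" for i using g F that by (auto simp: bij_betw_def)
  define X where "X = mat m m (\<lambda>(i, j). em (inv (g i) \<otimes> g j))"
  have "positive_elem (matrix_alg m AG) X"
  proof -
    let ?Y = "\<lambda>k i. if k = (0 :: nat) then em (g i) else \<zero>\<^bsub>AG\<^esub>"
    note I = positive_elem_matrix_algI[OF A.R.abelian_monoid_axioms A.adj_closed A.R.m_closed, where Y = ?Y and m = m]
    have 1: "X \<in> carrier_mat m m" by (simp add: X_def)
    have 2: "?Y k i \<in> carrier AG" if "k < m" "i < m" for k i using that gc by (simp add: em_closed)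
    have 3: "X $$ (i, j) = (\<Oplus>\<^bsub>AG\<^esub>k\<in>{..<m}. adj AG (?Y k i) \<otimes>\<^bsub>AG\<^esub> ?Y k j)"
      if ij: "i < m" "j < m" for i j
    proof -
      have "(\<Oplus>\<^bsub>AG\<^esub>k\<in>{..<m}. adj AG (?Y k i) \<otimes>\<^bsub>AG\<^esub> ?Y k j)
         = (\<Oplus>\<^bsub>AG\<^esub>k\<in>{..<m}. if 0 = k then adj AG (em (g i)) \<otimes>\<^bsub>AG\<^esub> em (g j) else \<zero>\<^bsub>AG\<^esub>)"
        by (rule A.R.finsum_cong') (use ij gc in \<open>auto simp: A.adj_zero em_closed A.adj_closed\<close>)
      also have "\<dots> = adj AG (em (g i)) \<otimes>\<^bsub>AG\<^esub> em (g j)"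
        by (rule A.R.finsum_singleton) (use ij gc in \<open>auto simp: em_closed A.adj_closed\<close>)
      finally show ?thesis
        using ij gc by (simp add: X_def em_adj_mult)
    qed
    show ?thesis by (rule I) (use 1 2 3 in auto)
  qed
  hence "positive_elem (matrix_alg m (complex_mat_alg n)) (map_mat \<Phi> X)"
    using ucp unfolding ucp_def completely_positive_def by blast
  hence psd: "psd ({..<m} \<times> {..<n}) (\<lambda>(i, a) (j, b). map_mat \<Phi> X $$ (i, j) $$ (a, b))"
    by (rule positive_matrix_imp_psd)
  \<comment> \<open>Complete positivity speaks of matrices indexed by numbers; the kernel is carried
    back to \<open>F\<close> along the inverse of its enumeration.\<close>
  define f where "f = (\<lambda>(h, a :: nat). (inv_into {..<m} g h, a))"
  have gi: "inv_into {..<m} g h < m" "g (inv_into {..<m} g h) = h" if "h \<in> F" for h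
    using that g inv_into_into[of h g "{..<m}"] f_inv_into_f[of h g "{..<m}"] by (auto simp: bij_betw_def)
  have "f ` (F \<times> {..<n}) \<subseteq> {..<m} \<times> {..<n}" using gi by (auto simp: f_def)
  hence ps: "psd (f ` (F \<times> {..<n})) (\<lambda>(i, a) (j, b). map_mat \<Phi> X $$ (i, j) $$ (a, b))"
    by (intro psd_subset[OF _ _ psd]) simp_all
  have 1: "psd (F \<times> {..<n}) (\<lambda>p q. (\<lambda>(i, a) (j, b). map_mat \<Phi> X $$ (i, j) $$ (a, b)) (f p) (f q))"
    by (rule psd_comp[OF _ ps]) (use F in simp)
  have 2: "(\<lambda>(i, a) (j, b). map_mat \<Phi> X $$ (i, j) $$ (a, b)) (f p) (f q)
      = (\<lambda>(g, a) (h, b). \<Phi> (em (inv g \<otimes> h)) $$ (a, b)) p q"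
    if "p \<in> F \<times> {..<n}" "q \<in> F \<times> {..<n}" for p q
    using that gi by (auto simp: f_def X_def)
  show "psd (F \<times> {..<n}) (\<lambda>(g, a) (h, b). \<Phi> (em (inv g \<otimes> h)) $$ (a, b))"
    by (rule psd_cong[THEN iffD1, OF 2 1])
qed

text \<open>A finite set yields finitely many conditions, each of which holds eventually; a proper
  filter has a point where all hold at once, and that map restricted to group elements is the
  approximant.\<close>

lemma property_F_D:
  assumes "property_F G" and S: "finite S" "S \<subseteq> carrier G" and e: "0 < e"
  shows "\<exists>n \<phi>. pd_approx G {..<n :: nat} \<phi> S e"
proof -
  obtain F where F: "F \<noteq> bot" "\<forall>\<^sub>F (n, \<Phi>) in F. 0 < n \<and> ucp AG (complex_mat_alg n) \<Phi>"
    and t: "\<And>a. a \<in> carrier AG \<Longrightarrow> ((\<lambda>(n, \<Phi>). ntr n (\<Phi> a)) \<longlongrightarrow> canonical_trace G a) F"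
    and v: "\<And>a b. a \<in> carrier AG \<Longrightarrow> b \<in> carrier AG \<Longrightarrow>
       ((\<lambda>(n, \<Phi>). norm2 n (\<Phi> (adj AG a \<otimes>\<^bsub>AG\<^esub> b) - mat_adjoint (\<Phi> a) * \<Phi> b)) \<longlongrightarrow> 0) F"
    using assms(1) unfolding property_F_def amenable_trace_def by blast
  have 1: "\<forall>\<^sub>F z in F. \<forall>g\<in>S. dist (ntr (fst z) (snd z (em g))) (canonical_trace G (em g)) < e"
  proof (rule eventually_ball_finite[OF S(1)], rule ballI)
    fix g assume "g \<in> S"
    hence "em g \<in> carrier AG" using S by (intro em_closed) auto
    from tendstoD[OF t[OF this] e] show "\<forall>\<^sub>F z in F. dist (ntr (fst z) (snd z (em g))) (canonical_trace G (em g)) < e"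
      by (simp add: case_prod_unfold)
  qed
  \<comment> \<open>The square root compensates for \<open>pd_approx\<close> bounding the square of
    this norm.\<close>
  have 2: "\<forall>\<^sub>F z in F. \<forall>g\<in>S. \<forall>h\<in>S. norm2 (fst z) (snd z (adj AG (em g) \<otimes>\<^bsub>AG\<^esub> em h)
      - mat_adjoint (snd z (em g)) * snd z (em h)) < sqrt e"
  proof (intro eventually_ball_finite[OF S(1)] ballI)
    fix g h assume "g \<in> S" "h \<in> S"
    hence "em g \<in> carrier AG" "em h \<in> carrier AG" using S by (auto intro!: em_closed)
    from order_tendstoD(2)[OF v[OF this], of "sqrt e"] e
    show "\<forall>\<^sub>F z in F. norm2 (fst z) (snd z (adj AG (em g) \<otimes>\<^bsub>AG\<^esub> em h)
      - mat_adjoint (snd z (em g)) * snd z (em h)) < sqrt e"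
      by (simp add: case_prod_unfold)
  qed
  have "\<forall>\<^sub>F z in F. 0 < fst z \<and> ucp AG (complex_mat_alg (fst z)) (snd z)"
    using F(2) by (simp add: case_prod_unfold)
  from eventually_happens'[OF F(1) eventually_conj[OF this eventually_conj[OF 1 2]]]
  obtain n \<Phi> where n: "0 < n" and ucp: "ucp AG (complex_mat_alg n) \<Phi>"
    and t: "\<And>g. g \<in> S \<Longrightarrow> dist (ntr n (\<Phi> (em g))) (canonical_trace G (em g)) < e"
    and v: "\<And>g h. g \<in> S \<Longrightarrow> h \<in> S \<Longrightarrow> norm2 n (\<Phi> (adj AG (em g) \<otimes>\<^bsub>AG\<^esub> em h)
      - mat_adjoint (\<Phi> (em g)) * \<Phi> (em h)) < sqrt e" by auto
  have c: "\<Phi> (em g) \<in> carrier_mat n n" if "g \<in> carrier G" for g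
    using ucp em_closed[OF that] unfolding ucp_def linear_on_def by auto
  have "pd_approx G {..<n} (\<lambda>g a b. \<Phi> (em g) $$ (a, b)) S e"
    unfolding pd_approx_def
  proof (intro conjI ballI)
    show "pd G {..<n} (\<lambda>g a b. \<Phi> (em g) $$ (a, b))" by (rule ucp_pd[OF ucp])
    show "{..<n} \<noteq> {}" using n by auto
    show "\<Phi> (em \<one>) $$ (a, b) = (if a = b then 1 else 0)" if "a \<in> {..<n}" "b \<in> {..<n}" for a b
    proof -
      have "\<Phi> (em \<one>) = 1\<^sub>m n" using ucp by (simp add: ucp_def AG_ops(5))
      thus ?thesis using that by simp
    qed
    show "cmod ((\<Sum>a\<in>{..<n}. \<Phi> (em g) $$ (a, a)) / of_nat (card {..<n}) - (if g = \<one> then 1 else 0)) < e"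
      if "g \<in> S" for g
      using t[OF that] that S by (simp add: dist_norm ntr_def canonical_trace_em subsetD)
    fix g h assume gh: "g \<in> S" "h \<in> S"
    hence gc: "g \<in> carrier G" "h \<in> carrier G" "inv g \<otimes> h \<in> carrier G" using S by auto
    let ?D = "\<Phi> (em (inv g \<otimes> h)) - mat_adjoint (\<Phi> (em g)) * \<Phi> (em h)"
    have P: "mat_adjoint (\<Phi> (em g)) * \<Phi> (em h) \<in> carrier_mat n n"
      by (rule mult_carrier_mat[OF mat_adjoint_carrier]) (use c gc in auto)
    have D: "?D \<in> carrier_mat n n" using P by (rule minus_carrier_mat)
    have "?D $$ (a, b) = \<Phi> (em (inv g \<otimes> h)) $$ (a, b) - (\<Sum>k<n. cnj (\<Phi> (em g) $$ (k, a)) * \<Phi> (em h) $$ (k, b))"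
      if "a < n" "b < n" for a b
    proof -
      have "?D $$ (a, b) = \<Phi> (em (inv g \<otimes> h)) $$ (a, b) - (mat_adjoint (\<Phi> (em g)) * \<Phi> (em h)) $$ (a, b)"
        using P that by (intro index_minus_mat(1)) auto
      thus ?thesis using that c gc by (simp add: mat_mult_entry[of _ n] mat_adjoint_entry[of _ n] del: index_mult_mat(1))
    qed
    hence "(norm2 n ?D)\<^sup>2 = (\<Sum>a<n. \<Sum>b<n. (cmod (\<Phi> (em (inv g \<otimes> h)) $$ (a, b)
        - (\<Sum>k<n. cnj (\<Phi> (em g) $$ (k, a)) * \<Phi> (em h) $$ (k, b))))\<^sup>2) / n"
      by (simp add: norm2_sq[OF D])
    moreover have "(norm2 n ?D)\<^sup>2 < e"
    proof -
      have "norm2 n ?D < sqrt e" using v[OF gh] gc by (simp add: em_adj_mult)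
      hence "(norm2 n ?D)\<^sup>2 < (sqrt e)\<^sup>2" using norm2_nonneg[OF D] by (intro power_strict_mono) auto
      thus ?thesis using e by simp
    qed
    ultimately show "(\<Sum>a\<in>{..<n}. \<Sum>b\<in>{..<n}. (cmod (\<Phi> (em (inv g \<otimes> h)) $$ (a, b)
        - (\<Sum>c\<in>{..<n}. cnj (\<Phi> (em g) $$ (c, a)) * \<Phi> (em h) $$ (c, b))))\<^sup>2) < e * card {..<n}"
      using n by (simp add: divide_less_eq)
  qed simp
  thus ?thesis by blast
qed

end

text \<open>Product index sets arise from the tensor product, whereas maps into matrix algebras need
  indices below some number.\<close>

lemma pd_approx_reindex:
  fixes I :: "'i set"
  assumes A: "pd_approx G I \<phi> S e"
  shows "\<exists>\<phi>'. pd_approx G {..<card I} \<phi>' S e"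
proof -
  have I: "finite I" "I \<noteq> {}" using A by (simp_all add: pd_approx_def)
  obtain h where h: "bij_betw h {..<card I} I"
    using ex_bij_betw_nat_finite[OF I(1)] by (auto simp: lessThan_atLeast0)
  have hI: "h a \<in> I" if "a < card I" for a using h that by (auto simp: bij_betw_def)
  have sum: "(\<Sum>a<card I. f (h a)) = sum f I" for f :: "'i \<Rightarrow> complex"
    by (rule sum.reindex_bij_betw[OF h])
  have sum': "(\<Sum>a<card I. f (h a)) = sum f I" for f :: "'i \<Rightarrow> real"
    by (rule sum.reindex_bij_betw[OF h])
  have "pd_approx G {..<card I} (\<lambda>g a b. \<phi> g (h a) (h b)) S e"
    unfolding pd_approx_def
  proof (intro conjI ballI)
    show "{..<card I} \<noteq> {}" using I by (simp add: lessThan_empty_iff)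
    show "pd G {..<card I} (\<lambda>g a b. \<phi> g (h a) (h b))"
      unfolding pd_def
    proof (intro allI impI)
      fix F assume F: "finite F \<and> F \<subseteq> carrier G"
      let ?K = "\<lambda>(g, a) (h, b). \<phi> (inv\<^bsub>G\<^esub> g \<otimes>\<^bsub>G\<^esub> h) a b"
      let ?f = "\<lambda>(g, a). (g, h a)"
      have "psd (F \<times> I) ?K" using A F by (simp add: pd_approx_def pd_def)
      hence 1: "psd (?f ` (F \<times> {..<card I})) ?K"
        by (rule psd_subset[rotated 2]) (use F I hI in auto)
      have 2: "psd (F \<times> {..<card I}) (\<lambda>p q. ?K (?f p) (?f q))"
        by (rule psd_comp[OF _ 1]) (use F in simp)
      show "psd (F \<times> {..<card I}) (\<lambda>(g, a) (k, b). \<phi> (inv\<^bsub>G\<^esub> g \<otimes>\<^bsub>G\<^esub> k) (h a) (h b))"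
        by (rule psd_cong[THEN iffD1, OF _ 2]) auto
    qed
    show "\<phi> \<one>\<^bsub>G\<^esub> (h a) (h b) = (if a = b then 1 else 0)" if "a \<in> {..<card I}" "b \<in> {..<card I}" for a b
      using A that hI h by (auto simp: pd_approx_def bij_betw_def inj_on_def)
    show "cmod ((\<Sum>a<card I. \<phi> g (h a) (h a)) / of_nat (card {..<card I}) - (if g = \<one>\<^bsub>G\<^esub> then 1 else 0)) < e"
      if "g \<in> S" for g
      using A that sum[of "\<lambda>a. \<phi> g a a"] by (simp add: pd_approx_def)
    fix g k assume "g \<in> S" "k \<in> S"
    hence "(\<Sum>a\<in>I. \<Sum>b\<in>I. (cmod (\<phi> (inv\<^bsub>G\<^esub> g \<otimes>\<^bsub>G\<^esub> k) a b
        - (\<Sum>c\<in>I. cnj (\<phi> g c a) * \<phi> k c b)))\<^sup>2) < e * card I"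
      using A by (simp add: pd_approx_def)
    thus "(\<Sum>a<card I. \<Sum>b<card I. (cmod (\<phi> (inv\<^bsub>G\<^esub> g \<otimes>\<^bsub>G\<^esub> k) (h a) (h b)
        - (\<Sum>c<card I. cnj (\<phi> g (h c) (h a)) * \<phi> k (h c) (h b))))\<^sup>2) < e * card {..<card I}"
      by (simp only: sum[symmetric] sum'[symmetric] card_lessThan)
  qed simp
  thus ?thesis by blast
qed

section \<open>Semidirect products\<close>

text \<open>The new function is the tensor product of the permutation matrix of \<open>g\<close> on
  \<open>J\<close> with \<phi>(\<kappa> g). The permutation part is an exact unitary representation,
  so neither positivity nor the tolerance \<open>e\<close> deteriorates.\<close>

lemma pd_approx_action:
  assumes "group \<Gamma>" "group K" and \<kappa>: "\<kappa> \<in> hom \<Gamma> K"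
    and J: "finite J" "J \<noteq> {}"
    and act: "\<And>g C. g \<in> carrier \<Gamma> \<Longrightarrow> C \<in> J \<Longrightarrow> \<alpha> g C \<in> J"
      "\<And>g h C. g \<in> carrier \<Gamma> \<Longrightarrow> h \<in> carrier \<Gamma> \<Longrightarrow> C \<in> J \<Longrightarrow> \<alpha> (g \<otimes>\<^bsub>\<Gamma>\<^esub> h) C = \<alpha> g (\<alpha> h C)"
      "\<And>C. C \<in> J \<Longrightarrow> \<alpha> \<one>\<^bsub>\<Gamma>\<^esub> C = C"
    and S: "S \<subseteq> carrier \<Gamma>" and e: "0 < e"
    and free: "\<And>g C. g \<in> S \<Longrightarrow> \<kappa> g = \<one>\<^bsub>K\<^esub> \<Longrightarrow> g \<noteq> \<one>\<^bsub>\<Gamma>\<^esub> \<Longrightarrow> C \<in> J \<Longrightarrow> \<alpha> g C \<noteq> C"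
    and A: "pd_approx K I \<phi> (\<kappa> ` S) e"
  shows "pd_approx \<Gamma> (J \<times> I) (\<lambda>g (C, a) (D, b). if C = \<alpha> g D then \<phi> (\<kappa> g) a b else 0) S e"
proof -
  interpret \<Gamma>: group \<Gamma> by fact
  interpret K: group K by fact
  interpret \<kappa>: group_hom \<Gamma> K \<kappa> by unfold_locales (rule \<kappa>)
  have I: "finite I" "I \<noteq> {}" using A by (simp_all add: pd_approx_def)
  have cI: "card I > 0" "card J > 0" using I J by (simp_all add: card_gt_0_iff)
  \<comment> \<open>Turns the condition for a nonzero entry at inv g h into the symmetric form in
    which one quantity is computed from (g, C) and compared with the same quantity for (h, D), as
    \<open>psd_block\<close> requires.\<close>
  have act_iff: "C = \<alpha> (inv\<^bsub>\<Gamma>\<^esub> g \<otimes>\<^bsub>\<Gamma>\<^esub> h) D \<longleftrightarrow> \<alpha> g C = \<alpha> h D"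
    if gh: "g \<in> carrier \<Gamma>" "h \<in> carrier \<Gamma>" and CD: "C \<in> J" "D \<in> J" for g h C D
  proof
    assume "C = \<alpha> (inv\<^bsub>\<Gamma>\<^esub> g \<otimes>\<^bsub>\<Gamma>\<^esub> h) D"
    hence "\<alpha> g C = \<alpha> (g \<otimes>\<^bsub>\<Gamma>\<^esub> (inv\<^bsub>\<Gamma>\<^esub> g \<otimes>\<^bsub>\<Gamma>\<^esub> h)) D" using gh CD by (simp add: act(2))
    thus "\<alpha> g C = \<alpha> h D" using gh by (simp flip: \<Gamma>.m_assoc)
  next
    assume *: "\<alpha> g C = \<alpha> h D"
    have "C = \<alpha> (inv\<^bsub>\<Gamma>\<^esub> g \<otimes>\<^bsub>\<Gamma>\<^esub> g) C" using gh CD by (simp add: act(3))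
    also have "\<dots> = \<alpha> (inv\<^bsub>\<Gamma>\<^esub> g) (\<alpha> h D)" using gh CD by (simp only: act(2) \<Gamma>.inv_closed *)
    also have "\<dots> = \<alpha> (inv\<^bsub>\<Gamma>\<^esub> g \<otimes>\<^bsub>\<Gamma>\<^esub> h) D" using gh CD by (simp add: act(2))
    finally show "C = \<alpha> (inv\<^bsub>\<Gamma>\<^esub> g \<otimes>\<^bsub>\<Gamma>\<^esub> h) D" .
  qed
  define \<Phi> where "\<Phi> g = (\<lambda>(C, a) (D, b). if C = \<alpha> g D then \<phi> (\<kappa> g) a b else 0)" for g
  have "pd_approx \<Gamma> (J \<times> I) \<Phi> S e"
    unfolding pd_approx_def
  proof (intro conjI ballI)
    show "finite (J \<times> I)" "J \<times> I \<noteq> {}" using I J by auto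
    show "pd \<Gamma> (J \<times> I) \<Phi>"
      unfolding pd_def
    proof (intro allI impI)
      fix F assume F: "finite F \<and> F \<subseteq> carrier \<Gamma>"
      let ?K = "\<lambda>(g, a) (h, b). \<phi> (inv\<^bsub>K\<^esub> g \<otimes>\<^bsub>K\<^esub> h) a b"
      \<comment> \<open>The kernel on \<Gamma> is the kernel of \<phi> pulled back along \<kappa>
        and then restricted to pairs for which the translates of C and D coincide.\<close>
      let ?f = "\<lambda>(g, C, a). (\<kappa> g, a)" and ?e = "\<lambda>(g, C, a). \<alpha> g C"
      have "\<kappa> ` F \<subseteq> carrier K" using F \<kappa>.hom_closed by blast
      hence "psd (\<kappa> ` F \<times> I) ?K" using A F by (simp add: pd_approx_def pd_def)
      hence 1: "psd (?f ` (F \<times> J \<times> I)) ?K"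
        by (rule psd_subset[rotated 2]) (use F I in auto)
      have 2: "psd (F \<times> J \<times> I) (\<lambda>p q. ?K (?f p) (?f q))"
        by (rule psd_comp[OF _ 1]) (use F I J in simp)
      have 3: "psd (F \<times> J \<times> I) (\<lambda>p q. if ?e p = ?e q then ?K (?f p) (?f q) else 0)"
        by (rule psd_block[OF _ 2]) (use F I J in simp)
      show "psd (F \<times> J \<times> I) (\<lambda>(g, a) (h, b). \<Phi> (inv\<^bsub>\<Gamma>\<^esub> g \<otimes>\<^bsub>\<Gamma>\<^esub> h) a b)"
      proof (rule psd_cong[THEN iffD1, OF _ 3])
        fix p q assume "p \<in> F \<times> J \<times> I" "q \<in> F \<times> J \<times> I"
        then obtain g C a h D b where p: "p = (g, C, a)" "q = (h, D, b)" "g \<in> F" "h \<in> F"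
          "C \<in> J" "D \<in> J" by auto
        hence gh: "g \<in> carrier \<Gamma>" "h \<in> carrier \<Gamma>" using F by auto
        show "(if ?e p = ?e q then ?K (?f p) (?f q) else 0)
            = (\<lambda>(g, a) (h, b). \<Phi> (inv\<^bsub>\<Gamma>\<^esub> g \<otimes>\<^bsub>\<Gamma>\<^esub> h) a b) p q"
          using gh by (simp add: p(1,2) \<Phi>_def act_iff[OF gh p(5,6)] \<kappa>.hom_mult)
      qed
    qed
    show "\<Phi> \<one>\<^bsub>\<Gamma>\<^esub> p q = (if p = q then 1 else 0)" if pq: "p \<in> J \<times> I" "q \<in> J \<times> I" for p q
    proof -
      obtain C a D b where p: "p = (C, a)" "q = (D, b)" "D \<in> J" "a \<in> I" "b \<in> I" using pq by auto
      have "\<phi> \<one>\<^bsub>K\<^esub> a b = (if a = b then 1 else 0)" using A p by (simp add: pd_approx_def)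
      thus ?thesis by (cases "a = b") (simp_all add: p(1,2) \<Phi>_def act(3)[OF p(3)])
    qed
  next
    fix g assume g: "g \<in> S"
    define t where "t = (\<Sum>a\<in>I. \<phi> (\<kappa> g) a a) / of_nat (card I)"
    have A': "cmod (t - (if \<kappa> g = \<one>\<^bsub>K\<^esub> then 1 else 0)) < e"
      using A g by (simp add: pd_approx_def t_def)
    define J' where "J' = {C \<in> J. C = \<alpha> g C}"
    have J': "card J' \<le> card J" using J by (auto simp: J'_def intro: card_mono)
    \<comment> \<open>The trace of a tensor product factors, and the trace of a permutation matrix
      counts fixed points.\<close>
    have "(\<Sum>p\<in>J \<times> I. \<Phi> g p p) = (\<Sum>C\<in>J. if C = \<alpha> g C then (\<Sum>a\<in>I. \<phi> (\<kappa> g) a a) else 0)"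
      unfolding sum.cartesian_product' by (intro sum.cong refl) (simp add: \<Phi>_def)
    also have "\<dots> = of_nat (card J') * (\<Sum>a\<in>I. \<phi> (\<kappa> g) a a)"
      using J by (simp add: sum.If_cases J'_def Int_def)
    finally have eq: "(\<Sum>p\<in>J \<times> I. \<Phi> g p p) / of_nat (card (J \<times> I)) = of_real (card J' / card J) * t"
      using cI by (simp add: t_def card_cartesian_product field_simps)
    show "cmod ((\<Sum>p\<in>J \<times> I. \<Phi> g p p) / of_nat (card (J \<times> I)) - (if g = \<one>\<^bsub>\<Gamma>\<^esub> then 1 else 0)) < e"
    proof (cases "\<kappa> g = \<one>\<^bsub>K\<^esub>")
      case False
      hence "g \<noteq> \<one>\<^bsub>\<Gamma>\<^esub>" by auto
      have "cmod (of_real (card J' / card J) * t) = (card J' / card J) * cmod t"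
        by (simp only: norm_mult norm_of_real) simp
      also have "\<dots> \<le> 1 * cmod t" using J' cI by (intro mult_right_mono) (auto simp: divide_le_eq)
      finally show ?thesis unfolding eq using A' False \<open>g \<noteq> \<one>\<^bsub>\<Gamma>\<^esub>\<close> by simp
    next
      case True
      \<comment> \<open>Here \<phi>(\<kappa> g) is exactly the identity, so the proportion of fixed
        points alone decides: it is 1 for the unit and 0 otherwise.\<close>
      have "t = 1" using A cI True by (simp add: pd_approx_def t_def)
      show ?thesis
      proof (cases "g = \<one>\<^bsub>\<Gamma>\<^esub>")
        case True
        have "J' = J" using True act(3) by (auto simp: J'_def)
        thus ?thesis unfolding eq using True \<open>t = 1\<close> cI e by simp
      next
        case False
        have "J' = {}" using free[OF g True False] unfolding J'_def by fastforce
        thus ?thesis unfolding eq using False e by simp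
      qed
    qed
  next
    fix g h assume gh: "g \<in> S" "h \<in> S"
    hence gc: "g \<in> carrier \<Gamma>" "h \<in> carrier \<Gamma>" using S by auto
    define d where "d a b = \<phi> (inv\<^bsub>K\<^esub> (\<kappa> g) \<otimes>\<^bsub>K\<^esub> \<kappa> h) a b - (\<Sum>c\<in>I. cnj (\<phi> (\<kappa> g) c a) * \<phi> (\<kappa> h) c b)" for a b
    have prod: "(\<Sum>r\<in>J \<times> I. cnj (\<Phi> g r (C, a)) * \<Phi> h r (D, b))
        = (if \<alpha> g C = \<alpha> h D then \<Sum>c\<in>I. cnj (\<phi> (\<kappa> g) c a) * \<phi> (\<kappa> h) c b else 0)"
      if "C \<in> J" "D \<in> J" for C D a b
    proof -
      have "(\<Sum>r\<in>J \<times> I. cnj (\<Phi> g r (C, a)) * \<Phi> h r (D, b))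
        = (\<Sum>E\<in>J. if E = \<alpha> g C then (if \<alpha> g C = \<alpha> h D then \<Sum>c\<in>I. cnj (\<phi> (\<kappa> g) c a) * \<phi> (\<kappa> h) c b else 0) else 0)"
        unfolding sum.cartesian_product' by (intro sum.cong refl) (auto simp: \<Phi>_def)
      thus ?thesis using J act(1)[OF gc(1) that(1)] by simp
    qed
    have entry: "\<Phi> (inv\<^bsub>\<Gamma>\<^esub> g \<otimes>\<^bsub>\<Gamma>\<^esub> h) (C, a) (D, b) - (\<Sum>r\<in>J \<times> I. cnj (\<Phi> g r (C, a)) * \<Phi> h r (D, b))
        = (if D = \<alpha> (inv\<^bsub>\<Gamma>\<^esub> h \<otimes>\<^bsub>\<Gamma>\<^esub> g) C then d a b else 0)"
      if CD: "C \<in> J" "D \<in> J" for C D a b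
    proof -
      have "D = \<alpha> (inv\<^bsub>\<Gamma>\<^esub> h \<otimes>\<^bsub>\<Gamma>\<^esub> g) C \<longleftrightarrow> \<alpha> g C = \<alpha> h D"
        using act_iff[OF gc(2,1) CD(2,1)] by auto
      thus ?thesis
        unfolding prod[OF CD] using act_iff[OF gc CD] gc by (simp add: \<Phi>_def d_def \<kappa>.hom_mult)
    qed
    define P where "P p q = (cmod (\<Phi> (inv\<^bsub>\<Gamma>\<^esub> g \<otimes>\<^bsub>\<Gamma>\<^esub> h) p q
          - (\<Sum>r\<in>J \<times> I. cnj (\<Phi> g r p) * \<Phi> h r q)))\<^sup>2" for p q
    have "(\<Sum>p\<in>J \<times> I. \<Sum>q\<in>J \<times> I. P p q) = (\<Sum>C\<in>J. \<Sum>a\<in>I. \<Sum>D\<in>J. \<Sum>b\<in>I. P (C, a) (D, b))"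
      by (simp add: sum.cartesian_product')
    also have "\<dots> = (\<Sum>C\<in>J. \<Sum>a\<in>I. \<Sum>D\<in>J. \<Sum>b\<in>I. (cmod (if D = \<alpha> (inv\<^bsub>\<Gamma>\<^esub> h \<otimes>\<^bsub>\<Gamma>\<^esub> g) C then d a b else 0))\<^sup>2)"
      by (intro sum.cong refl) (simp only: P_def entry)
    \<comment> \<open>For each C exactly one D contributes, namely the translate of C by inv h g.
      The total is \<open>card J\<close> copies of the defect of \<phi>, and the index set has grown
      by the same factor.\<close>
    also have "\<dots> = (\<Sum>C\<in>J. \<Sum>a\<in>I. \<Sum>b\<in>I. (cmod (d a b))\<^sup>2)"
    proof (intro sum.cong refl)
      fix C a assume "C \<in> J"
      hence "\<alpha> (inv\<^bsub>\<Gamma>\<^esub> h \<otimes>\<^bsub>\<Gamma>\<^esub> g) C \<in> J" using gc by (intro act) auto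
      moreover have "(\<Sum>D\<in>J. \<Sum>b\<in>I. (cmod (if D = \<alpha> (inv\<^bsub>\<Gamma>\<^esub> h \<otimes>\<^bsub>\<Gamma>\<^esub> g) C then d a b else 0))\<^sup>2)
         = (\<Sum>D\<in>J. if D = \<alpha> (inv\<^bsub>\<Gamma>\<^esub> h \<otimes>\<^bsub>\<Gamma>\<^esub> g) C then (\<Sum>b\<in>I. (cmod (d a b))\<^sup>2) else 0)"
        by (intro sum.cong refl) simp
      ultimately show "(\<Sum>D\<in>J. \<Sum>b\<in>I. (cmod (if D = \<alpha> (inv\<^bsub>\<Gamma>\<^esub> h \<otimes>\<^bsub>\<Gamma>\<^esub> g) C then d a b else 0))\<^sup>2)
         = (\<Sum>b\<in>I. (cmod (d a b))\<^sup>2)" using J by simp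
    qed
    also have "\<dots> = card J * (\<Sum>a\<in>I. \<Sum>b\<in>I. (cmod (d a b))\<^sup>2)" by simp
    also have "\<dots> < card J * (e * card I)"
      using A gh cI by (intro mult_strict_left_mono) (simp_all add: pd_approx_def d_def)
    finally show "(\<Sum>p\<in>J \<times> I. \<Sum>q\<in>J \<times> I. (cmod (\<Phi> (inv\<^bsub>\<Gamma>\<^esub> g \<otimes>\<^bsub>\<Gamma>\<^esub> h) p q
          - (\<Sum>r\<in>J \<times> I. cnj (\<Phi> g r p) * \<Phi> h r q)))\<^sup>2) < e * card (J \<times> I)"
      by (simp add: card_cartesian_product mult_ac P_def)
  qed
  thus ?thesis unfolding \<Phi>_def .
qed

section \<open>Finite-index classes defined by homomorphisms into finite groups\<close>

lemma hom_eq_on_generate: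
  assumes "group N" "group Q" "f \<in> hom N Q" "h \<in> hom N Q" "T \<subseteq> carrier N"
    and eq: "\<And>x. x \<in> T \<Longrightarrow> f x = h x" and y: "y \<in> generate N T"
  shows "f y = h y"
proof -
  interpret N: group N by fact
  interpret f: group_hom N Q f by (intro group_hom.intro group_hom_axioms.intro assms)
  interpret h: group_hom N Q h by (intro group_hom.intro group_hom_axioms.intro assms)
  show ?thesis using y
  proof (induction rule: generate.induct)
    case (eng a b)
    hence "a \<in> carrier N" "b \<in> carrier N" using N.generate_in_carrier[OF assms(5)] by blast+
    thus ?case using eng by simp
  qed (use eq assms(5) in \<open>auto simp: subset_iff\<close>)
qed

text \<open>For \<open>y\<close> in \<open>N\<close> and groups \<open>Q x\<close>, this is the
  coset of \<open>y\<close> modulo the common kernel of all homomorphisms into the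
  \<open>Q x\<close>. The later argument needs the set of cosets with its action, so no quotient
  group is formed.\<close>

definition hom_class :: "('a, 'm) monoid_scheme \<Rightarrow> 'x set \<Rightarrow> ('x \<Rightarrow> ('q, 'k) monoid_scheme) \<Rightarrow> 'a \<Rightarrow> 'a set" where
  "hom_class N X Q y = {z \<in> carrier N. \<forall>x\<in>X. \<forall>f\<in>hom N (Q x). f z = f y}"

lemma hom_class_cong:
  assumes "\<And>x f. x \<in> X \<Longrightarrow> f \<in> hom N (Q x) \<Longrightarrow> f y = f z"
  shows "hom_class N X Q y = hom_class N X Q z"
  unfolding hom_class_def by (intro Collect_cong conj_cong ball_cong refl) (simp only: assms)

text \<open>A homomorphism is determined by its values on a finite generating set, so up to equality
  on \<open>N\<close> there are finitely many into each \<open>Q x\<close>, and the class of a point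
  depends only on their finitely many values there.\<close>

lemma finite_hom_classes:
  assumes N: "group N" "finitely_generated N" and X: "finite X"
    and Q: "\<And>x. x \<in> X \<Longrightarrow> group (Q x)" "\<And>x. x \<in> X \<Longrightarrow> finite (carrier (Q x))"
  shows "finite (hom_class N X Q ` carrier N)"
proof -
  obtain T where T: "finite T" "T \<subseteq> carrier N" "generate N T = carrier N"
    using N(2) unfolding finitely_generated_def by blast
  \<comment> \<open>Members of \<open>hom\<close> are unrestricted outside the carrier, so the set
    of homomorphisms itself may be infinite. A finite set of representatives, one for each possible
    restriction to the generators, takes its place.\<close>
  have "\<forall>x\<in>X. \<exists>R. R \<subseteq> hom N (Q x) \<and> finite R \<and> (\<lambda>f. restrict f T) ` hom N (Q x) = (\<lambda>f. restrict f T) ` R"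
  proof
    fix x assume x: "x \<in> X"
    have "(\<lambda>f. restrict f T) ` hom N (Q x) \<subseteq> T \<rightarrow>\<^sub>E carrier (Q x)"
      using T(2) by (auto simp: hom_def)
    moreover have "finite (T \<rightarrow>\<^sub>E carrier (Q x))" using T(1) Q(2)[OF x] by (intro finite_PiE) auto
    ultimately have "finite ((\<lambda>f. restrict f T) ` hom N (Q x))" by (rule finite_subset)
    thus "\<exists>R. R \<subseteq> hom N (Q x) \<and> finite R \<and> (\<lambda>f. restrict f T) ` hom N (Q x) = (\<lambda>f. restrict f T) ` R"
      using finite_subset_image[of "(\<lambda>f. restrict f T) ` hom N (Q x)" "\<lambda>f. restrict f T" "hom N (Q x)"]
      by blast
  qed
  from bchoice[OF this] obtain R where "\<forall>x\<in>X. R x \<subseteq> hom N (Q x) \<and> finite (R x) \<and>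
    (\<lambda>f. restrict f T) ` hom N (Q x) = (\<lambda>f. restrict f T) ` R x" ..
  hence R: "\<And>x. x \<in> X \<Longrightarrow> R x \<subseteq> hom N (Q x)" "\<And>x. x \<in> X \<Longrightarrow> finite (R x)"
    "\<And>x. x \<in> X \<Longrightarrow> (\<lambda>f. restrict f T) ` hom N (Q x) = (\<lambda>f. restrict f T) ` R x" by blast+
  \<comment> \<open>Records the values at \<open>y\<close> of all representatives; being
    extensional, it ranges over a finite product of finite groups.\<close>
  define ev where "ev y = restrict (\<lambda>p. snd p y) (Sigma X R)" for y
  have "ev ` carrier N \<subseteq> (\<Pi>\<^sub>E p\<in>Sigma X R. carrier (Q (fst p)))"
  proof
    fix v assume "v \<in> ev ` carrier N"
    then obtain y where y: "y \<in> carrier N" "v = ev y" by blast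
    have "r y \<in> carrier (Q x)" if "x \<in> X" "r \<in> R x" for x r
      using R(1)[OF that(1)] that(2) y(1) unfolding hom_def by blast
    thus "v \<in> (\<Pi>\<^sub>E p\<in>Sigma X R. carrier (Q (fst p)))" by (auto simp: y(2) ev_def)
  qed
  moreover have "finite (\<Pi>\<^sub>E p\<in>Sigma X R. carrier (Q (fst p)))"
    using X R(2) Q(2) by (intro finite_PiE finite_SigmaI) auto
  ultimately have fin: "finite (ev ` carrier N)" by (rule finite_subset)
  have eq: "hom_class N X Q y = hom_class N X Q z"
    if yz: "y \<in> carrier N" "z \<in> carrier N" "ev y = ev z" for y z
  proof (rule hom_class_cong)
    fix x f assume x: "x \<in> X" and f: "f \<in> hom N (Q x)"
    then obtain r where r: "r \<in> R x" "restrict f T = restrict r T" using R(3)[OF x] by blast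
    have rh: "r \<in> hom N (Q x)" using R(1)[OF x] r(1) by blast
    have fr: "f w = r w" if "w \<in> carrier N" for w
    proof (rule hom_eq_on_generate[OF N(1) Q(1)[OF x] f rh T(2)])
      show "f t = r t" if "t \<in> T" for t using r(2) that by (metis restrict_apply')
    qed (use that T(3) in simp)
    have "r y = r z" using fun_cong[OF yz(3), of "(x, r)"] x r(1) by (simp add: ev_def)
    thus "f y = f z" using fr yz by simp
  qed
  have "hom_class N X Q ` carrier N
      = (\<lambda>v. hom_class N X Q (SOME y. y \<in> carrier N \<and> ev y = v)) ` ev ` carrier N"
    unfolding image_image
  proof (rule image_cong[OF refl])
    fix y assume y: "y \<in> carrier N"
    have "(SOME z. z \<in> carrier N \<and> ev z = ev y) \<in> carrier N \<and> ev (SOME z. z \<in> carrier N \<and> ev z = ev y) = ev y"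
      by (rule someI[of _ y]) (use y in simp)
    thus "hom_class N X Q y = hom_class N X Q (SOME z. z \<in> carrier N \<and> ev z = ev y)"
      using eq[OF y] by metis
  qed
  thus ?thesis using fin by simp
qed

text \<open>The group \<open>\<Gamma>\<close> acts on \<open>N\<close> by \<open>(\<nu>, k) \<cdot> y = \<nu> \<theta>\<^sub>k(y)\<close>. Classes of points of \<open>N\<close> that no
  homomorphism into finitely many fixed finite groups separates are permuted by this action,
  because precomposition with an automorphism preserves the set of all homomorphisms.\<close>

lemma property_F_semidirect:
  fixes N :: "('a, 'm) monoid_scheme" and K :: "('b, 'k) monoid_scheme" and \<Gamma> :: "('c, 'l) monoid_scheme"
  assumes N: "group N" "finitely_generated N" "residually_finite N"
    and K: "group K" "property_F K"
    and \<theta>: "\<theta> \<in> hom K (AutoGroup N)"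
    and \<Gamma>: "group \<Gamma>" and \<psi>: "\<psi> \<in> iso \<Gamma> (semidirect_product N K \<theta>)"
  shows "property_F \<Gamma>"
proof -
  interpret N: group N by (rule N)
  interpret K: group K by (rule K)
  interpret \<Gamma>: group \<Gamma> by (rule \<Gamma>)
  interpret K: group_algebra K by unfold_locales
  interpret \<Gamma>: group_algebra \<Gamma> by unfold_locales
  have th: "\<theta> k \<in> hom N N" "inj_on (\<theta> k) (carrier N)" if "k \<in> carrier K" for k
  proof -
    have "\<theta> k \<in> auto N" using \<theta> that by (auto simp: hom_def AutoGroup_def)
    thus "\<theta> k \<in> hom N N" "inj_on (\<theta> k) (carrier N)" by (auto simp: auto_def Bij_def bij_betw_def)
  qed
  have th_closed: "\<theta> k y \<in> carrier N" if "k \<in> carrier K" "y \<in> carrier N" for k y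
    using th(1)[OF that(1)] that(2) by (auto simp: hom_def)
  have th_hom: "\<theta> k (y \<otimes>\<^bsub>N\<^esub> z) = \<theta> k y \<otimes>\<^bsub>N\<^esub> \<theta> k z" if "k \<in> carrier K" "y \<in> carrier N" "z \<in> carrier N" for k y z
    using th(1)[OF that(1)] that(2,3) by (auto simp: hom_def)
  have th_mult: "\<theta> (k \<otimes>\<^bsub>K\<^esub> l) y = \<theta> k (\<theta> l y)" if kl: "k \<in> carrier K" "l \<in> carrier K" and y: "y \<in> carrier N" for k l y
  proof -
    have "\<theta> k \<in> auto N" "\<theta> l \<in> auto N" using \<theta> kl by (auto simp: hom_def AutoGroup_def)
    moreover have "\<theta> (k \<otimes>\<^bsub>K\<^esub> l) = \<theta> k \<otimes>\<^bsub>AutoGroup N\<^esub> \<theta> l" using \<theta> kl by (simp add: hom_def)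
    ultimately show ?thesis using y by (simp add: AutoGroup_def BijGroup_def auto_def compose_def)
  qed
  \<comment> \<open>The map at the unit is idempotent on \<open>N\<close>, and an injective
    idempotent map is the identity.\<close>
  have th_one: "\<theta> \<one>\<^bsub>K\<^esub> y = y" if y: "y \<in> carrier N" for y
    using th_mult[of "\<one>\<^bsub>K\<^esub>" "\<one>\<^bsub>K\<^esub>" y] th_closed[of "\<one>\<^bsub>K\<^esub>" y] th(2)[of "\<one>\<^bsub>K\<^esub>"] y
    by (simp add: inj_on_eq_iff)
  define \<nu> where "\<nu> g = fst (\<psi> g)" for g
  define \<kappa> where "\<kappa> g = snd (\<psi> g)" for g
  have hom: "\<psi> \<in> hom \<Gamma> (semidirect_product N K \<theta>)" and inj: "inj_on \<psi> (carrier \<Gamma>)"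
    using \<psi> by (auto simp: iso_def bij_betw_def)
  have nk: "\<nu> g \<in> carrier N" "\<kappa> g \<in> carrier K" if "g \<in> carrier \<Gamma>" for g
    using hom that by (auto simp: hom_def semidirect_product_def \<nu>_def \<kappa>_def Pi_def mem_Times_iff)
  have nk_mult: "\<nu> (g \<otimes>\<^bsub>\<Gamma>\<^esub> h) = \<nu> g \<otimes>\<^bsub>N\<^esub> \<theta> (\<kappa> g) (\<nu> h)" "\<kappa> (g \<otimes>\<^bsub>\<Gamma>\<^esub> h) = \<kappa> g \<otimes>\<^bsub>K\<^esub> \<kappa> h"
    if "g \<in> carrier \<Gamma>" "h \<in> carrier \<Gamma>" for g h
    using hom that by (auto simp: hom_def semidirect_product_def \<nu>_def \<kappa>_def case_prod_unfold)
  have \<kappa>: "\<kappa> \<in> hom \<Gamma> K" using nk nk_mult by (auto simp: hom_def)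
  have \<kappa>_one: "\<kappa> \<one>\<^bsub>\<Gamma>\<^esub> = \<one>\<^bsub>K\<^esub>" by (rule hom_one[OF \<kappa> \<Gamma> K(1)])
  have \<nu>_one: "\<nu> \<one>\<^bsub>\<Gamma>\<^esub> = \<one>\<^bsub>N\<^esub>"
    using nk_mult(1)[of "\<one>\<^bsub>\<Gamma>\<^esub>" "\<one>\<^bsub>\<Gamma>\<^esub>"] nk[of "\<one>\<^bsub>\<Gamma>\<^esub>"] by (simp add: \<kappa>_one th_one)
  have eq_one: "g = \<one>\<^bsub>\<Gamma>\<^esub>" if g: "g \<in> carrier \<Gamma>" "\<nu> g = \<one>\<^bsub>N\<^esub>" "\<kappa> g = \<one>\<^bsub>K\<^esub>" for g
  proof -
    have "\<psi> g = \<psi> \<one>\<^bsub>\<Gamma>\<^esub>" using g \<kappa>_one \<nu>_one by (simp add: \<nu>_def \<kappa>_def prod_eq_iff)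
    thus ?thesis using inj g(1) by (simp add: inj_on_eq_iff)
  qed
  define t where "t g y = \<nu> g \<otimes>\<^bsub>N\<^esub> \<theta> (\<kappa> g) y" for g y
  have t_closed: "t g y \<in> carrier N" if "g \<in> carrier \<Gamma>" "y \<in> carrier N" for g y
    using that nk th_closed by (simp add: t_def)
  have t_mult: "t (g \<otimes>\<^bsub>\<Gamma>\<^esub> h) y = t g (t h y)" if "g \<in> carrier \<Gamma>" "h \<in> carrier \<Gamma>" "y \<in> carrier N" for g h y
    using that nk th_closed by (simp add: t_def nk_mult th_mult th_hom N.m_assoc)
  have t_one: "t \<one>\<^bsub>\<Gamma>\<^esub> y = y" if "y \<in> carrier N" for y
    using that by (simp add: t_def \<nu>_one \<kappa>_one th_one)
  show ?thesis
  proof (rule \<Gamma>.property_F_I)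
    fix S and e :: real assume S: "finite S" "S \<subseteq> carrier \<Gamma>" and e: "0 < e"
    have "finite (\<kappa> ` S)" "\<kappa> ` S \<subseteq> carrier K" using S nk by auto
    \<comment> \<open>The tensor product loses nothing, so \<phi> is taken with the final tolerance
      \<open>e\<close> before the permutation action is known.\<close>
    then obtain n \<phi> where A: "pd_approx K {..<n :: nat} \<phi> (\<kappa> ` S) e"
      using K.property_F_D[OF K(2) _ _ e] by blast
    define X where "X = {x \<in> \<nu> ` S. x \<noteq> \<one>\<^bsub>N\<^esub>}"
    have X: "finite X" "X \<subseteq> carrier N" using S nk by (auto simp: X_def)
    have "\<exists>H. H \<lhd> N \<and> finite (carrier (N Mod H)) \<and> H #>\<^bsub>N\<^esub> x \<noteq> \<one>\<^bsub>N Mod H\<^esub>" if "x \<in> X" for x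
      using N(3) that X(2) unfolding residually_finite_def X_def by blast
    then obtain M where M: "\<And>x. x \<in> X \<Longrightarrow> M x \<lhd> N" "\<And>x. x \<in> X \<Longrightarrow> finite (carrier (N Mod M x))"
      "\<And>x. x \<in> X \<Longrightarrow> M x #>\<^bsub>N\<^esub> x \<noteq> \<one>\<^bsub>N Mod M x\<^esub>" by metis
    define Q where "Q x = N Mod M x" for x
    have Q: "group (Q x)" "finite (carrier (Q x))" if "x \<in> X" for x
      using M(1,2)[OF that] by (simp_all add: Q_def normal.factorgroup_is_group)
    let ?cls = "hom_class N X Q"
    define J where "J = ?cls ` carrier N"
    have J: "finite J" "J \<noteq> {}"
      using finite_hom_classes[OF N(1,2) X(1) Q] N.one_closed by (auto simp: J_def)
    have sep: "f (t g y) = f (t g z)"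
      if g: "g \<in> carrier \<Gamma>" and yz: "y \<in> carrier N" "z \<in> carrier N"
        and eq: "\<And>x f. x \<in> X \<Longrightarrow> f \<in> hom N (Q x) \<Longrightarrow> f y = f z" and x: "x \<in> X" and f: "f \<in> hom N (Q x)"
      for g y z x f
    proof -
      have "f \<circ> \<theta> (\<kappa> g) \<in> hom N (Q x)" by (rule Group.hom_compose[OF th(1)[OF nk(2)[OF g]] f])
      from eq[OF x this] have "f (\<theta> (\<kappa> g) y) = f (\<theta> (\<kappa> g) z)" by simp
      \<comment> \<open>The translation part of \<open>t g\<close> multiplies both values on the
        left by the same element \<open>f (\<nu> g)\<close>.\<close>
      thus ?thesis using f g yz nk th_closed by (simp add: t_def hom_def)
    qed
    have image_le: "t g ` ?cls y \<subseteq> ?cls (t g y)" if g: "g \<in> carrier \<Gamma>" and y: "y \<in> carrier N" for g y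
    proof
      fix w assume "w \<in> t g ` ?cls y"
      then obtain z where z: "w = t g z" "z \<in> carrier N" "\<And>x f. x \<in> X \<Longrightarrow> f \<in> hom N (Q x) \<Longrightarrow> f z = f y"
        by (auto simp: hom_class_def)
      have "f (t g z) = f (t g y)" if "x \<in> X" "f \<in> hom N (Q x)" for x f
        by (rule sep[OF g z(2) y _ that]) (rule z(3))
      thus "w \<in> ?cls (t g y)"
        unfolding hom_class_def z(1) using t_closed[OF g z(2)] by blast
    qed
    \<comment> \<open>Equality is what makes the image of a class a class again, so \<Gamma> acts on
      \<open>J\<close> by images of sets and no representatives are chosen. The reverse inclusion is
      \<open>image_le\<close> for the inverse element.\<close>
    have image: "t g ` ?cls y = ?cls (t g y)" if g: "g \<in> carrier \<Gamma>" and y: "y \<in> carrier N" for g y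
    proof
      show "?cls (t g y) \<subseteq> t g ` ?cls y"
      proof
        fix w assume w: "w \<in> ?cls (t g y)"
        hence wN: "w \<in> carrier N" by (simp add: hom_class_def)
        have "t (inv\<^bsub>\<Gamma>\<^esub> g) w \<in> ?cls (t (inv\<^bsub>\<Gamma>\<^esub> g) (t g y))"
          using image_le[of "inv\<^bsub>\<Gamma>\<^esub> g" "t g y"] w g y t_closed by auto
        also have "t (inv\<^bsub>\<Gamma>\<^esub> g) (t g y) = y" using g y t_mult[of "inv\<^bsub>\<Gamma>\<^esub> g" g y] by (simp add: t_one)
        finally have "t (inv\<^bsub>\<Gamma>\<^esub> g) w \<in> ?cls y" .
        moreover have "w = t g (t (inv\<^bsub>\<Gamma>\<^esub> g) w)" using g wN t_mult[of g "inv\<^bsub>\<Gamma>\<^esub> g" w] by (simp add: t_one)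
        ultimately show "w \<in> t g ` ?cls y" by blast
      qed
    qed (rule image_le[OF g y])
    have JN: "C \<subseteq> carrier N" if "C \<in> J" for C using that by (auto simp: J_def hom_class_def)
    have "pd_approx \<Gamma> (J \<times> {..<n}) (\<lambda>g (C, a) (D, b). if C = t g ` D then \<phi> (\<kappa> g) a b else 0) S e"
    proof (rule pd_approx_action[OF \<Gamma> K(1) \<kappa> J _ _ _ S(2) e _ A])
      show "t g ` C \<in> J" if "g \<in> carrier \<Gamma>" "C \<in> J" for g C
        using that by (auto simp: J_def image t_closed)
      show "t (g \<otimes>\<^bsub>\<Gamma>\<^esub> h) ` C = t g ` t h ` C" if "g \<in> carrier \<Gamma>" "h \<in> carrier \<Gamma>" "C \<in> J" for g h C
        unfolding image_image by (rule image_cong[OF refl]) (use that JN t_mult in blast)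
      show "t \<one>\<^bsub>\<Gamma>\<^esub> ` C = C" if "C \<in> J" for C
      proof -
        have "t \<one>\<^bsub>\<Gamma>\<^esub> ` C = (\<lambda>y. y) ` C" by (rule image_cong[OF refl]) (use that JN t_one in blast)
        thus ?thesis by simp
      qed
      show "t g ` C \<noteq> C" if g: "g \<in> S" and k: "\<kappa> g = \<one>\<^bsub>K\<^esub>" and ne: "g \<noteq> \<one>\<^bsub>\<Gamma>\<^esub>" and C: "C \<in> J" for g C
      proof
        assume fix': "t g ` C = C"
        have gc: "g \<in> carrier \<Gamma>" using g S by blast
        \<comment> \<open>As \<open>\<kappa> g\<close> is trivial and \<open>g\<close> is not, the
          \<open>N\<close>-component is nontrivial, so the family \<open>M\<close> contains a
          finite-index subgroup chosen to detect it.\<close>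
        define x where "x = \<nu> g"
        have x: "x \<in> X" "x \<in> carrier N" using g eq_one[OF gc _ k] ne nk(1)[OF gc] by (auto simp: X_def x_def)
        obtain y where y: "y \<in> carrier N" "C = ?cls y" using C by (auto simp: J_def)
        have "y \<in> C" using y by (simp add: hom_class_def)
        hence "t g y \<in> ?cls y" using fix' y(2) by blast
        \<comment> \<open>The coset map of \<open>M x\<close> is one of the homomorphisms by which
          classes are defined. A fixed class would therefore give \<open>x \<otimes> y\<close> and
          \<open>y\<close> the same coset, and cancelling \<open>y\<close> puts \<open>x\<close>
          into \<open>M x\<close>.\<close>
        moreover have f: "(\<lambda>a. M x #>\<^bsub>N\<^esub> a) \<in> hom N (Q x)"
          unfolding Q_def by (rule normal.r_coset_hom_Mod[OF M(1)[OF x(1)]])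
        ultimately have "M x #>\<^bsub>N\<^esub> (t g y) = M x #>\<^bsub>N\<^esub> y" using x(1) by (simp add: hom_class_def)
        moreover have "t g y = x \<otimes>\<^bsub>N\<^esub> y" using y k by (simp add: t_def th_one x_def)
        ultimately have "(M x #>\<^bsub>N\<^esub> x) \<otimes>\<^bsub>Q x\<^esub> (M x #>\<^bsub>N\<^esub> y) = M x #>\<^bsub>N\<^esub> y"
          using f x(2) y(1) by (simp add: hom_def)
        moreover have "M x #>\<^bsub>N\<^esub> x \<in> carrier (Q x)" "M x #>\<^bsub>N\<^esub> y \<in> carrier (Q x)"
          using f x(2) y(1) by (auto simp: hom_def)
        ultimately have "M x #>\<^bsub>N\<^esub> x = \<one>\<^bsub>Q x\<^esub>"
          using group.r_cancel_one[OF Q(1)[OF x(1)]] by metis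
        thus False using M(3)[OF x(1)] by (simp add: Q_def)
      qed
    qed
    from pd_approx_reindex[OF this] show "\<exists>n \<phi>. pd_approx \<Gamma> {..<n :: nat} \<phi> S e" by blast
  qed
qed

theorem proposition4p9:
  fixes N :: "('a, 'm) monoid_scheme"
    and K :: "('b, 'k) monoid_scheme"
    and \<theta> :: "'b \<Rightarrow> 'a \<Rightarrow> 'a"
    and \<Gamma> :: "('c, 'l) monoid_scheme"
  assumes "group N" and "finitely_generated N" and "residually_finite N"
    and "group K" and "property_F K"
    and "\<theta> \<in> hom K (AutoGroup N)"
    and "group \<Gamma>" and "\<Gamma> \<cong> semidirect_product N K \<theta>"
  shows "property_F \<Gamma>"
proof -
  obtain \<psi> where "\<psi> \<in> iso \<Gamma> (semidirect_product N K \<theta>)"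
    using assms(8) by (auto simp: is_iso_def)
  thus ?thesis by (rule property_F_semidirect[OF assms(1-7)])
qed

end
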